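(* Fix $\gamma\in[0,1/2)$ and let $\beta_c=\frac14-\frac{\gamma}{2}$. There exists a function $\varepsilon\mapsto M_\varepsilon\in(0,\infty)$ such that for any sequence $(\beta_n)_{n\ge1}$ of positive reals with $\beta_n\to\beta_c$ and $\limsup_{n\to\infty}4\beta_c(\beta_n-\beta_c)(\log n)^2<\pi^2$, there exists a constant $n_0$ (depending on the sequence but not on $\varepsilon$) such that for all $n\ge n_0$ and all $\varepsilon>0$, $$\mathbb P^{\beta_n}\bigg(|\mathscr L_n|\Big/\frac{\sqrt n/\log n}{\mathrm{Si}\big(4\beta_c(\beta_n-\beta_c)(\log n)^2\big)}\in[1/M_\varepsilon,M_\varepsilon]\bigg)\ge 1-\varepsilon .$$
   Context: $\gamma$-growing random graph with parameter $\beta>0$: the random graph $\mathscr G_n$ on vertex set $[n]=\{1,\dots,n\}$ in which, independently over pairs $i<j$, the edge $\{i,j\}$ is present with probability $p_{ij}=\min(\beta\, i^{-\gamma}j^{\gamma-1},1)$. $\mathbb P^{\beta}$ denotes its law (the dependence on $\gamma$ is suppressed). $\mathscr L_n$ is the largest connected component of $\mathscr G_n$ (arbitrary tie-breaking) and $|\mathscr L_n|$ its number of vertices. Under $\mathbb P^{\beta_n}$ all edges of $\mathscr G_n$ are generated with the same parameter $\beta=\beta_n$. The function $\mathrm{Si}$ (not the sine integral) is $\mathrm{Si}(\alpha)=\sin(\sqrt\alpha)/\sqrt\alpha$ for $\alpha>0$, $\mathrm{Si}(0)=1$, $\mathrm{Si}(\alpha)=\sinh(\sqrt{|\alpha|})/\sqrt{|\alpha|}$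 for $\alpha<0$. *)

theory Defs
  imports "HOL-Probability.Probability" "HOL-Probability.Product_PMF"
begin

definition edge_prob :: "real \<Rightarrow> real \<Rightarrow> nat \<Rightarrow> nat \<Rightarrow> real" where
  "edge_prob \<gamma> \<beta> i j = min (\<beta> * real i powr (- \<gamma>) * real j powr (\<gamma> - 1)) 1"

definition vertex_pairs :: "nat \<Rightarrow> (nat \<times> nat) set" where
  "vertex_pairs n = {(i, j). 1 \<le> i \<and> i < j \<and> j \<le> n}"

text \<open>
  The law of the edge set (a set of two-element subsets of \<open>{1..n}\<close>) of the
  \<open>\<gamma>\<close>-growing random graph with parameter \<open>\<beta>\<close>: the indicators of the pairs are
  independent Bernoulli variables, and the argument \<open>False\<close> of \<open>Pi_pmf\<close> is merely the
  value of the indicator family outside \<open>vertex_pairs n\<close>.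
\<close>

definition growing_graph :: "real \<Rightarrow> real \<Rightarrow> nat \<Rightarrow> nat set set pmf" where
  "growing_graph \<gamma> \<beta> n =
     map_pmf (\<lambda>\<omega>. {{i, j} | i j. (i, j) \<in> vertex_pairs n \<and> \<omega> (i, j)})
       (Pi_pmf (vertex_pairs n) False (\<lambda>(i, j). bernoulli_pmf (edge_prob \<gamma> \<beta> i j)))"

text \<open>
  Vertex sets of the connected components of the graph with vertex set \<open>{1..n}\<close> and edge
  set \<open>E\<close>: the classes of the reachability relation. All edges are assumed to lie within
  \<open>{1..n}\<close>, so that the classes do as well.
\<close>

definition components :: "nat \<Rightarrow> nat set set \<Rightarrow> nat set set" where
  "components n E = {1..n} // {(u, v). {u, v} \<in> E}\<^sup>*"

text \<open>Ties are broken by the choice operator underlying \<open>arg_max\<close>.\<close>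

definition largest_component :: "nat \<Rightarrow> nat set set \<Rightarrow> nat set" where
  "largest_component n E = (ARG_MAX card C. C \<in> components n E)"

text \<open>
  This is the function written \<open>Si\<close> in the source; it is not the sine integral, which is
  what \<open>Si\<close> denotes in \<open>HOL-Probability\<close>.
\<close>

definition sinc_sqrt :: "real \<Rightarrow> real" where
  "sinc_sqrt \<alpha> =
     (if \<alpha> > 0 then sin (sqrt \<alpha>) / sqrt \<alpha>
      else if \<alpha> = 0 then 1
      else sinh (sqrt \<bar>\<alpha>\<bar>) / sqrt \<bar>\<alpha>\<bar>)"

end

theory Submission
  imports Defs "HOL-Real_Asymp.Real_Asymp"
begin

text \<open>
  Removing a vertex \<open>u\<close> from the graph expresses its cluster through the clusters of its
  neighbours. With a BK-type inequality, first and second moments of cluster sizes are bounded by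
  supersolutions \<open>\<phi> \<ge> 1 + K \<phi>\<close> of the operator \<open>K\<close> whose kernel is the edge probability.
  With \<open>a = 1/2 - \<gamma>\<close> and \<open>\<rho> = 2 a \<beta> - a\<^sup>2\<close>, in the variable \<open>ln i\<close> the operator inverts
  \<open>(a\<^sup>2 - d\<^sup>2) / (2 a \<beta>)\<close>, so that sub- and supersolutions come from \<open>u'' = - \<rho> u\<close>; the
  normalisation at \<open>ln n\<close> produces the sine function of the statement.
  The upper bound follows from a bound on the sum of \<open>\<bar>cluster u\<bar>\<^sup>2\<close> over \<open>u\<close>. For the lower bound, restrict
  the graph to the vertices above a constant \<open>A\<close>, where the errors in the first moment recursion
  are of relative order \<open>1 / A\<close>: each of the vertices between \<open>A\<close> and \<open>2 A\<close> has a
  large cluster with probability bounded below, and the variance of their number is \<open>O(A)\<close>.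
\<close>

section \<open>Clusters\<close>

text \<open>Two uniformities shape the constants: \<open>M\<close> may depend only on
  \<open>a\<close> and \<open>\<epsilon>\<close>, and the threshold for \<open>n\<close> must not
  depend on \<open>\<epsilon>\<close>. The sequence therefore enters only through inequalities
  between \<open>\<rho>\<close>, \<open>L = ln n\<close> and \<open>a\<close> that hold eventually
  (locale \<open>profile\<close>). The delicate regime is \<open>\<rho> * L^2\<close> close to
  \<open>pi^2\<close>: there \<open>S L\<close> is far below \<open>L\<close> and \<open>C\<close>
  is negative near the right end. So bounds are expressed through \<open>S\<close> itself, and
  \<open>C\<close> is controlled from below only by \<open>1 \<le> C + (a / 100) S\<close>. The
  supersolution is not a plain solution of the differential equation: a small decaying exponential
  is subtracted, on which the operator has a different eigenvalue, and this leaves a definite gain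
  \<open>rsq i * dec i\<close>. That gain pays for Green's function, and hence for second moments,
  for the variance over the block near \<open>A\<close> and for the errors of the first moment
  recursion. Passing between sums and integrals loses nothing in the wrong direction: the
  supersolution is decreasing, and the subsolution is an integral over unit intervals.\<close>

text \<open>A configuration \<open>G\<close> tells for every pair \<open>(i, j)\<close> with \<open>i < j\<close> whether the edge is present.\<close>

definition opn :: "(nat \<times> nat \<Rightarrow> bool) \<Rightarrow> nat \<Rightarrow> nat \<Rightarrow> bool" where
  "opn G u w \<longleftrightarrow> G (min u w, max u w)"

lemma opn_commute: "opn G u w \<longleftrightarrow> opn G w u"
  by (simp add: opn_def min.commute max.commute)

definition open_rel :: "(nat \<times> nat \<Rightarrow> bool) \<Rightarrow> nat set \<Rightarrow> (nat \<times> nat) set" where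
  "open_rel G S = {(x, y). x \<in> S \<and> y \<in> S \<and> x \<noteq> y \<and> opn G x y}"

text \<open>The vertex set \<open>S\<close> is an argument because the recursions delete a vertex
  and continue in the induced subgraph, while \<open>G\<close> stays the same.\<close>

definition cl :: "(nat \<times> nat \<Rightarrow> bool) \<Rightarrow> nat set \<Rightarrow> nat \<Rightarrow> nat set" where
  "cl G S u = (open_rel G S)\<^sup>* `` {u}"

definition pairs_in :: "nat set \<Rightarrow> (nat \<times> nat) set" where
  "pairs_in S = {(i, j). i \<in> S \<and> j \<in> S \<and> i < j}"

text \<open>Plays the part of measurability with respect to the coordinates in \<open>A\<close>;
  disjoint coordinate sets give independence (\<open>E_indep\<close>).\<close>

definition depends_on :: "((nat \<times> nat \<Rightarrow> bool) \<Rightarrow> 'b) \<Rightarrow> (nat \<times> nat) set \<Rightarrow> bool" where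
  "depends_on F A \<longleftrightarrow> (\<forall>G G'. (\<forall>e\<in>A. G e = G' e) \<longrightarrow> F G = F G')"

lemma depends_onD: "depends_on F A \<Longrightarrow> (\<And>e. e \<in> A \<Longrightarrow> G e = G' e) \<Longrightarrow> F G = F G'"
  unfolding depends_on_def by blast

lemma depends_on_mono: "depends_on F A \<Longrightarrow> A \<subseteq> B \<Longrightarrow> depends_on F B"
  unfolding depends_on_def by blast

lemma depends_on_comp: "depends_on F A \<Longrightarrow> depends_on (\<lambda>G. g (F G)) A"
  unfolding depends_on_def by metis

lemma depends_on_comp2: "depends_on F A \<Longrightarrow> depends_on H A \<Longrightarrow> depends_on (\<lambda>G. g (F G) (H G)) A"
  unfolding depends_on_def by metis

lemma depends_on_opn: "depends_on (\<lambda>G. opn G u w) {(min u w, max u w)}"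
  by (simp add: depends_on_def opn_def)

lemma open_rel_mono: "S \<subseteq> T \<Longrightarrow> open_rel G S \<subseteq> open_rel G T"
  by (auto simp: open_rel_def)

lemma sym_open_rel: "sym (open_rel G S)"
  by (auto simp: sym_def open_rel_def opn_commute)

lemma cl_refl: "u \<in> cl G S u"
  by (simp add: cl_def)

lemma cl_mono: "S \<subseteq> T \<Longrightarrow> cl G S u \<subseteq> cl G T u"
  unfolding cl_def using rtrancl_mono[OF open_rel_mono] by blast

lemma cl_subset: assumes "u \<in> S" shows "cl G S u \<subseteq> S"
proof
  fix v assume "v \<in> cl G S u"
  then have "(u, v) \<in> (open_rel G S)\<^sup>*" by (simp add: cl_def)
  then show "v \<in> S" using assms by (induction) (auto simp: open_rel_def)
qed

lemma cl_sym: "v \<in> cl G S u \<longleftrightarrow> u \<in> cl G S v"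
  using sym_rtrancl[OF sym_open_rel[of G S]] by (auto simp: cl_def sym_def)

lemma cl_eq: assumes "v \<in> cl G S u" shows "cl G S v = cl G S u"
proof -
  have "u \<in> cl G S v" using assms cl_sym by simp
  then show ?thesis using assms unfolding cl_def by (auto intro: rtrancl_trans)
qed

lemma cl_disjoint: "v \<notin> cl G S u \<Longrightarrow> cl G S v \<inter> cl G S u = {}"
  using cl_eq[of _ G S] cl_refl by (metis disjoint_iff)

lemma finite_cl: "finite S \<Longrightarrow> u \<in> S \<Longrightarrow> finite (cl G S u)"
  using cl_subset[of u S G] by (auto intro: finite_subset)

lemma opn_in_cl: "x \<in> cl G S u \<Longrightarrow> x \<in> S \<Longrightarrow> y \<in> S \<Longrightarrow> opn G x y \<Longrightarrow> y \<in> cl G S u"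
  by (cases "x = y") (auto simp: cl_def open_rel_def intro: rtrancl_into_rtrancl)

lemma cl_closed_subset:
  assumes "u \<in> T" and "\<And>x y. x \<in> T \<Longrightarrow> y \<in> S \<Longrightarrow> x \<in> S \<Longrightarrow> opn G x y \<Longrightarrow> y \<in> T"
  shows "cl G S u \<subseteq> T"
proof
  fix v assume "v \<in> cl G S u"
  then have "(u, v) \<in> (open_rel G S)\<^sup>*" by (simp add: cl_def)
  then show "v \<in> T" using assms(1) by (induction) (auto simp: open_rel_def intro: assms(2))
qed

text \<open>The right-hand side contains \<open>u\<close> and is closed under open edges, since a
  step through \<open>u\<close> restarts at one of its neighbours. Conversely, open neighbours lie
  in the cluster of \<open>u\<close>, and clusters grow with the vertex set.\<close>

lemma cl_rec:
  assumes u: "u \<in> S"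
  shows "cl G S u = insert u (\<Union>w\<in>{w\<in>S - {u}. opn G u w}. cl G (S - {u}) w)"
    (is "_ = ?R")
proof
  show "cl G S u \<subseteq> ?R"
  proof (rule cl_closed_subset)
    show "u \<in> ?R" by simp
    fix x y assume x: "x \<in> ?R" and y: "y \<in> S" and o: "opn G x y"
    show "y \<in> ?R"
    proof (cases "y = u \<or> x = u")
      case True
      then show ?thesis using y o cl_refl[of y G "S - {u}"] by auto
    next
      case False
      then obtain w where w: "w \<in> S - {u}" "opn G u w" "x \<in> cl G (S - {u}) w" using x by auto
      then have "x \<in> S - {u}" using cl_subset[of w "S - {u}" G] by auto
      then have "y \<in> cl G (S - {u}) w" using w opn_in_cl[of x G "S - {u}" w y] y o False by auto
      then show ?thesis using w by auto
    qed
  qed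
  show "?R \<subseteq> cl G S u"
  proof -
    have "cl G (S - {u}) w \<subseteq> cl G S u" if w: "w \<in> S - {u}" "opn G u w" for w
    proof -
      have "w \<in> cl G S u" using opn_in_cl[OF cl_refl u _ w(2)] w by simp
      then have "cl G S w = cl G S u" by (rule cl_eq)
      then show ?thesis using cl_mono[of "S - {u}" S G w] by auto
    qed
    then show ?thesis using cl_refl by auto
  qed
qed

lemma cl_cong:
  assumes "\<And>e. e \<in> pairs_in S \<Longrightarrow> G e = G' e"
  shows "cl G S u = cl G' S u"
proof -
  have "open_rel G S = open_rel G' S"
    using assms by (auto simp: open_rel_def opn_def pairs_in_def min_def max_def)
  then show ?thesis by (simp add: cl_def)
qed

lemma depends_on_cl: "depends_on (\<lambda>G. cl G S u) (pairs_in S)"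
  unfolding depends_on_def using cl_cong by blast

text \<open>Distinct clusters are disjoint, so a path from \<open>v\<close> never meets
  \<open>cl G S u\<close>. This is the exploration step behind \<open>disjoint_clusters_le\<close>:
  once the cluster of \<open>u\<close> is known to be \<open>T\<close>, the cluster of
  \<open>v\<close> lives on \<open>S - T\<close>.\<close>

lemma cl_avoid:
  assumes v: "v \<in> S" "v \<notin> cl G S u" and u: "u \<in> S"
  shows "cl G S v = cl G (S - cl G S u) v"
proof
  have d: "cl G S v \<inter> cl G S u = {}" using v by (simp add: cl_disjoint)
  show "cl G (S - cl G S u) v \<subseteq> cl G S v" by (rule cl_mono) auto
  have "(v, x) \<in> (open_rel G (S - cl G S u))\<^sup>*" if "(v, x) \<in> (open_rel G S)\<^sup>*" for x
    using that
  proof (induction)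
    case base then show ?case by simp
  next
    case (step y z)
    have "y \<in> cl G S v" "z \<in> cl G S v" using step by (auto simp: cl_def)
    then have "y \<notin> cl G S u" "z \<notin> cl G S u" using d by auto
    then have "(y, z) \<in> open_rel G (S - cl G S u)" using step(2) by (auto simp: open_rel_def)
    then show ?case using step by simp
  qed
  then show "cl G S v \<subseteq> cl G (S - cl G S u) v" by (auto simp: cl_def)
qed

text \<open>The pairs are those with an endpoint in \<open>T\<close>: edges inside \<open>T\<close>
  decide whether \<open>u\<close> reaches all of it, edges leaving \<open>T\<close> whether the
  exploration stops. None of them is in \<open>pairs_in (S - T)\<close>.\<close>

lemma depends_on_cl_eq:
  assumes u: "u \<in> S"
  shows "depends_on (\<lambda>G. cl G S u = T) (pairs_in S - pairs_in (S - T))"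
proof -
  have *: "cl G' S u = T"
    if ag: "\<forall>e\<in>pairs_in S - pairs_in (S - T). G e = G' e" and T: "cl G S u = T" for G G'
  proof
    have TS: "T \<subseteq> S" using T cl_subset[OF u] by auto
    have uT: "u \<in> T" using T cl_refl by auto
    have ag': "opn G x y = opn G' x y" if "x \<in> T" "y \<in> S" "x \<noteq> y" for x y
      using ag that TS by (auto simp: pairs_in_def opn_def min_def max_def)
    show "cl G' S u \<subseteq> T"
    proof (rule cl_closed_subset[OF uT])
      fix x y assume "x \<in> T" "y \<in> S" "x \<in> S" "opn G' x y"
      then show "y \<in> T" using ag'[of x y] opn_in_cl[of x G S u y] T by (cases "x = y") auto
    qed
    have "(u, x) \<in> (open_rel G' S)\<^sup>*" if "(u, x) \<in> (open_rel G S)\<^sup>*" for x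
      using that
    proof (induction)
      case base then show ?case by simp
    next
      case (step y z)
      have "y \<in> T" using step T by (auto simp: cl_def)
      then have "(y, z) \<in> open_rel G' S" using step(2) ag'[of y z] by (auto simp: open_rel_def)
      then show ?case using step by simp
    qed
    then show "T \<subseteq> cl G' S u" using T by (auto simp: cl_def)
  qed
  show ?thesis
    unfolding depends_on_def using * by (metis (no_types, lifting))
qed

lemma finite_pairs_in: "finite S \<Longrightarrow> finite (pairs_in S)"
  by (rule finite_subset[of _ "S \<times> S"]) (auto simp: pairs_in_def)

lemma vertex_pairs_eq: "vertex_pairs n = pairs_in {1..n}"
  by (auto simp: vertex_pairs_def pairs_in_def)

section \<open>Independent edges\<close>

locale edge_percolation =
  fixes U :: "nat set" and p :: "nat \<Rightarrow> nat \<Rightarrow> real"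
  assumes finite_U: "finite U"
    and p_sym: "p u w = p w u"
    and p_nonneg: "0 \<le> p u w"
    and p_le_1: "p u w \<le> 1"
begin

definition M :: "(nat \<times> nat \<Rightarrow> bool) pmf" where
  "M = Pi_pmf (pairs_in U) False (\<lambda>(i, j). bernoulli_pmf (p i j))"

abbreviation E :: "((nat \<times> nat \<Rightarrow> bool) \<Rightarrow> real) \<Rightarrow> real" where
  "E F \<equiv> measure_pmf.expectation M F"

abbreviation prob :: "(nat \<times> nat \<Rightarrow> bool) set \<Rightarrow> real" where
  "prob Q \<equiv> measure_pmf.prob M Q"

text \<open>Makes every function integrable, so that the rules for \<open>E\<close> carry no side
  conditions.\<close>

lemma finite_support: "finite (set_pmf M)"
proof -
  have "set_pmf M \<subseteq> PiE_dflt (pairs_in U) False (\<lambda>_. UNIV)"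
    unfolding M_def by (rule order_trans[OF set_Pi_pmf_subset'[OF finite_pairs_in[OF finite_U]]])
      (auto simp: PiE_dflt_def)
  then show ?thesis
    by (rule finite_subset) (auto intro!: finite_PiE_dflt finite_pairs_in finite_U)
qed

lemma integrable_M [simp]: "integrable M (F :: _ \<Rightarrow> real)"
  by (rule integrable_measure_pmf_finite[OF finite_support])

lemma E_add: "E (\<lambda>G. F G + H G) = E F + E H"
  by (rule Bochner_Integration.integral_add) auto

lemma E_diff: "E (\<lambda>G. F G - H G) = E F - E H"
  by (rule Bochner_Integration.integral_diff) auto

lemma E_sum: "E (\<lambda>G. \<Sum>i\<in>I. F i G) = (\<Sum>i\<in>I. E (F i))"
  by (rule Bochner_Integration.integral_sum) auto

lemma E_cmult: "E (\<lambda>G. c * F G) = c * E F"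
  by simp

lemma E_mono: "(\<And>G. F G \<le> H G) \<Longrightarrow> E F \<le> E H"
  by (rule integral_mono) auto

lemma E_nonneg: "(\<And>G. 0 \<le> F G) \<Longrightarrow> 0 \<le> E F"
  by (rule Bochner_Integration.integral_nonneg) auto

lemma E_of_bool: "E (\<lambda>G. of_bool (Q G)) = prob {G. Q G}"
proof -
  have "(\<lambda>G. of_bool (Q G) :: real) = indicator {G. Q G}"
    by (auto simp: fun_eq_iff indicator_def)
  then show ?thesis by simp
qed

lemma E_indep:
  assumes F: "depends_on F A" and H: "depends_on H B" and d: "A \<inter> B = {}"
  shows "E (\<lambda>G. F G * H G) = E F * E H"
proof -
  let ?I = "pairs_in U" and ?q = "\<lambda>(i, j). bernoulli_pmf (p i j)"
  define I1 where "I1 = ?I \<inter> A"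
  define I2 where "I2 = ?I - A"
  have fin: "finite I1" "finite I2" "I1 \<inter> I2 = {}" and un: "?I = I1 \<union> I2"
    using finite_pairs_in[OF finite_U] by (auto simp: I1_def I2_def)
  let ?c = "\<lambda>(f, g) x. if x \<in> I1 then f x else g x"
  have M: "M = map_pmf ?c (pair_pmf (Pi_pmf I1 False ?q) (Pi_pmf I2 False ?q))"
    unfolding M_def un by (rule Pi_pmf_union[OF fin])
  define Q where "Q = pair_pmf (Pi_pmf I1 False ?q) (Pi_pmf I2 False ?q)"
  \<comment> \<open>\<open>A\<close> and \<open>B\<close> may contain pairs outside
    \<open>pairs_in U\<close>. There a configuration of the support has the default value
    \<open>False\<close>, so \<open>F'\<close> and \<open>H'\<close> can fill in
    \<open>False\<close> without changing \<open>F\<close> and \<open>H\<close> on the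
    support.\<close>
  have supp: "G e = False" if "G \<in> set_pmf M" "e \<notin> ?I" for G e
    using that set_Pi_pmf_subset[OF finite_pairs_in[OF finite_U], of False ?q] unfolding M_def by (cases e) auto
  define F' where "F' = (\<lambda>f. F (\<lambda>x. if x \<in> I1 then f x else False))"
  define H' where "H' = (\<lambda>g. H (\<lambda>x. if x \<in> I1 then False else g x))"
  have FF: "F G = F' G" if "G \<in> set_pmf M" for G
    unfolding F'_def by (rule depends_onD[OF F]) (use supp[OF that] in \<open>auto simp: I1_def\<close>)
  have GG: "H G = H' G" if "G \<in> set_pmf M" for G
    unfolding H'_def by (rule depends_onD[OF H]) (use supp[OF that] d in \<open>auto simp: I1_def\<close>)
  have F'c: "F' (?c x) = F' (fst x)" for x unfolding F'_def case_prod_beta by (rule arg_cong[of _ _ F]) auto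
  have H'c: "H' (?c x) = H' (snd x)" for x unfolding H'_def case_prod_beta by (rule arg_cong[of _ _ H]) auto
  have finP: "finite (set_pmf (Pi_pmf I False ?q))" if "finite I" for I
  proof -
    have "set_pmf (Pi_pmf I False ?q) \<subseteq> PiE_dflt I False (\<lambda>_. UNIV)"
      by (rule order_trans[OF set_Pi_pmf_subset'[OF that]]) (auto simp: PiE_dflt_def)
    then show ?thesis by (rule finite_subset) (auto intro!: finite_PiE_dflt that)
  qed
  have "E (\<lambda>G. F G * H G) = E (\<lambda>G. F' G * H' G)"
    by (intro integral_cong_AE) (auto simp: AE_measure_pmf_iff FF GG)
  also have "\<dots> = measure_pmf.expectation Q (\<lambda>x. F' (?c x) * H' (?c x))"
    unfolding M Q_def[symmetric] by simp
  also have "\<dots> = measure_pmf.expectation Q (\<lambda>x. F' (fst x) * H' (snd x))"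
    by (simp only: F'c H'c)
  also have "\<dots> = measure_pmf.expectation (Pi_pmf I1 False ?q) F' * measure_pmf.expectation (Pi_pmf I2 False ?q) H'"
  proof -
    have f1: "finite (set_pmf (Pi_pmf I1 False ?q))" and f2: "finite (set_pmf (Pi_pmf I2 False ?q))"
      using finP fin by auto
    show ?thesis
      unfolding Q_def
      by (subst integral_measure_pmf_real[of "set_pmf (Pi_pmf I1 False ?q) \<times> set_pmf (Pi_pmf I2 False ?q)"],
          use f1 f2 in auto,
          subst integral_measure_pmf_real[of "set_pmf (Pi_pmf I1 False ?q)"],
          use f1 in auto,
          subst integral_measure_pmf_real[of "set_pmf (Pi_pmf I2 False ?q)"],
          use f2 in \<open>auto simp: sum_product sum.cartesian_product pmf_pair intro!: sum.cong\<close>)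
  qed
  also have "measure_pmf.expectation (Pi_pmf I1 False ?q) F' = E F'"
  proof -
    have "E F' = measure_pmf.expectation Q (\<lambda>x. F' (?c x))"
      unfolding M Q_def[symmetric] by simp
    also have "\<dots> = measure_pmf.expectation Q (\<lambda>x. F' (fst x))"
      by (simp only: F'c)
    also have "\<dots> = measure_pmf.expectation (map_pmf fst Q) F'" by simp
    finally show ?thesis by (simp add: Q_def map_fst_pair_pmf)
  qed
  also have "measure_pmf.expectation (Pi_pmf I2 False ?q) H' = E H'"
  proof -
    have "E H' = measure_pmf.expectation Q (\<lambda>x. H' (?c x))"
      unfolding M Q_def[symmetric] by simp
    also have "\<dots> = measure_pmf.expectation Q (\<lambda>x. H' (snd x))"
      by (simp only: H'c)
    also have "\<dots> = measure_pmf.expectation (map_pmf snd Q) H'" by simp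
    finally show ?thesis by (simp add: Q_def map_snd_pair_pmf)
  qed
  also have "E F' = E F" by (intro integral_cong_AE) (auto simp: AE_measure_pmf_iff FF)
  also have "E H' = E H" by (intro integral_cong_AE) (auto simp: AE_measure_pmf_iff GG)
  finally show ?thesis .
qed

lemma E_opn:
  assumes "u \<in> U" "w \<in> U" "u \<noteq> w"
  shows "E (\<lambda>G. of_bool (opn G u w)) = p u w"
proof -
  let ?e = "(min u w, max u w)"
  have e: "?e \<in> pairs_in U" using assms by (auto simp: pairs_in_def min_def max_def)
  have "E (\<lambda>G. of_bool (opn G u w)) = measure_pmf.expectation (map_pmf (\<lambda>G. G ?e) M) of_bool"
    by (simp add: opn_def)
  also have "map_pmf (\<lambda>G. G ?e) M = bernoulli_pmf (p (min u w) (max u w))"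
    unfolding M_def using Pi_pmf_component[OF finite_pairs_in[OF finite_U], of ?e False] e by simp
  also have "p (min u w) (max u w) = p u w" using p_sym by (auto simp: min_def max_def)
  also have "measure_pmf.expectation (bernoulli_pmf (p u w)) of_bool = p u w"
    using p_nonneg p_le_1 by simp
  finally show ?thesis .
qed

end

section \<open>Moments of cluster sums\<close>

lemma sum_UN_le:
  fixes f :: "'b \<Rightarrow> real"
  assumes "finite I" "\<And>i. i \<in> I \<Longrightarrow> finite (A i)" "\<And>x. 0 \<le> f x"
  shows "sum f (\<Union>i\<in>I. A i) \<le> (\<Sum>i\<in>I. sum f (A i))"
  using assms(1,2)
proof (induction I)
  case empty then show ?case by simp
next
  case (insert i I)
  have "sum f (A i \<union> (\<Union>i\<in>I. A i)) \<le> sum f (A i) + sum f (\<Union>i\<in>I. A i)"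
    using insert by (subst sum_Un) (auto intro!: sum_nonneg assms(3))
  then show ?case using insert by auto
qed

lemma sum_Un_le:
  fixes f :: "'b \<Rightarrow> real"
  assumes "finite A" "finite B" "\<And>x. 0 \<le> f x"
  shows "sum f (A \<union> B) \<le> sum f A + sum f B"
  using assms by (subst sum_Un) (auto intro!: sum_nonneg)

text \<open>Three weights matter: the constant 1 (cluster size), \<open>p u\<close> (expected number
  of edges from the cluster back to \<open>u\<close>) and the indicator of a block of
  vertices.\<close>

definition X :: "(nat \<Rightarrow> real) \<Rightarrow> (nat \<times> nat \<Rightarrow> bool) \<Rightarrow> nat set \<Rightarrow> nat \<Rightarrow> real" where
  "X f G S u = sum f (cl G S u)"

lemma X_nonneg: "(\<And>v. 0 \<le> f v) \<Longrightarrow> 0 \<le> X f G S u"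
  by (simp add: X_def sum_nonneg)

lemma depends_on_X: "depends_on (\<lambda>G. X f G S u) (pairs_in S)"
  unfolding X_def by (rule depends_on_comp[OF depends_on_cl])

lemma sum_opn:
  fixes h :: "nat \<Rightarrow> real"
  assumes "finite S"
  shows "(\<Sum>w\<in>{w\<in>S. opn G u w}. h w) = (\<Sum>w\<in>S. of_bool (opn G u w) * h w)"
  using assms by (intro sum.mono_neutral_cong_left) auto

lemma X_rec_le:
  assumes S: "finite S" "u \<in> S" and f: "\<And>v. 0 \<le> f v"
  shows "X f G S u \<le> f u + (\<Sum>w\<in>S - {u}. of_bool (opn G u w) * X f G (S - {u}) w)"
proof -
  let ?I = "{w\<in>S - {u}. opn G u w}"
  have fc: "finite (cl G (S - {u}) w)" if "w \<in> ?I" for w using that S finite_cl[of "S - {u}"] by auto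
  have "X f G S u = sum f ({u} \<union> (\<Union>w\<in>?I. cl G (S - {u}) w))"
    unfolding X_def by (subst cl_rec[OF S(2)]) simp
  also have "\<dots> \<le> sum f {u} + sum f (\<Union>w\<in>?I. cl G (S - {u}) w)"
    by (rule sum_Un_le) (use S fc f in auto)
  also have "sum f (\<Union>w\<in>?I. cl G (S - {u}) w) \<le> (\<Sum>w\<in>?I. X f G (S - {u}) w)"
    unfolding X_def by (rule sum_UN_le) (use S fc f in auto)
  also have "\<dots> = (\<Sum>w\<in>S - {u}. of_bool (opn G u w) * X f G (S - {u}) w)"
    by (rule sum_opn) (use S in auto)
  finally show ?thesis by simp
qed

text \<open>Once \<open>u\<close> is deleted, two vertices of its cluster lie either in one cluster
  or in two distinct clusters reached from two neighbours of \<open>u\<close>. The last sum keeps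
  the indicator of the second case, so that \<open>disjoint_clusters_le\<close> applies to
  it.\<close>

lemma XX_rec_le:
  assumes S: "finite S" "u \<in> S" and f: "\<And>v. 0 \<le> f v" and g: "\<And>v. 0 \<le> g v"
  defines "S' \<equiv> S - {u}"
  defines "b \<equiv> \<lambda>G w. of_bool (opn G u w) :: real"
  shows "X f G S u * X g G S u \<le> f u * g u + f u * (\<Sum>w\<in>S'. b G w * X g G S' w)
     + g u * (\<Sum>w\<in>S'. b G w * X f G S' w) + (\<Sum>w\<in>S'. b G w * (X f G S' w * X g G S' w))
     + (\<Sum>w\<in>S'. \<Sum>w'\<in>S'. (b G w * b G w') * (X f G S' w * X g G S' w' * of_bool (w' \<notin> cl G S' w)))"
proof -
  let ?I = "{w\<in>S'. opn G u w}"
  define C where "C = (\<lambda>w. cl G S' w)"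
  define D where "D = (\<Union>w\<in>?I. C w)"
  define J where "J = {q\<in>?I \<times> ?I. snd q \<notin> C (fst q)}"
  have S': "finite S'" "u \<notin> S'" using S by (auto simp: S'_def)
  have CS: "C w \<subseteq> S'" if "w \<in> S'" for w using cl_subset[OF that] by (simp add: C_def)
  have fc: "finite (C w)" if "w \<in> S'" for w using finite_cl[OF S'(1) that] by (simp add: C_def)
  have fI: "finite ?I" using S' by auto
  have fJ: "finite J" unfolding J_def using fI by auto
  have fD: "finite D" unfolding D_def using fI fc by auto
  have uD: "u \<notin> D" using CS S' by (auto simp: D_def)
  have cl: "cl G S u = insert u D" unfolding D_def C_def S'_def by (rule cl_rec[OF S(2)])
  have XI: "X h G S u = h u + sum h D" for h
    unfolding X_def cl using fD uD by simp
  have XD: "sum h D \<le> (\<Sum>w\<in>S'. b G w * X h G S' w)" if "\<And>v. 0 \<le> h v" for h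
  proof -
    have "sum h D \<le> (\<Sum>w\<in>?I. sum h (C w))" unfolding D_def
      by (rule sum_UN_le) (use fI fc that in auto)
    also have "\<dots> = (\<Sum>w\<in>S'. b G w * X h G S' w)"
      unfolding X_def C_def b_def by (rule sum_opn) (use S' in auto)
    finally show ?thesis .
  qed
  let ?h = "\<lambda>(x, y). f x * g y"
  have hp: "0 \<le> ?h z" for z using f g by (auto simp: case_prod_beta)
  have sub: "D \<times> D \<subseteq> (\<Union>w\<in>?I. C w \<times> C w) \<union> (\<Union>q\<in>J. C (fst q) \<times> C (snd q))"
  proof
    fix z assume "z \<in> D \<times> D"
    then obtain x y w w' where z: "z = (x, y)" and w: "w \<in> ?I" "x \<in> C w" and w': "w' \<in> ?I" "y \<in> C w'"
      by (auto simp: D_def)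
    show "z \<in> (\<Union>w\<in>?I. C w \<times> C w) \<union> (\<Union>q\<in>J. C (fst q) \<times> C (snd q))"
    proof (cases "w' \<in> C w")
      case True
      then have "C w' = C w" unfolding C_def by (rule cl_eq)
      then show ?thesis using z w w' by auto
    next
      case False
      then have "(w, w') \<in> J" using w w' by (auto simp: J_def)
      then show ?thesis using z w w' by force
    qed
  qed
  have prod: "sum ?h (A \<times> B) = sum f A * sum g B" for A B
    by (simp add: sum_product sum.cartesian_product)
  have "sum f D * sum g D = sum ?h (D \<times> D)" using prod by simp
  also have "\<dots> \<le> sum ?h ((\<Union>w\<in>?I. C w \<times> C w) \<union> (\<Union>q\<in>J. C (fst q) \<times> C (snd q)))"
    by (rule sum_mono2[OF _ sub]) (use fI fJ fc hp in \<open>auto simp: J_def\<close>)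
  also have "\<dots> \<le> sum ?h (\<Union>w\<in>?I. C w \<times> C w) + sum ?h (\<Union>q\<in>J. C (fst q) \<times> C (snd q))"
    by (rule sum_Un_le) (use fI fJ fc hp in \<open>auto simp: J_def\<close>)
  also have "sum ?h (\<Union>w\<in>?I. C w \<times> C w) \<le> (\<Sum>w\<in>?I. sum ?h (C w \<times> C w))"
    by (rule sum_UN_le) (use fI fc hp in auto)
  also have "\<dots> = (\<Sum>w\<in>?I. X f G S' w * X g G S' w)"
    by (simp only: prod X_def C_def)
  also have "\<dots> = (\<Sum>w\<in>S'. b G w * (X f G S' w * X g G S' w))"
    unfolding b_def by (rule sum_opn) (use S' in auto)
  also have "sum ?h (\<Union>q\<in>J. C (fst q) \<times> C (snd q)) \<le> (\<Sum>q\<in>J. sum ?h (C (fst q) \<times> C (snd q)))"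
    by (rule sum_UN_le) (use fI fJ fc hp in \<open>auto simp: J_def\<close>)
  also have "\<dots> = (\<Sum>q\<in>J. X f G S' (fst q) * X g G S' (snd q))"
    by (simp only: prod X_def C_def)
  also have "\<dots> = (\<Sum>q\<in>S' \<times> S'. (b G (fst q) * b G (snd q)) * (X f G S' (fst q) * X g G S' (snd q) * of_bool (snd q \<notin> cl G S' (fst q))))"
    by (rule sum.mono_neutral_cong_left) (use S' in \<open>auto simp: J_def C_def b_def\<close>)
  also have "\<dots> = (\<Sum>w\<in>S'. \<Sum>w'\<in>S'. (b G w * b G w') * (X f G S' w * X g G S' w' * of_bool (w' \<notin> cl G S' w)))"
    by (simp add: sum.cartesian_product case_prod_beta)
  finally have DD: "sum f D * sum g D \<le> (\<Sum>w\<in>S'. b G w * (X f G S' w * X g G S' w)) +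
     (\<Sum>w\<in>S'. \<Sum>w'\<in>S'. (b G w * b G w') * (X f G S' w * X g G S' w' * of_bool (w' \<notin> cl G S' w)))"
    by simp
  have "X f G S u * X g G S u = f u * g u + f u * sum g D + g u * sum f D + sum f D * sum g D"
    unfolding XI by (simp add: algebra_simps)
  then show ?thesis
    using DD mult_left_mono[OF XD[of g, OF g] f[of u]] mult_left_mono[OF XD[of f, OF f] g[of u]] by linarith
qed

section \<open>Upper recursions for first and second moments\<close>

context edge_percolation
begin

abbreviation meanX :: "(nat \<Rightarrow> real) \<Rightarrow> nat set \<Rightarrow> nat \<Rightarrow> real" where
  "meanX f S u \<equiv> E (\<lambda>G. X f G S u)"

text \<open>The diagonal is left out because \<open>p u u\<close> is merely some number in
  \<open>[0, 1]\<close>, while clusters use no loops.\<close>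

definition Kop :: "nat set \<Rightarrow> (nat \<Rightarrow> real) \<Rightarrow> nat \<Rightarrow> real" where
  "Kop V f u = (\<Sum>w\<in>V - {u}. p u w * f w)"

text \<open>The truncated Neumann series \<open>f + K f + ... + K^(k - 1) f\<close> of
  \<open>(1 - K)^-1 f\<close>. Truncation suffices because deleting vertices ends after finitely
  many steps, and every supersolution bounds it (\<open>Gop_le\<close>).\<close>

fun Gop :: "nat set \<Rightarrow> nat \<Rightarrow> (nat \<Rightarrow> real) \<Rightarrow> nat \<Rightarrow> real" where
  "Gop V 0 f = (\<lambda>u. 0)"
| "Gop V (Suc k) f = (\<lambda>u. f u + Kop V (Gop V k f) u)"

text \<open>A special case of the van den Berg--Kesten inequality, by conditioning on the cluster of \<open>u\<close>.\<close>

lemma disjoint_clusters_le: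
  assumes S: "finite S" "u \<in> S" "v \<in> S"
    and F: "\<And>T. 0 \<le> F T" and H: "\<And>T. 0 \<le> H T"
    and H_mono: "\<And>T T'. T \<subseteq> T' \<Longrightarrow> T' \<subseteq> S \<Longrightarrow> H T \<le> H T'"
  shows "E (\<lambda>G. F (cl G S u) * H (cl G S v) * of_bool (v \<notin> cl G S u))
    \<le> E (\<lambda>G. F (cl G S u)) * E (\<lambda>G. H (cl G S v))"
proof -
  have inS: "cl G S u \<in> Pow S" for G using cl_subset[OF S(2)] by auto
  have split: "F (cl G S u) * Y (cl G S u) = (\<Sum>T\<in>Pow S. of_bool (cl G S u = T) * (F T * Y T))" for G and Y :: "nat set \<Rightarrow> real"
  proof -
    have "(\<Sum>T\<in>Pow S. of_bool (cl G S u = T) * (F T * Y T)) = (\<Sum>T\<in>Pow S. if cl G S u = T then F T * Y T else 0)"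
      by (rule sum.cong) auto
    also have "\<dots> = F (cl G S u) * Y (cl G S u)" using inS[of G] S(1) by (subst sum.delta') auto
    finally show ?thesis by simp
  qed
  have "E (\<lambda>G. F (cl G S u) * H (cl G S v) * of_bool (v \<notin> cl G S u))
      = E (\<lambda>G. F (cl G S u) * (of_bool (v \<notin> cl G S u) * H (cl G (S - cl G S u) v)))"
    using cl_avoid[OF S(3) _ S(2)] by (intro arg_cong[of _ _ E] ext) (simp add: of_bool_def)
  also have "\<dots> = E (\<lambda>G. \<Sum>T\<in>Pow S. of_bool (cl G S u = T) * (F T * (of_bool (v \<notin> T) * H (cl G (S - T) v))))"
    by (rule arg_cong[of _ _ E], rule ext, rule split)
  also have "\<dots> = (\<Sum>T\<in>Pow S. E (\<lambda>G. of_bool (cl G S u = T) * (F T * (of_bool (v \<notin> T) * H (cl G (S - T) v)))))"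
    by (rule E_sum)
  also have "\<dots> \<le> (\<Sum>T\<in>Pow S. E (\<lambda>G. of_bool (cl G S u = T)) * (F T * E (\<lambda>G. H (cl G S v))))"
  proof (rule sum_mono)
    fix T assume T: "T \<in> Pow S"
    have "E (\<lambda>G. of_bool (cl G S u = T) * (F T * (of_bool (v \<notin> T) * H (cl G (S - T) v))))
       = E (\<lambda>G. of_bool (cl G S u = T)) * E (\<lambda>G. F T * (of_bool (v \<notin> T) * H (cl G (S - T) v)))"
      by (rule E_indep[where A = "pairs_in S - pairs_in (S - T)" and B = "pairs_in (S - T)"])
        (auto intro: depends_on_comp[OF depends_on_cl_eq[OF S(2)]] depends_on_comp[OF depends_on_cl])
    also have "\<dots> \<le> E (\<lambda>G. of_bool (cl G S u = T)) * E (\<lambda>G. F T * H (cl G S v))"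
    proof (rule mult_left_mono[OF E_mono E_nonneg])
      fix G
      have "of_bool (v \<notin> T) * H (cl G (S - T) v) \<le> H (cl G S v)"
        using H H_mono[OF cl_mono[of "S - T" S G v] cl_subset[OF S(3)]] by (auto simp: of_bool_def)
      then show "F T * (of_bool (v \<notin> T) * H (cl G (S - T) v)) \<le> F T * H (cl G S v)"
        using F by (rule mult_left_mono)
    qed auto
    also have "\<dots> = E (\<lambda>G. of_bool (cl G S u = T)) * (F T * E (\<lambda>G. H (cl G S v)))"
      by (simp only: E_cmult)
    finally show "E (\<lambda>G. of_bool (cl G S u = T) * (F T * (of_bool (v \<notin> T) * H (cl G (S - T) v))))
        \<le> E (\<lambda>G. of_bool (cl G S u = T)) * (F T * E (\<lambda>G. H (cl G S v)))" .
  qed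
  also have "\<dots> = (\<Sum>T\<in>Pow S. E (\<lambda>G. of_bool (cl G S u = T) * (F T * 1))) * E (\<lambda>G. H (cl G S v))"
    by (simp add: sum_distrib_left sum_distrib_right mult_ac)
  also have "(\<Sum>T\<in>Pow S. E (\<lambda>G. of_bool (cl G S u = T) * (F T * 1))) = E (\<lambda>G. F (cl G S u) * 1)"
    unfolding split[of _ "\<lambda>_. 1"] by (rule E_sum[symmetric])
  finally show ?thesis by simp
qed

lemma E_opn_mult:
  assumes "S \<subseteq> U" "u \<in> S" "w \<in> S - {u}" and Y: "depends_on Y (pairs_in (S - {u}))"
  shows "E (\<lambda>G. of_bool (opn G u w) * Y G) = p u w * E Y"
proof -
  have "E (\<lambda>G. of_bool (opn G u w) * Y G) = E (\<lambda>G. of_bool (opn G u w)) * E Y"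
    by (rule E_indep[OF depends_on_comp[OF depends_on_opn] Y]) (auto simp: pairs_in_def min_def max_def)
  then show ?thesis using E_opn[of u w] assms by auto
qed

lemma E_opn_opn_mult:
  assumes "S \<subseteq> U" "u \<in> S" "w \<in> S - {u}" "w' \<in> S - {u}" "w \<noteq> w'"
    and Y: "depends_on Y (pairs_in (S - {u}))"
  shows "E (\<lambda>G. (of_bool (opn G u w) * of_bool (opn G u w')) * Y G) = p u w * p u w' * E Y"
proof -
  let ?e = "\<lambda>w. (min u w, max u w)"
  have 1: "depends_on (\<lambda>G. of_bool (opn G u w) * of_bool (opn G u w') :: real) ({?e w} \<union> {?e w'})"
    by (intro depends_on_comp2[where g = "\<lambda>a b. of_bool a * of_bool b :: real"] depends_on_mono[OF depends_on_opn]) auto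
  have "E (\<lambda>G. (of_bool (opn G u w) * of_bool (opn G u w')) * Y G)
     = E (\<lambda>G. of_bool (opn G u w) * of_bool (opn G u w')) * E Y"
    by (rule E_indep[OF 1 Y]) (auto simp: pairs_in_def min_def max_def)
  also have "E (\<lambda>G. of_bool (opn G u w) * of_bool (opn G u w')) = E (\<lambda>G. of_bool (opn G u w)) * E (\<lambda>G. of_bool (opn G u w'))"
    by (rule E_indep[OF depends_on_comp[OF depends_on_opn] depends_on_comp[OF depends_on_opn]])
      (use assms in \<open>auto simp: min_def max_def split: if_splits\<close>)
  also have "E (\<lambda>G. of_bool (opn G u w)) = p u w" by (rule E_opn) (use assms in auto)
  also have "E (\<lambda>G. of_bool (opn G u w')) = p u w'" by (rule E_opn) (use assms in auto)
  finally show ?thesis .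
qed

lemma E_X_rec_le:
  assumes S: "S \<subseteq> U" "u \<in> S" and f: "\<And>v. 0 \<le> f v"
  shows "meanX f S u \<le> f u + Kop S (\<lambda>w. meanX f (S - {u}) w) u"
proof -
  have fS: "finite S" using S finite_U finite_subset by blast
  have "meanX f S u \<le> E (\<lambda>G. f u + (\<Sum>w\<in>S - {u}. of_bool (opn G u w) * X f G (S - {u}) w))"
    by (rule E_mono) (rule X_rec_le[OF fS S(2) f])
  also have "\<dots> = f u + (\<Sum>w\<in>S - {u}. E (\<lambda>G. of_bool (opn G u w) * X f G (S - {u}) w))"
    unfolding E_add E_sum by simp
  also have "(\<Sum>w\<in>S - {u}. E (\<lambda>G. of_bool (opn G u w) * X f G (S - {u}) w)) = Kop S (\<lambda>w. meanX f (S - {u}) w) u"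
    unfolding Kop_def by (rule sum.cong[OF refl], rule E_opn_mult[OF S _ depends_on_X])
  finally show ?thesis .
qed

lemma Kop_mono:
  assumes "finite V" "S \<subseteq> V" "\<And>w. w \<in> V \<Longrightarrow> 0 \<le> g w" "\<And>w. w \<in> S - {u} \<Longrightarrow> f w \<le> g w"
  shows "Kop S f u \<le> Kop V g u"
proof -
  have "Kop S f u \<le> (\<Sum>w\<in>S - {u}. p u w * g w)"
    unfolding Kop_def by (intro sum_mono mult_left_mono p_nonneg) (use assms in auto)
  also have "\<dots> \<le> Kop V g u"
    unfolding Kop_def by (rule sum_mono2) (use assms p_nonneg in auto)
  finally show ?thesis .
qed

text \<open>Induction on \<open>card S\<close>: the recursion passes to \<open>S - {u}\<close>, and
  one supersolution on \<open>V\<close> bounds all subsets at the same time.\<close>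

lemma E_X_le:
  assumes V: "V \<subseteq> U" and f: "\<And>v. 0 \<le> f v" and \<phi>: "\<And>v. v \<in> V \<Longrightarrow> 0 \<le> \<phi> v"
    and super: "\<And>v. v \<in> V \<Longrightarrow> f v + Kop V \<phi> v \<le> \<phi> v"
    and S: "S \<subseteq> V" "u \<in> S"
  shows "meanX f S u \<le> \<phi> u"
proof -
  have fV: "finite V" using V finite_U finite_subset by blast
  have "finite S" using S fV finite_subset by blast
  then show ?thesis using S
  proof (induction "card S" arbitrary: S u rule: less_induct)
    case less
    have c: "card (S - {u}) < card S" using less.prems by (intro psubset_card_mono) auto
    have "meanX f S u \<le> f u + Kop S (\<lambda>w. meanX f (S - {u}) w) u"
      by (rule E_X_rec_le) (use less.prems V f in auto)
    also have "Kop S (\<lambda>w. meanX f (S - {u}) w) u \<le> Kop V \<phi> u"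
      by (rule Kop_mono[OF fV]) (use less.prems \<phi> less.hyps[OF c] in auto)
    finally show ?case using super[of u] less.prems by auto
  qed
qed

lemma Gop_nonneg:
  assumes "\<And>v. v \<in> V \<Longrightarrow> 0 \<le> f v" "u \<in> V"
  shows "0 \<le> Gop V k f u"
  using assms(2)
proof (induction k arbitrary: u)
  case (Suc k)
  have "0 \<le> Kop V (Gop V k f) u"
    unfolding Kop_def by (intro sum_nonneg mult_nonneg_nonneg p_nonneg) (use Suc in auto)
  then show ?case using assms(1)[of u] Suc by simp
qed simp

lemma Gop_le:
  assumes "finite V" "\<And>v. v \<in> V \<Longrightarrow> 0 \<le> \<psi> v" "\<And>v. v \<in> V \<Longrightarrow> f v + Kop V \<psi> v \<le> \<psi> v" "u \<in> V"
  shows "Gop V k f u \<le> \<psi> u"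
  using assms(4)
proof (induction k arbitrary: u)
  case (Suc k)
  have "Kop V (Gop V k f) u \<le> Kop V \<psi> u"
    by (rule Kop_mono) (use assms Suc in auto)
  then show ?case using assms(3)[of u] Suc by simp
qed (use assms in simp)

text \<open>Tree-graph bound: paths from \<open>u\<close> to two vertices of its cluster share an
  initial piece; \<open>Gop\<close> sums over that piece, and \<open>\<phi> v * \<psi> v\<close>
  bounds the two branches at its end \<open>v\<close>. As each step deletes a vertex,
  \<open>k\<close> terms of the series suffice for \<open>card S \<le> k\<close>.\<close>

lemma E_XX_le:
  assumes V: "V \<subseteq> U" and f: "\<And>v. 0 \<le> f v" and \<phi>: "\<And>v. v \<in> V \<Longrightarrow> 0 \<le> \<phi> v"
    and super: "\<And>v. v \<in> V \<Longrightarrow> f v + Kop V \<phi> v \<le> \<phi> v"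
    and g: "\<And>v. 0 \<le> g v" and \<psi>: "\<And>v. v \<in> V \<Longrightarrow> 0 \<le> \<psi> v"
    and super': "\<And>v. v \<in> V \<Longrightarrow> g v + Kop V \<psi> v \<le> \<psi> v"
    and S: "S \<subseteq> V" "u \<in> S" and k: "card S \<le> k"
  shows "E (\<lambda>G. X f G S u * X g G S u) \<le> Gop V k (\<lambda>v. \<phi> v * \<psi> v) u"
proof -
  have fV: "finite V" using V finite_U finite_subset by blast
  show ?thesis using S k
  proof (induction k arbitrary: S u)
    case 0
    then have "S = {}" using fV finite_subset[of S V] by auto
    then show ?case using 0 by auto
  next
    case (Suc k)
    let ?S = "S - {u}"
    have fS: "finite S" using Suc.prems fV finite_subset by blast
    have SU: "S \<subseteq> U" and u: "u \<in> S" using Suc.prems V by auto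
    have c: "card ?S \<le> k" using Suc.prems fS by auto
    let ?o = "\<lambda>G w. of_bool (opn G u w) :: real"
    let ?Xf = "\<lambda>w. meanX f ?S w" and ?Xg = "\<lambda>w. meanX g ?S w"
    have dX: "depends_on (\<lambda>G. X h G ?S w * X h' G ?S w') (pairs_in ?S)" for h h' w w'
      by (rule depends_on_comp2[OF depends_on_X depends_on_X])
    have nn: "0 \<le> ?Xf w" "0 \<le> ?Xg w" for w by (intro E_nonneg X_nonneg f g)+
    have t1: "E (\<lambda>G. \<Sum>w\<in>?S. ?o G w * X h G ?S w) = (\<Sum>w\<in>?S. p u w * meanX h ?S w)" for h
      unfolding E_sum by (rule sum.cong[OF refl], rule E_opn_mult[OF SU u _ depends_on_X])
    have t2: "E (\<lambda>G. \<Sum>w\<in>?S. ?o G w * (X f G ?S w * X g G ?S w)) = (\<Sum>w\<in>?S. p u w * E (\<lambda>G. X f G ?S w * X g G ?S w))"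
      unfolding E_sum by (rule sum.cong[OF refl], rule E_opn_mult[OF SU u _ dX])
    have t3: "E (\<lambda>G. (?o G w * ?o G w') * (X f G ?S w * X g G ?S w' * of_bool (w' \<notin> cl G ?S w)))
         \<le> (p u w * ?Xf w) * (p u w' * ?Xg w')" if w: "w \<in> ?S" "w' \<in> ?S" for w w'
    proof (cases "w = w'")
      case True
      then show ?thesis using nn by (simp add: cl_refl p_nonneg)
    next
      case False
      have "E (\<lambda>G. (?o G w * ?o G w') * (X f G ?S w * X g G ?S w' * of_bool (w' \<notin> cl G ?S w)))
          = p u w * p u w' * E (\<lambda>G. X f G ?S w * X g G ?S w' * of_bool (w' \<notin> cl G ?S w))"
        by (rule E_opn_opn_mult[OF SU u w False])
          (rule depends_on_comp2[OF dX depends_on_comp[OF depends_on_cl[of ?S w], of "\<lambda>C. w' \<notin> C"], where g = "\<lambda>a b. a * of_bool b"])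
      also have "\<dots> \<le> p u w * p u w' * (?Xf w * ?Xg w')"
        unfolding X_def
        by (intro mult_left_mono mult_nonneg_nonneg p_nonneg disjoint_clusters_le)
          (use fS w f g in \<open>auto intro!: sum_nonneg sum_mono2 intro: finite_subset\<close>)
      finally show ?thesis by (simp add: mult_ac)
    qed
    have "E (\<lambda>G. X f G S u * X g G S u) \<le> E (\<lambda>G. f u * g u + f u * (\<Sum>w\<in>?S. ?o G w * X g G ?S w)
     + g u * (\<Sum>w\<in>?S. ?o G w * X f G ?S w) + (\<Sum>w\<in>?S. ?o G w * (X f G ?S w * X g G ?S w))
     + (\<Sum>w\<in>?S. \<Sum>w'\<in>?S. (?o G w * ?o G w') * (X f G ?S w * X g G ?S w' * of_bool (w' \<notin> cl G ?S w))))"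
      by (rule E_mono) (rule XX_rec_le[OF fS u f g])
    also have "\<dots> = f u * g u + f u * (\<Sum>w\<in>?S. p u w * ?Xg w) + g u * (\<Sum>w\<in>?S. p u w * ?Xf w)
      + (\<Sum>w\<in>?S. p u w * E (\<lambda>G. X f G ?S w * X g G ?S w))
      + (\<Sum>w\<in>?S. \<Sum>w'\<in>?S. E (\<lambda>G. (?o G w * ?o G w') * (X f G ?S w * X g G ?S w' * of_bool (w' \<notin> cl G ?S w))))"
      unfolding E_add E_cmult t1 t2 by (simp only: E_sum) simp
    also have "\<dots> \<le> f u * g u + f u * (\<Sum>w\<in>?S. p u w * ?Xg w) + g u * (\<Sum>w\<in>?S. p u w * ?Xf w)
      + (\<Sum>w\<in>?S. p u w * E (\<lambda>G. X f G ?S w * X g G ?S w))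
      + (\<Sum>w\<in>?S. \<Sum>w'\<in>?S. (p u w * ?Xf w) * (p u w' * ?Xg w'))"
      by (intro add_left_mono sum_mono t3)
    \<comment> \<open>The double sum has become a product of two sums and completes the first three
      terms to a full product, each factor of which is below its supersolution at
      \<open>u\<close>.\<close>
    also have "\<dots> = (f u + Kop S ?Xf u) * (g u + Kop S ?Xg u) + (\<Sum>w\<in>?S. p u w * E (\<lambda>G. X f G ?S w * X g G ?S w))"
      unfolding Kop_def sum_product[symmetric] by (simp add: algebra_simps)
    also have "\<dots> \<le> \<phi> u * \<psi> u + Kop V (Gop V k (\<lambda>v. \<phi> v * \<psi> v)) u"
    proof (rule add_mono)
      have "Kop S ?Xf u \<le> Kop V \<phi> u"
        by (rule Kop_mono[OF fV]) (use Suc.prems \<phi> E_X_le[OF V f \<phi> super, of ?S] in auto)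
      then have 1: "f u + Kop S ?Xf u \<le> \<phi> u" using super[of u] Suc.prems by auto
      have "Kop S ?Xg u \<le> Kop V \<psi> u"
        by (rule Kop_mono[OF fV]) (use Suc.prems \<psi> E_X_le[OF V g \<psi> super', of ?S] in auto)
      then have 2: "g u + Kop S ?Xg u \<le> \<psi> u" using super'[of u] Suc.prems by auto
      have 3: "0 \<le> g u + Kop S ?Xg u"
        unfolding Kop_def by (intro add_nonneg_nonneg sum_nonneg mult_nonneg_nonneg p_nonneg nn g)
      show "(f u + Kop S ?Xf u) * (g u + Kop S ?Xg u) \<le> \<phi> u * \<psi> u"
        by (rule mult_mono) (use 1 2 3 \<phi> Suc.prems in auto)
      have "Kop S (\<lambda>w. E (\<lambda>G. X f G ?S w * X g G ?S w)) u \<le> Kop V (Gop V k (\<lambda>v. \<phi> v * \<psi> v)) u"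
        by (rule Kop_mono[OF fV]) (use Suc.prems \<phi> \<psi> c in \<open>auto intro!: Gop_nonneg Suc.IH\<close>)
      then show "(\<Sum>w\<in>?S. p u w * E (\<lambda>G. X f G ?S w * X g G ?S w)) \<le> Kop V (Gop V k (\<lambda>v. \<phi> v * \<psi> v)) u"
        by (simp add: Kop_def)
    qed
    finally show ?case by simp
  qed
qed

lemma Kop_sym:
  assumes "finite V"
  shows "(\<Sum>u\<in>V. g u * Kop V f u) = (\<Sum>u\<in>V. Kop V g u * f u)"
proof -
  have *: "Kop V h u = (\<Sum>w\<in>V. if w = u then 0 else p u w * h w)" for h u
    unfolding Kop_def by (rule sum.mono_neutral_cong_left) (use assms in auto)
  have "(\<Sum>u\<in>V. g u * Kop V f u) = (\<Sum>u\<in>V. \<Sum>w\<in>V. if w = u then 0 else p u w * (g u * f w))"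
    unfolding * sum_distrib_left by (intro sum.cong) auto
  also have "\<dots> = (\<Sum>w\<in>V. \<Sum>u\<in>V. if w = u then 0 else p u w * (g u * f w))" by (rule sum.swap)
  also have "\<dots> = (\<Sum>u\<in>V. Kop V g u * f u)"
    unfolding * sum_distrib_right by (intro sum.cong) (auto simp: p_sym)
  finally show ?thesis .
qed

lemma Kop_add: "Kop V (\<lambda>w. f w + g w) u = Kop V f u + Kop V g u"
  by (simp add: Kop_def distrib_left sum.distrib)

lemma Kop_cmult: "Kop V (\<lambda>w. c * f w) u = c * Kop V f u"
  by (simp add: Kop_def sum_distrib_left mult_ac)

lemma Gop_Suc': "Gop V (Suc k) f u = f u + Gop V k (Kop V f) u"
proof (induction k arbitrary: u)
  case 0 then show ?case by (simp add: Kop_def)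
next
  case (Suc k)
  have "Gop V (Suc (Suc k)) f u = f u + Kop V (\<lambda>u. f u + Gop V k (Kop V f) u) u"
    using Suc by (simp add: fun_eq_iff)
  then show ?case by (simp add: Kop_add)
qed

text \<open>Moves the series from a product of supersolutions onto a simple weight, for which a
  supersolution is at hand.\<close>

lemma Gop_sym:
  assumes "finite V"
  shows "(\<Sum>u\<in>V. g u * Gop V k f u) = (\<Sum>u\<in>V. Gop V k g u * f u)"
proof (induction k arbitrary: g)
  case 0 then show ?case by simp
next
  case (Suc k)
  have "(\<Sum>u\<in>V. g u * Gop V (Suc k) f u) = (\<Sum>u\<in>V. g u * f u) + (\<Sum>u\<in>V. g u * Kop V (Gop V k f) u)"
    by (simp add: distrib_left sum.distrib)
  also have "\<dots> = (\<Sum>u\<in>V. g u * f u) + (\<Sum>u\<in>V. Gop V k (Kop V g) u * f u)"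
    by (simp only: Kop_sym[OF assms] Suc)
  also have "\<dots> = (\<Sum>u\<in>V. Gop V (Suc k) g u * f u)"
    unfolding Gop_Suc' by (simp add: distrib_right sum.distrib)
  finally show ?case .
qed

end

section \<open>Lower recursion for the expected cluster size\<close>

abbreviation csize :: "(nat \<times> nat \<Rightarrow> bool) \<Rightarrow> nat set \<Rightarrow> nat \<Rightarrow> real" where
  "csize \<equiv> X (\<lambda>_. 1)"

lemma csize_eq_card: "csize G S u = real (card (cl G S u))"
  by (simp add: X_def)

lemma csize_nonneg: "0 \<le> csize G S u"
  by (simp add: csize_eq_card)

lemma X_eq_sum_of_bool:
  assumes "finite S" "w \<in> S"
  shows "X f G S w = (\<Sum>v\<in>S. f v * of_bool (v \<in> cl G S w))"
  unfolding X_def using cl_subset[OF assms(2)] assms(1)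
  by (intro sum.mono_neutral_cong_left) auto

text \<open>Distinct clusters are disjoint, so only the repetitions in the union are overcounted.\<close>

lemma card_UN_cl_ge:
  assumes S: "finite S" and I: "I \<subseteq> S"
  shows "(\<Sum>w\<in>I. csize G S w) - (\<Sum>w\<in>I. \<Sum>w'\<in>I - {w}. csize G S w * of_bool (w' \<in> cl G S w))
     \<le> real (card (\<Union>w\<in>I. cl G S w))"
proof -
  have "finite I" using I S finite_subset by blast
  then show ?thesis using I
  proof (induction I)
    case empty then show ?case by simp
  next
    case (insert w0 I)
    let ?f = "\<lambda>w w'. csize G S w * of_bool (w' \<in> cl G S w)"
    have nn: "0 \<le> ?f w w'" for w w' using csize_nonneg by simp
    have fc: "finite (cl G S w)" if "w \<in> insert w0 I" for w using finite_cl[OF S, of w] that insert by auto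
    have fU: "finite (\<Union>w\<in>I. cl G S w)" using insert fc by auto
    have c1: "(\<Sum>w'\<in>insert w0 I - {w0}. ?f w0 w') = (\<Sum>w'\<in>I. ?f w0 w')"
      using insert by (intro sum.cong) auto
    have c2: "(\<Sum>w'\<in>I - {w}. ?f w w') \<le> (\<Sum>w'\<in>insert w0 I - {w}. ?f w w')" if "w \<in> I" for w
      using insert nn by (intro sum_mono2) auto
    have corr: "(\<Sum>w\<in>insert w0 I. \<Sum>w'\<in>insert w0 I - {w}. ?f w w') \<ge>
        (\<Sum>w'\<in>I. ?f w0 w') + (\<Sum>w\<in>I. \<Sum>w'\<in>I - {w}. ?f w w')"
      using sum_mono[of I, OF c2] c1 insert by simp
    show ?case
    proof (cases "\<exists>w'\<in>I. w' \<in> cl G S w0")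
      case True
      then obtain w' where w': "w' \<in> I" "w' \<in> cl G S w0" by auto
      have "csize G S w0 \<le> (\<Sum>w'\<in>I. ?f w0 w')"
        using member_le_sum[of w' I "?f w0"] w' nn insert by auto
      moreover have "real (card (\<Union>w\<in>I. cl G S w)) \<le> real (card (\<Union>w\<in>insert w0 I. cl G S w))"
        using fU fc by (intro of_nat_mono card_mono) auto
      ultimately show ?thesis using corr insert by simp
    next
      case False
      have "cl G S w0 \<inter> (\<Union>w\<in>I. cl G S w) = {}"
        using False cl_disjoint[of w0 G S] cl_sym by fastforce
      then have "real (card (\<Union>w\<in>insert w0 I. cl G S w)) = csize G S w0 + real (card (\<Union>w\<in>I. cl G S w))"
        using fU fc by (simp add: card_Un_disjoint csize_eq_card)
      moreover have "(\<Sum>w\<in>insert w0 I. csize G S w) = csize G S w0 + (\<Sum>w\<in>I. csize G S w)"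
        using insert by simp
      moreover have "(\<Sum>w\<in>I. csize G S w) - (\<Sum>w\<in>I. \<Sum>w'\<in>I - {w}. ?f w w') \<le> real (card (\<Union>w\<in>I. cl G S w))"
        using insert by simp
      moreover have "0 \<le> (\<Sum>w'\<in>I. ?f w0 w')" by (intro sum_nonneg nn)
      ultimately show ?thesis using corr by linarith
    qed
  qed
qed

text \<open>Counterpart of \<open>X_rec_le\<close> from below; the subtracted double sum charges
  every pair of open neighbours joined without \<open>u\<close>.\<close>

lemma csize_rec_ge:
  assumes S: "finite S" "u \<in> S"
  defines "S' \<equiv> S - {u}"
  defines "b \<equiv> \<lambda>G w. of_bool (opn G u w) :: real"
  shows "1 + (\<Sum>w\<in>S'. b G w * csize G S' w)
     - (\<Sum>w\<in>S'. \<Sum>w'\<in>S' - {w}. (b G w * b G w') * (csize G S' w * of_bool (w' \<in> cl G S' w)))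
     \<le> csize G S u"
proof -
  let ?I = "{w\<in>S'. opn G u w}"
  have S': "finite S'" "u \<notin> S'" using S by (auto simp: S'_def)
  have fU: "finite (\<Union>w\<in>?I. cl G S' w)" using S' finite_cl[of S'] by auto
  have uU: "u \<notin> (\<Union>w\<in>?I. cl G S' w)" using S' cl_subset[of _ S' G] by fastforce
  have "csize G S u = 1 + real (card (\<Union>w\<in>?I. cl G S' w))"
    unfolding csize_eq_card using cl_rec[OF S(2), of G] fU uU by (simp add: S'_def)
  moreover have "(\<Sum>w\<in>?I. csize G S' w) = (\<Sum>w\<in>S'. b G w * csize G S' w)"
    unfolding b_def by (rule sum_opn) (use S' in auto)
  moreover have "(\<Sum>w\<in>?I. \<Sum>w'\<in>?I - {w}. csize G S' w * of_bool (w' \<in> cl G S' w))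
     = (\<Sum>w\<in>S'. \<Sum>w'\<in>S' - {w}. (b G w * b G w') * (csize G S' w * of_bool (w' \<in> cl G S' w)))"
  proof -
    have "(\<Sum>w\<in>?I. \<Sum>w'\<in>?I - {w}. csize G S' w * of_bool (w' \<in> cl G S' w))
       = (\<Sum>w\<in>?I. \<Sum>w'\<in>S' - {w}. (b G w * b G w') * (csize G S' w * of_bool (w' \<in> cl G S' w)))"
      by (intro sum.cong[OF refl] sum.mono_neutral_cong_left) (use S' in \<open>auto simp: b_def\<close>)
    also have "\<dots> = (\<Sum>w\<in>S'. \<Sum>w'\<in>S' - {w}. (b G w * b G w') * (csize G S' w * of_bool (w' \<in> cl G S' w)))"
      by (intro sum.mono_neutral_left) (use S' in \<open>auto simp: b_def\<close>)
    finally show ?thesis .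
  qed
  ultimately show ?thesis using card_UN_cl_ge[OF S'(1), of ?I G] by auto
qed

text \<open>A vertex lost by deleting \<open>u\<close> is \<open>u\<close> itself or lies behind it:
  a path from \<open>w\<close> reaches a neighbour \<open>w1\<close> of \<open>u\<close>, passes
  through \<open>u\<close> and continues to a neighbour \<open>w2\<close> outside the cluster of
  \<open>w\<close> in \<open>S - {u}\<close>. This is needed because the recursion speaks of
  \<open>S - {u}\<close>, whereas the operator inequality is to hold on one fixed set.\<close>

lemma csize_remove_le:
  assumes S: "finite S" "u \<in> S" and w: "w \<in> S - {u}"
  defines "S' \<equiv> S - {u}"
  defines "b \<equiv> \<lambda>G w. of_bool (opn G u w) :: real"
  shows "csize G S w \<le> csize G S' w + (\<Sum>w1\<in>S'. b G w1 * of_bool (w1 \<in> cl G S' w))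
     + (\<Sum>w1\<in>S'. \<Sum>w2\<in>S'. (b G w1 * b G w2) * (of_bool (w1 \<in> cl G S' w) * csize G S' w2 * of_bool (w2 \<notin> cl G S' w)))"
proof -
  let ?C = "cl G S'"
  let ?I = "{w2\<in>S'. opn G u w2 \<and> w2 \<notin> ?C w}"
  let ?P = "\<exists>w1\<in>?C w. opn G u w1"
  define D where "D = (if ?P then {u} \<union> (\<Union>w2\<in>?I. ?C w2) else {})"
  have S': "finite S'" "u \<notin> S'" "w \<in> S'" using S w by (auto simp: S'_def)
  have CS: "?C x \<subseteq> S'" if "x \<in> S'" for x by (rule cl_subset[OF that])
  have fC: "finite (?C x)" if "x \<in> S'" for x using finite_cl[OF S'(1) that] .
  have fI: "finite ?I" using S' by auto
  have fD: "finite D" using fC fI by (auto simp: D_def)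
  have sub: "cl G S w \<subseteq> ?C w \<union> D"
  proof (rule cl_closed_subset)
    show "w \<in> ?C w \<union> D" using cl_refl by auto
    fix x y assume x: "x \<in> ?C w \<union> D" and xy: "y \<in> S" "x \<in> S" "opn G x y"
    consider "x = u" | "y = u" "x \<noteq> u" | "y \<noteq> u" "x \<noteq> u" by blast
    then show "y \<in> ?C w \<union> D"
    proof cases
      case 1
      then have P: ?P using x S' CS[of w] by (auto simp: D_def split: if_splits)
      show ?thesis
      proof (cases "y = u \<or> y \<in> ?C w")
        case True then show ?thesis using P by (auto simp: D_def)
      next
        case False
        then have "y \<in> ?I" using 1 xy by (auto simp: S'_def)
        then show ?thesis using P cl_refl[of y G S'] by (auto simp: D_def)
      qed
    next
      case 2
      have ?P
      proof (cases "x \<in> ?C w")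
        case True then show ?thesis using xy 2 opn_commute by blast
      next
        case False then show ?thesis using x by (auto simp: D_def split: if_splits)
      qed
      then show ?thesis using 2 by (auto simp: D_def)
    next
      case 3
      then have xy': "x \<in> S'" "y \<in> S'" using xy by (auto simp: S'_def)
      have step: "y \<in> ?C z" if "x \<in> ?C z" for z
        by (rule opn_in_cl[OF that xy' xy(3)])
      from x show ?thesis using step 3 by (auto simp: D_def split: if_splits)
    qed
  qed
  have "csize G S w \<le> real (card (?C w \<union> D))"
    unfolding csize_eq_card using sub fC S' fD by (intro of_nat_mono card_mono) auto
  also have "\<dots> \<le> csize G S' w + real (card D)"
    unfolding csize_eq_card using card_Un_le[of "?C w" D] by linarith
  \<comment> \<open>The first factor dominates the indicator of \<open>?P\<close>: it is at least 1
    if \<open>u\<close> has an open neighbour in \<open>?C w\<close>, and otherwise \<open>D\<close>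
    is empty. Expanding the product gives the two sums of the claim.\<close>
  also have "real (card D) \<le> (\<Sum>w1\<in>S'. b G w1 * of_bool (w1 \<in> ?C w)) * (1 + (\<Sum>w2\<in>S'. b G w2 * (csize G S' w2 * of_bool (w2 \<notin> ?C w))))"
  proof (cases ?P)
    case False then show ?thesis
      by (auto simp: D_def b_def csize_eq_card intro!: mult_nonneg_nonneg add_nonneg_nonneg sum_nonneg)
  next
    case True
    then obtain w1 where w1: "w1 \<in> ?C w" "opn G u w1" by auto
    have w1S: "w1 \<in> S'" using w1 CS[OF S'(3)] by auto
    have ge1: "1 \<le> (\<Sum>w1\<in>S'. b G w1 * of_bool (w1 \<in> ?C w))"
      using member_le_sum[of w1 S' "\<lambda>w1. b G w1 * of_bool (w1 \<in> ?C w)"] w1 w1S S' by (auto simp: b_def)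
    have "card D \<le> 1 + card (\<Union>w2\<in>?I. ?C w2)"
      using True card_Un_le[of "{u}" "\<Union>w2\<in>?I. ?C w2"] by (simp add: D_def)
    also have "card (\<Union>w2\<in>?I. ?C w2) \<le> (\<Sum>w2\<in>?I. card (?C w2))"
      by (rule card_UN_le[OF fI])
    finally have "real (card D) \<le> 1 + (\<Sum>w2\<in>?I. csize G S' w2)"
      unfolding csize_eq_card by (simp flip: of_nat_sum)
    also have "(\<Sum>w2\<in>?I. csize G S' w2) = (\<Sum>w2\<in>S'. b G w2 * (csize G S' w2 * of_bool (w2 \<notin> ?C w)))"
      by (rule sum.mono_neutral_cong_left) (use S' in \<open>auto simp: b_def\<close>)
    finally have 1: "real (card D) \<le> 1 + (\<Sum>w2\<in>S'. b G w2 * (csize G S' w2 * of_bool (w2 \<notin> ?C w)))" .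
    have "0 \<le> 1 + (\<Sum>w2\<in>S'. b G w2 * (csize G S' w2 * of_bool (w2 \<notin> ?C w)))"
      by (auto simp: b_def csize_eq_card intro!: add_nonneg_nonneg sum_nonneg)
    then show ?thesis using 1 mult_right_mono[OF ge1] by fastforce
  qed
  also have "\<dots> = (\<Sum>w1\<in>S'. b G w1 * of_bool (w1 \<in> ?C w)) + (\<Sum>w1\<in>S'. \<Sum>w2\<in>S'. (b G w1 * b G w2) * (of_bool (w1 \<in> cl G S' w) * csize G S' w2 * of_bool (w2 \<notin> cl G S' w)))"
    unfolding distrib_left sum_product by (simp add: mult_ac)
  finally show ?thesis by simp
qed

context edge_percolation
begin

abbreviation meanC :: "nat set \<Rightarrow> nat \<Rightarrow> real" where
  "meanC S u \<equiv> E (\<lambda>G. csize G S u)"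

lemma E_csize_rec_ge:
  assumes S: "S \<subseteq> U" "u \<in> S"
  shows "meanC S u \<ge> 1 + (\<Sum>w\<in>S - {u}. p u w * meanC (S - {u}) w)
    - (\<Sum>w\<in>S - {u}. p u w * E (\<lambda>G. csize G (S - {u}) w * X (p u) G (S - {u}) w))"
proof -
  let ?S = "S - {u}"
  let ?b = "\<lambda>G w. of_bool (opn G u w) :: real"
  have fS: "finite S" using S finite_U finite_subset by blast
  have t1: "E (\<lambda>G. \<Sum>w\<in>?S. ?b G w * csize G ?S w) = (\<Sum>w\<in>?S. p u w * meanC ?S w)"
    unfolding E_sum by (rule sum.cong[OF refl], rule E_opn_mult[OF S _ depends_on_X])
  have t2: "E (\<lambda>G. \<Sum>w\<in>?S. \<Sum>w'\<in>?S - {w}. (?b G w * ?b G w') * (csize G ?S w * of_bool (w' \<in> cl G ?S w)))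
    \<le> (\<Sum>w\<in>?S. p u w * E (\<lambda>G. csize G ?S w * X (p u) G ?S w))"
    unfolding E_sum
  proof (rule sum_mono)
    fix w assume w: "w \<in> ?S"
    have "(\<Sum>w'\<in>?S - {w}. E (\<lambda>G. (?b G w * ?b G w') * (csize G ?S w * of_bool (w' \<in> cl G ?S w))))
       = (\<Sum>w'\<in>?S - {w}. p u w * p u w' * E (\<lambda>G. csize G ?S w * of_bool (w' \<in> cl G ?S w)))"
    proof (rule sum.cong[OF refl])
      fix w' assume w': "w' \<in> ?S - {w}"
      show "E (\<lambda>G. (?b G w * ?b G w') * (csize G ?S w * of_bool (w' \<in> cl G ?S w)))
          = p u w * p u w' * E (\<lambda>G. csize G ?S w * of_bool (w' \<in> cl G ?S w))"
        by (rule E_opn_opn_mult[OF S w])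
          (use w' in \<open>auto intro!: depends_on_comp2[OF depends_on_X depends_on_comp[OF depends_on_cl[of ?S w], of "\<lambda>C. w' \<in> C"], where g = "\<lambda>a b. a * of_bool b"]\<close>)
    qed
    also have "\<dots> \<le> (\<Sum>w'\<in>?S. p u w * p u w' * E (\<lambda>G. csize G ?S w * of_bool (w' \<in> cl G ?S w)))"
      by (rule sum_mono2) (use fS in \<open>auto intro!: mult_nonneg_nonneg p_nonneg E_nonneg csize_nonneg\<close>)
    also have "\<dots> = p u w * E (\<lambda>G. csize G ?S w * X (p u) G ?S w)"
    proof -
      have "E (\<lambda>G. csize G ?S w * X (p u) G ?S w) = E (\<lambda>G. \<Sum>w'\<in>?S. p u w' * (csize G ?S w * of_bool (w' \<in> cl G ?S w)))"
      proof (intro arg_cong[of _ _ E] ext)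
        fix G
        have fS': "finite ?S" using fS by simp
        show "csize G ?S w * X (p u) G ?S w = (\<Sum>w'\<in>?S. p u w' * (csize G ?S w * of_bool (w' \<in> cl G ?S w)))"
          unfolding X_eq_sum_of_bool[OF fS' w, of "p u"] sum_distrib_left
          by (intro sum.cong refl) (simp only: mult_ac)
      qed
      also have "\<dots> = (\<Sum>w'\<in>?S. p u w' * E (\<lambda>G. csize G ?S w * of_bool (w' \<in> cl G ?S w)))"
        unfolding E_sum E_cmult ..
      finally show ?thesis by (simp add: sum_distrib_left mult_ac)
    qed
    finally show "(\<Sum>w'\<in>?S - {w}. E (\<lambda>G. (?b G w * ?b G w') * (csize G ?S w * of_bool (w' \<in> cl G ?S w))))
      \<le> p u w * E (\<lambda>G. csize G ?S w * X (p u) G ?S w)" .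
  qed
  have "E (\<lambda>G. 1 + (\<Sum>w\<in>?S. ?b G w * csize G ?S w)
     - (\<Sum>w\<in>?S. \<Sum>w'\<in>?S - {w}. (?b G w * ?b G w') * (csize G ?S w * of_bool (w' \<in> cl G ?S w))))
     \<le> meanC S u"
    by (rule E_mono) (rule csize_rec_ge[OF fS S(2)])
  then show ?thesis using t1 t2 unfolding E_diff E_add by simp
qed

lemma E_csize_remove_le:
  assumes S: "S \<subseteq> U" "u \<in> S" and w: "w \<in> S - {u}"
  shows "meanC S w \<le> meanC (S - {u}) w
    + meanX (p u) (S - {u}) w * (1 + Kop S (\<lambda>w2. meanC (S - {u}) w2) u)"
proof -
  let ?S = "S - {u}"
  let ?b = "\<lambda>G w. of_bool (opn G u w) :: real"
  have fS: "finite S" using S finite_U finite_subset by blast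
  have PX: "(\<Sum>w1\<in>?S. p u w1 * E (\<lambda>G. of_bool (w1 \<in> cl G ?S w))) = meanX (p u) ?S w"
  proof -
    have "meanX (p u) ?S w = E (\<lambda>G. \<Sum>w1\<in>?S. p u w1 * of_bool (w1 \<in> cl G ?S w))"
      using fS w by (intro arg_cong[of _ _ E] ext) (simp add: X_eq_sum_of_bool[of ?S w "p u"])
    then show ?thesis unfolding E_sum E_cmult by simp
  qed
  have t1: "E (\<lambda>G. \<Sum>w1\<in>?S. ?b G w1 * of_bool (w1 \<in> cl G ?S w)) = (\<Sum>w1\<in>?S. p u w1 * E (\<lambda>G. of_bool (w1 \<in> cl G ?S w)))"
    unfolding E_sum by (rule sum.cong[OF refl], rule E_opn_mult[OF S _ depends_on_comp[OF depends_on_cl]])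
  have t2: "E (\<lambda>G. (?b G w1 * ?b G w2) * (of_bool (w1 \<in> cl G ?S w) * csize G ?S w2 * of_bool (w2 \<notin> cl G ?S w)))
     \<le> (p u w1 * E (\<lambda>G. of_bool (w1 \<in> cl G ?S w))) * (p u w2 * meanC ?S w2)"
    if w12: "w1 \<in> ?S" "w2 \<in> ?S" for w1 w2
  proof (cases "w1 = w2")
    case True
    then have "(\<lambda>G. (?b G w1 * ?b G w2) * (of_bool (w1 \<in> cl G ?S w) * csize G ?S w2 * of_bool (w2 \<notin> cl G ?S w))) = (\<lambda>_. 0)"
      by (auto simp: fun_eq_iff)
    moreover have "0 \<le> (p u w1 * E (\<lambda>G. of_bool (w1 \<in> cl G ?S w))) * (p u w2 * meanC ?S w2)"
      by (intro mult_nonneg_nonneg p_nonneg E_nonneg csize_nonneg) auto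
    ultimately show ?thesis by (simp only:) simp
  next
    case False
    have d: "depends_on (\<lambda>G. of_bool (w1 \<in> cl G ?S w) * csize G ?S w2 * of_bool (w2 \<notin> cl G ?S w)) (pairs_in ?S)"
      by (rule depends_on_comp2[OF depends_on_cl[of ?S w] depends_on_X[of "\<lambda>_. 1" ?S w2],
            where g = "\<lambda>C a. of_bool (w1 \<in> C) * a * of_bool (w2 \<notin> C)"])
    have "E (\<lambda>G. (?b G w1 * ?b G w2) * (of_bool (w1 \<in> cl G ?S w) * csize G ?S w2 * of_bool (w2 \<notin> cl G ?S w)))
      = p u w1 * p u w2 * E (\<lambda>G. of_bool (w1 \<in> cl G ?S w) * csize G ?S w2 * of_bool (w2 \<notin> cl G ?S w))"
      by (rule E_opn_opn_mult[OF S w12 False d])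
    also have "\<dots> \<le> p u w1 * p u w2 * (E (\<lambda>G. of_bool (w1 \<in> cl G ?S w)) * meanC ?S w2)"
      unfolding csize_eq_card
      by (intro mult_left_mono mult_nonneg_nonneg p_nonneg
            disjoint_clusters_le[where F = "\<lambda>C. of_bool (w1 \<in> C)" and H = "\<lambda>C. real (card C)"])
        (use fS w w12 in \<open>auto intro!: card_mono intro: finite_subset\<close>)
    finally show ?thesis by (simp add: mult_ac)
  qed
  have "meanC S w \<le> E (\<lambda>G. csize G ?S w + (\<Sum>w1\<in>?S. ?b G w1 * of_bool (w1 \<in> cl G ?S w))
     + (\<Sum>w1\<in>?S. \<Sum>w2\<in>?S. (?b G w1 * ?b G w2) * (of_bool (w1 \<in> cl G ?S w) * csize G ?S w2 * of_bool (w2 \<notin> cl G ?S w))))"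
    by (rule E_mono) (rule csize_remove_le[OF fS S(2) w])
  also have "\<dots> = meanC ?S w + meanX (p u) ?S w
     + (\<Sum>w1\<in>?S. \<Sum>w2\<in>?S. E (\<lambda>G. (?b G w1 * ?b G w2) * (of_bool (w1 \<in> cl G ?S w) * csize G ?S w2 * of_bool (w2 \<notin> cl G ?S w))))"
    unfolding E_add t1 PX by (simp only: E_sum)
  also have "\<dots> \<le> meanC ?S w + meanX (p u) ?S w
     + (\<Sum>w1\<in>?S. \<Sum>w2\<in>?S. (p u w1 * E (\<lambda>G. of_bool (w1 \<in> cl G ?S w))) * (p u w2 * meanC ?S w2))"
    by (intro add_left_mono sum_mono t2)
  also have "\<dots> = meanC ?S w + meanX (p u) ?S w * (1 + Kop S (\<lambda>w2. meanC ?S w2) u)"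
    unfolding sum_product[symmetric] PX Kop_def by (simp add: algebra_simps)
  finally show ?thesis .
qed

text \<open>
  The first error term accounts for paths from a neighbour of \<open>u\<close> back to \<open>u\<close>, the second
  one for pairs of neighbours of \<open>u\<close> that are connected without \<open>u\<close>.
\<close>

lemma E_csize_almost_super:
  assumes V: "V \<subseteq> U" and u: "u \<in> V"
    and \<phi>: "\<And>v. v \<in> V \<Longrightarrow> 0 \<le> \<phi> v" and super: "\<And>v. v \<in> V \<Longrightarrow> 1 + Kop V \<phi> v \<le> \<phi> v"
    and q: "\<And>v. v \<in> V \<Longrightarrow> 0 \<le> q v" and superq: "\<And>v. v \<in> V \<Longrightarrow> p u v + Kop V q v \<le> q v"
  shows "1 + Kop V (\<lambda>w. meanC V w) u \<le>
     meanC V u + (\<phi> u * Kop V q u + (\<Sum>w\<in>V. \<phi> w * (q w)\<^sup>2))"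
proof -
  let ?V = "V - {u}"
  have fV: "finite V" using V finite_U finite_subset by blast
  let ?T = "\<lambda>w. meanC V w" and ?T' = "\<lambda>w. meanC ?V w"
  have EXq: "meanX (p u) ?V w \<le> q w" if "w \<in> ?V" for w
    by (rule E_X_le[OF V p_nonneg q superq]) (use that in auto)
  have T': "?T' w \<le> \<phi> w" if "w \<in> ?V" for w
    by (rule E_X_le[OF V _ \<phi> super]) (use that in auto)
  have K1: "1 + Kop V ?T' u \<le> \<phi> u"
  proof -
    have "Kop V ?T' u \<le> Kop V \<phi> u" by (rule Kop_mono[OF fV]) (use \<phi> T' in auto)
    then show ?thesis using super[OF u] by simp
  qed
  have K0: "0 \<le> 1 + Kop V ?T' u"
    unfolding Kop_def by (intro add_nonneg_nonneg sum_nonneg mult_nonneg_nonneg p_nonneg E_nonneg csize_nonneg) auto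
  have "Kop V ?T u \<le> (\<Sum>w\<in>?V. p u w * (?T' w + q w * \<phi> u))"
    unfolding Kop_def
  proof (intro sum_mono mult_left_mono p_nonneg)
    fix w assume w: "w \<in> ?V"
    have "meanX (p u) ?V w * (1 + Kop V ?T' u) \<le> q w * \<phi> u"
      by (rule mult_mono) (use EXq[OF w] K1 K0 q w in auto)
    then show "?T w \<le> ?T' w + q w * \<phi> u" using E_csize_remove_le[OF V u w] by linarith
  qed
  also have "\<dots> = (\<Sum>w\<in>?V. p u w * ?T' w) + \<phi> u * Kop V q u"
    unfolding Kop_def by (simp add: distrib_left sum.distrib sum_distrib_left mult_ac)
  finally have 1: "Kop V ?T u \<le> (\<Sum>w\<in>?V. p u w * ?T' w) + \<phi> u * Kop V q u" .
  have "(\<Sum>w\<in>?V. p u w * E (\<lambda>G. csize G ?V w * X (p u) G ?V w))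
     \<le> (\<Sum>w\<in>?V. p u w * Gop V (card V) (\<lambda>v. \<phi> v * q v) w)"
    by (intro sum_mono mult_left_mono p_nonneg E_XX_le[OF V _ \<phi> super p_nonneg q superq])
      (use fV in \<open>auto intro: card_mono\<close>)
  also have "\<dots> \<le> (\<Sum>w\<in>V. p u w * Gop V (card V) (\<lambda>v. \<phi> v * q v) w)"
    by (rule sum_mono2[OF fV]) (use \<phi> q in \<open>auto intro!: mult_nonneg_nonneg p_nonneg Gop_nonneg\<close>)
  \<comment> \<open>Symmetry moves the series onto the kernel \<open>p u\<close>, where it is
    bounded by \<open>q\<close>; this produces the square of \<open>q\<close>.\<close>
  also have "\<dots> = (\<Sum>w\<in>V. Gop V (card V) (p u) w * (\<phi> w * q w))"
    by (rule Gop_sym[OF fV])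
  also have "\<dots> \<le> (\<Sum>w\<in>V. q w * (\<phi> w * q w))"
    by (intro sum_mono mult_right_mono Gop_le[OF fV q superq]) (use \<phi> q in auto)
  finally have 2: "(\<Sum>w\<in>?V. p u w * E (\<lambda>G. csize G ?V w * X (p u) G ?V w)) \<le> (\<Sum>w\<in>V. \<phi> w * (q w)\<^sup>2)"
    by (simp add: power2_eq_square mult_ac)
  show ?thesis using 1 2 E_csize_rec_ge[OF V u] by linarith
qed

text \<open>At a minimiser \<open>m\<close> of \<open>z / \<phi>\<close> with negative minimum
  \<open>t\<close> one would have \<open>z m = t * \<phi> m < t * Kop V \<phi> m \<le> Kop V z m
  \<le> z m\<close>.\<close>

lemma Kop_max_principle:
  assumes V: "finite V" and \<phi>: "\<And>v. v \<in> V \<Longrightarrow> 0 < \<phi> v" "\<And>v. v \<in> V \<Longrightarrow> Kop V \<phi> v < \<phi> v"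
    and z: "\<And>v. v \<in> V \<Longrightarrow> Kop V z v \<le> z v" and u: "u \<in> V"
  shows "0 \<le> z u"
proof -
  define t where "t = Min ((\<lambda>v. z v / \<phi> v) ` V)"
  have "t \<in> (\<lambda>v. z v / \<phi> v) ` V" unfolding t_def using V u by (intro Min_in) auto
  then obtain m where m: "m \<in> V" "t = z m / \<phi> m" by auto
  have t: "t * \<phi> v \<le> z v" if "v \<in> V" for v
  proof -
    have "t \<le> z v / \<phi> v" unfolding t_def using V that by (intro Min_le) auto
    then show ?thesis using \<phi>(1)[OF that] by (simp add: field_simps)
  qed
  have "0 \<le> t"
  proof (rule ccontr)
    assume "\<not> 0 \<le> t"
    have "t * \<phi> m < t * Kop V \<phi> m" using \<phi>(2)[OF m(1)] \<open>\<not> 0 \<le> t\<close> by simp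
    also have "\<dots> = Kop V (\<lambda>w. t * \<phi> w) m" by (simp only: Kop_cmult)
    also have "\<dots> \<le> Kop V z m" unfolding Kop_def by (intro sum_mono mult_left_mono p_nonneg t) auto
    also have "\<dots> \<le> z m" using z m by auto
    also have "z m = t * \<phi> m" using m \<phi>(1)[OF m(1)] by simp
    finally show False by simp
  qed
  then have "0 \<le> t * \<phi> u" using \<phi>(1)[OF u] by simp
  then show ?thesis using t[OF u] by linarith
qed

text \<open>A cluster of size at least \<open>t\<close> contributes its size cubed to the sum of
  squared cluster sizes over all vertices. After \<open>Gop_sym\<close> the series acts on the
  constant 1 and is bounded by \<open>\<phi>\<close> once more, whence the cube of
  \<open>\<phi>\<close>.\<close>

lemma prob_large_cluster_le:
  assumes V: "V \<subseteq> U" and \<phi>: "\<And>v. v \<in> V \<Longrightarrow> 0 \<le> \<phi> v"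
    and super: "\<And>v. v \<in> V \<Longrightarrow> 1 + Kop V \<phi> v \<le> \<phi> v" and t: "0 < t"
  shows "prob {G. \<exists>u\<in>V. t \<le> csize G V u} \<le> (\<Sum>u\<in>V. \<phi> u ^ 3) / t ^ 3"
proof -
  have fV: "finite V" using V finite_U finite_subset by blast
  have "t ^ 3 * of_bool (\<exists>u\<in>V. t \<le> csize G V u) \<le> (\<Sum>u\<in>V. csize G V u * csize G V u)" for G
  proof (cases "\<exists>u\<in>V. t \<le> csize G V u")
    case False then show ?thesis by (simp add: csize_nonneg sum_nonneg)
  next
    case True
    then obtain u where u: "u \<in> V" "t \<le> csize G V u" by auto
    have "t ^ 3 \<le> csize G V u ^ 3" using u t by (intro power_mono) auto
    also have "\<dots> = (\<Sum>v\<in>cl G V u. csize G V u * csize G V u)"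
      by (simp add: csize_eq_card power3_eq_cube)
    also have "\<dots> = (\<Sum>v\<in>cl G V u. csize G V v * csize G V v)"
      by (rule sum.cong[OF refl]) (metis cl_eq csize_eq_card)
    also have "\<dots> \<le> (\<Sum>v\<in>V. csize G V v * csize G V v)"
      by (rule sum_mono2[OF fV cl_subset[OF u(1)]]) auto
    finally show ?thesis using True by simp
  qed
  then have "E (\<lambda>G. t ^ 3 * of_bool (\<exists>u\<in>V. t \<le> csize G V u)) \<le> E (\<lambda>G. \<Sum>u\<in>V. csize G V u * csize G V u)"
    by (rule E_mono)
  also have "\<dots> \<le> (\<Sum>u\<in>V. 1 * Gop V (card V) (\<lambda>v. \<phi> v * \<phi> v) u)"
    unfolding E_sum
    by (intro sum_mono) (use E_XX_le[OF V _ \<phi> super _ \<phi> super] in auto)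
  also have "\<dots> = (\<Sum>u\<in>V. Gop V (card V) (\<lambda>_. 1) u * (\<phi> u * \<phi> u))"
    by (rule Gop_sym[OF fV])
  also have "\<dots> \<le> (\<Sum>u\<in>V. \<phi> u * (\<phi> u * \<phi> u))"
    by (intro sum_mono mult_right_mono Gop_le[OF fV \<phi> super]) (use \<phi> in auto)
  finally show ?thesis
    unfolding E_cmult E_of_bool using t by (simp add: field_simps power3_eq_cube)
qed

lemma paley_zygmund:
  assumes s: "0 < s" "2 * s \<le> E Y" and Q: "0 < Q" "E (\<lambda>G. Y G * Y G) \<le> Q"
  shows "s\<^sup>2 / Q \<le> prob {G. s \<le> Y G}"
proof -
  \<comment> \<open>\<open>y \<le> c * y^2 + 1 / (4 * c)\<close> holds for every positive
    \<open>c\<close>; this one gives \<open>c * Q = s / 2\<close> and so leaves \<open>s / 2\<close>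
    of the mean to the event.\<close>
  define c where "c = s / (2 * Q)"
  have c: "0 < c" using s Q by (simp add: c_def)
  have "Y G \<le> s + c * (Y G * Y G) + 1 / (4 * c) * of_bool (s \<le> Y G)" for G
  proof (cases "s \<le> Y G")
    case True
    have "0 \<le> (2 * c * Y G - 1)\<^sup>2 / (4 * c)" using c by simp
    also have "\<dots> = c * (Y G * Y G) + 1 / (4 * c) - Y G" using c by (simp add: field_simps power2_eq_square)
    finally show ?thesis using True s by simp
  next
    case False
    have "0 \<le> c * (Y G * Y G)" using c by simp
    then show ?thesis using False by simp
  qed
  then have "E Y \<le> E (\<lambda>G. s + c * (Y G * Y G) + 1 / (4 * c) * of_bool (s \<le> Y G))" by (rule E_mono)
  also have "\<dots> = s + c * E (\<lambda>G. Y G * Y G) + 1 / (4 * c) * prob {G. s \<le> Y G}"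
    unfolding E_add E_cmult E_of_bool by simp
  also have "\<dots> \<le> s + c * Q + 1 / (4 * c) * prob {G. s \<le> Y G}"
    using mult_left_mono[OF Q(2), of c] c by simp
  finally have "E Y \<le> s + c * Q + 1 / (4 * c) * prob {G. s \<le> Y G}" .
  moreover have "c * Q = s / 2" "1 / (4 * c) = Q / (2 * s)" using s Q by (simp_all add: c_def)
  ultimately have "s / 2 \<le> Q / (2 * s) * prob {G. s \<le> Y G}" using s(2) by (simp only:)
  then show ?thesis using s Q by (simp add: field_simps power2_eq_square)
qed

text \<open>Chebyshev's inequality for the number of \<open>m\<close> in \<open>B\<close> with a
  large cluster. For vertices in different clusters the joint probability is at most the product, so
  the variance is at most the expected number of connected ordered pairs in
  \<open>B\<close>.\<close>

lemma prob_no_large_cluster_le: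
  assumes V: "V \<subseteq> U" and B: "B \<subseteq> V" and \<mu>: "0 < \<mu>" "\<mu> \<le> (\<Sum>m\<in>B. prob {G. s \<le> csize G V m})"
    and v: "(\<Sum>m\<in>B. meanX (indicator B) V m) \<le> v"
  shows "prob {G. \<forall>m\<in>B. csize G V m < s} \<le> v / \<mu>\<^sup>2"
proof -
  have fV: "finite V" using V finite_U finite_subset by blast
  have fB: "finite B" using B fV finite_subset by blast
  let ?I = "\<lambda>G m. of_bool (s \<le> csize G V m) :: real"
  let ?N = "\<lambda>G. \<Sum>m\<in>B. ?I G m"
  define \<nu> where "\<nu> = (\<Sum>m\<in>B. prob {G. s \<le> csize G V m})"
  have EN: "E ?N = \<nu>" unfolding E_sum E_of_bool \<nu>_def ..
  have pair: "E (\<lambda>G. ?I G m * ?I G m') \<le> E (\<lambda>G. of_bool (m' \<in> cl G V m)) + E (\<lambda>G. ?I G m) * E (\<lambda>G. ?I G m')"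
    if m: "m \<in> B" "m' \<in> B" for m m'
  proof -
    have "E (\<lambda>G. ?I G m * ?I G m') \<le> E (\<lambda>G. of_bool (m' \<in> cl G V m) + ?I G m * ?I G m' * of_bool (m' \<notin> cl G V m))"
      by (rule E_mono) auto
    also have "\<dots> = E (\<lambda>G. of_bool (m' \<in> cl G V m)) + E (\<lambda>G. ?I G m * ?I G m' * of_bool (m' \<notin> cl G V m))"
      by (rule E_add)
    also have "E (\<lambda>G. ?I G m * ?I G m' * of_bool (m' \<notin> cl G V m)) \<le> E (\<lambda>G. ?I G m) * E (\<lambda>G. ?I G m')"
      unfolding csize_eq_card
    proof (rule disjoint_clusters_le[where F = "\<lambda>C. of_bool (s \<le> real (card C))" and H = "\<lambda>C. of_bool (s \<le> real (card C))"])
      fix T T' assume "T \<subseteq> T'" "T' \<subseteq> V"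
      then have "card T \<le> card T'" using fV by (intro card_mono) (auto intro: finite_subset)
      then show "(of_bool (s \<le> real (card T)) :: real) \<le> of_bool (s \<le> real (card T'))" by auto
    qed (use fV B m in auto)
    finally show ?thesis by simp
  qed
  have "E (\<lambda>G. ?N G * ?N G) = (\<Sum>m\<in>B. \<Sum>m'\<in>B. E (\<lambda>G. ?I G m * ?I G m'))"
    unfolding sum_product E_sum ..
  also have "\<dots> \<le> (\<Sum>m\<in>B. \<Sum>m'\<in>B. E (\<lambda>G. of_bool (m' \<in> cl G V m)) + E (\<lambda>G. ?I G m) * E (\<lambda>G. ?I G m'))"
    by (intro sum_mono pair)
  also have "\<dots> = (\<Sum>m\<in>B. \<Sum>m'\<in>B. E (\<lambda>G. of_bool (m' \<in> cl G V m))) + \<nu> * \<nu>"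
    unfolding \<nu>_def E_of_bool sum.distrib sum_product ..
  also have "(\<Sum>m\<in>B. \<Sum>m'\<in>B. E (\<lambda>G. of_bool (m' \<in> cl G V m))) = (\<Sum>m\<in>B. meanX (indicator B) V m)"
  proof (rule sum.cong[OF refl])
    fix m assume m: "m \<in> B"
    have "X (indicator B) G V m = (\<Sum>m'\<in>B. of_bool (m' \<in> cl G V m))" for G
      using m B by (subst X_eq_sum_of_bool[OF fV]) (auto intro!: sum.mono_neutral_cong_right fV simp: indicator_def)
    then show "(\<Sum>m'\<in>B. E (\<lambda>G. of_bool (m' \<in> cl G V m))) = meanX (indicator B) V m"
      by (simp only: E_sum)
  qed
  finally have EN2: "E (\<lambda>G. ?N G * ?N G) \<le> v + \<nu> * \<nu>" using v by simp
  have "\<nu>\<^sup>2 * of_bool (\<forall>m\<in>B. csize G V m < s) \<le> ?N G * ?N G - 2 * \<nu> * ?N G + \<nu> * \<nu>" for G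
  proof (cases "\<forall>m\<in>B. csize G V m < s")
    case True
    then have "?N G = 0" by (intro sum.neutral) auto
    then show ?thesis using True by (simp add: power2_eq_square)
  next
    case False
    obtain a where a: "?N G = a" by simp
    have "0 \<le> (a - \<nu>)\<^sup>2" by simp
    then have "0 \<le> a * a - 2 * \<nu> * a + \<nu> * \<nu>" by (simp add: power2_eq_square algebra_simps)
    moreover have "of_bool (\<forall>m\<in>B. csize G V m < s) = (0 :: real)" using False by simp
    ultimately show ?thesis unfolding a by (simp only: mult_zero_right)
  qed
  then have "E (\<lambda>G. \<nu>\<^sup>2 * of_bool (\<forall>m\<in>B. csize G V m < s)) \<le> E (\<lambda>G. ?N G * ?N G - 2 * \<nu> * ?N G + \<nu> * \<nu>)"
    by (rule E_mono)
  also have "\<dots> = E (\<lambda>G. ?N G * ?N G) - 2 * \<nu> * \<nu> + \<nu> * \<nu>"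
    unfolding E_add E_diff E_cmult EN by simp
  also have "\<dots> \<le> v" using EN2 by simp
  finally have 1: "\<nu>\<^sup>2 * prob {G. \<forall>m\<in>B. csize G V m < s} \<le> v"
    unfolding E_cmult E_of_bool .
  have "\<mu>\<^sup>2 \<le> \<nu>\<^sup>2" using \<mu> by (intro power_mono) (auto simp: \<nu>_def)
  then have "\<mu>\<^sup>2 * prob {G. \<forall>m\<in>B. csize G V m < s} \<le> v"
    using 1 mult_right_mono[of "\<mu>\<^sup>2" "\<nu>\<^sup>2" "prob {G. \<forall>m\<in>B. csize G V m < s}"] by simp
  then show ?thesis using \<mu>(1) by (simp add: field_simps)
qed

end

section \<open>The growing random graph\<close>

definition sym_edge_prob :: "real \<Rightarrow> real \<Rightarrow> nat \<Rightarrow> nat \<Rightarrow> real" where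
  "sym_edge_prob \<gamma> \<beta> u w = edge_prob \<gamma> \<beta> (min u w) (max u w)"

lemma edge_percolation_growing:
  assumes "0 \<le> \<beta>"
  shows "edge_percolation {1..n} (sym_edge_prob \<gamma> \<beta>)"
proof
  fix u w
  show "sym_edge_prob \<gamma> \<beta> u w = sym_edge_prob \<gamma> \<beta> w u"
    by (metis sym_edge_prob_def min.commute max.commute)
  show "0 \<le> sym_edge_prob \<gamma> \<beta> u w" "sym_edge_prob \<gamma> \<beta> u w \<le> 1"
    using assms by (simp_all add: sym_edge_prob_def edge_prob_def)
qed simp

definition open_edges :: "nat \<Rightarrow> (nat \<times> nat \<Rightarrow> bool) \<Rightarrow> nat set set" where
  "open_edges n G = {{i, j} | i j. (i, j) \<in> vertex_pairs n \<and> G (i, j)}"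

lemma growing_graph_eq:
  assumes "0 \<le> \<beta>"
  shows "growing_graph \<gamma> \<beta> n =
    map_pmf (open_edges n) (edge_percolation.M {1..n} (sym_edge_prob \<gamma> \<beta>))"
proof -
  interpret edge_percolation "{1..n}" "sym_edge_prob \<gamma> \<beta>"
    by (rule edge_percolation_growing[OF assms])
  have "M = Pi_pmf (vertex_pairs n) False (\<lambda>(i, j). bernoulli_pmf (edge_prob \<gamma> \<beta> i j))"
    unfolding M_def vertex_pairs_eq
    by (rule Pi_pmf_cong) (auto simp: pairs_in_def sym_edge_prob_def min_def max_def)
  then show ?thesis by (simp add: growing_graph_def open_edges_def[abs_def])
qed

lemma open_edges_rel: "{(u, v). {u, v} \<in> open_edges n G} = open_rel G {1..n}"
proof -
  have "{u, v} \<in> open_edges n G \<longleftrightarrow> (u, v) \<in> open_rel G {1..n}" for u v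
  proof
    assume "{u, v} \<in> open_edges n G"
    then obtain i j where ij: "{u, v} = {i, j}" "(i, j) \<in> vertex_pairs n" "G (i, j)"
      by (auto simp: open_edges_def)
    then have "u = i \<and> v = j \<or> u = j \<and> v = i" by (auto simp: doubleton_eq_iff)
    then show "(u, v) \<in> open_rel G {1..n}" using ij by (auto simp: vertex_pairs_def open_rel_def opn_def min_def max_def)
  next
    assume a: "(u, v) \<in> open_rel G {1..n}"
    then have "(min u v, max u v) \<in> vertex_pairs n" "G (min u v, max u v)"
      by (auto simp: vertex_pairs_def open_rel_def opn_def min_def max_def)
    moreover have "{u, v} = {min u v, max u v}" by (auto simp: min_def max_def)
    ultimately show "{u, v} \<in> open_edges n G" unfolding open_edges_def by blast
  qed
  then show ?thesis by auto
qed

lemma components_open_edges: "components n (open_edges n G) = cl G {1..n} ` {1..n}"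
  unfolding components_def open_edges_rel quotient_def cl_def by auto

lemma largest_component_open_edges:
  assumes "1 \<le> n"
  shows "\<exists>u\<in>{1..n}. largest_component n (open_edges n G) = cl G {1..n} u"
    and "u \<in> {1..n} \<Longrightarrow> card (cl G {1..n} u) \<le> card (largest_component n (open_edges n G))"
proof -
  let ?P = "\<lambda>D. D \<in> cl G {1..n} ` {1..n}"
  have "?P (cl G {1..n} 1)" using assms by auto
  moreover have "\<forall>D. ?P D \<longrightarrow> card D < n + 1"
  proof (intro allI impI)
    fix D assume "?P D"
    then have "D \<subseteq> {1..n}" using cl_subset by blast
    then have "card D \<le> card {1..n}" by (intro card_mono) auto
    then show "card D < n + 1" by simp
  qed
  ultimately have *: "?P (arg_max card ?P) \<and> (\<forall>D. ?P D \<longrightarrow> card D \<le> card (arg_max card ?P))"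
    by (rule arg_max_nat_lemma)
  have L: "largest_component n (open_edges n G) = arg_max card ?P"
    by (simp add: largest_component_def components_open_edges)
  show "\<exists>u\<in>{1..n}. largest_component n (open_edges n G) = cl G {1..n} u"
    using * unfolding L by auto
  show "u \<in> {1..n} \<Longrightarrow> card (cl G {1..n} u) \<le> card (largest_component n (open_edges n G))"
    using * unfolding L by auto
qed

text \<open>Clusters grow with the vertex set: a large cluster in the subgraph induced on
  \<open>V\<close> is enough for the lower bound, while the upper bound concerns all of
  \<open>{1..n}\<close>.\<close>

lemma prob_largest_component_ge:
  fixes \<gamma> \<beta> lo hi :: real
  assumes \<beta>: "0 \<le> \<beta>" and n: "1 \<le> n" and V: "B \<subseteq> V" "V \<subseteq> {1..n}"
  defines "P \<equiv> edge_percolation.M {1..n} (sym_edge_prob \<gamma> \<beta>)"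
  shows "measure_pmf.prob (growing_graph \<gamma> \<beta> n) {E. real (card (largest_component n E)) \<in> {lo..hi}}
    \<ge> 1 - measure_pmf.prob P {G. \<exists>u\<in>{1..n}. hi \<le> csize G {1..n} u}
        - measure_pmf.prob P {G. \<forall>m\<in>B. csize G V m < lo}"
proof -
  let ?L = "\<lambda>G. largest_component n (open_edges n G)"
  let ?X = "{G. real (card (?L G)) \<in> {lo..hi}}"
  let ?Y = "{G. \<exists>u\<in>{1..n}. hi \<le> csize G {1..n} u}"
  let ?Z = "{G. \<forall>m\<in>B. csize G V m < lo}"
  have "- ?X \<subseteq> ?Y \<union> ?Z"
  proof
    fix G assume w: "G \<in> - ?X"
    show "G \<in> ?Y \<union> ?Z"
    proof (cases "real (card (?L G)) < lo")
      case True
      have "csize G V m < lo" if m: "m \<in> B" for m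
      proof -
        have m': "m \<in> {1..n}" using m V by auto
        have "card (cl G V m) \<le> card (cl G {1..n} m)"
          using cl_mono[OF V(2), of G m] finite_cl[OF _ m', of G] by (intro card_mono) auto
        also have "\<dots> \<le> card (?L G)" by (rule largest_component_open_edges(2)[OF n m'])
        finally show ?thesis using True by (simp add: csize_eq_card)
      qed
      then show ?thesis by auto
    next
      case False
      then have "hi < real (card (?L G))" using w by auto
      moreover obtain u where "u \<in> {1..n}" "?L G = cl G {1..n} u"
        using largest_component_open_edges(1)[OF n, of G] by blast
      ultimately show ?thesis unfolding csize_eq_card by (metis (mono_tags, lifting) UnI1 less_imp_le mem_Collect_eq)
    qed
  qed
  then have "measure_pmf.prob P (- ?X) \<le> measure_pmf.prob P (?Y \<union> ?Z)"
    by (intro measure_pmf.finite_measure_mono) auto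
  also have "\<dots> \<le> measure_pmf.prob P ?Y + measure_pmf.prob P ?Z"
    by (rule measure_Un_le) auto
  also have "measure_pmf.prob P (- ?X) = 1 - measure_pmf.prob P ?X"
    using measure_pmf.prob_compl[of ?X P] by (simp add: Compl_eq_Diff_UNIV)
  also have "measure_pmf.prob P ?X = measure_pmf.prob (growing_graph \<gamma> \<beta> n) {E. real (card (largest_component n E)) \<in> {lo..hi}}"
    unfolding growing_graph_eq[OF \<beta>] P_def by (simp add: vimage_def)
  finally show ?thesis by simp
qed

text \<open>Integral comparison for a decreasing \<open>g\<close> by the mean value theorem on unit
  intervals. The term \<open>j\<close> is compared with the interval to its left, which is why the
  sum starts after \<open>A\<close>.\<close>

lemma sum_le_antiderivative:
  fixes G g :: "real \<Rightarrow> real"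
  assumes "A \<le> i"
    and "\<And>t. real A \<le> t \<Longrightarrow> t \<le> real i \<Longrightarrow> (G has_real_derivative g t) (at t)"
    and "\<And>s t. real A \<le> s \<Longrightarrow> s \<le> t \<Longrightarrow> t \<le> real i \<Longrightarrow> g t \<le> g s"
  shows "(\<Sum>j\<in>{A<..i}. g (real j)) \<le> G (real i) - G (real A)"
  using assms
proof (induction i rule: dec_induct)
  case base then show ?case by simp
next
  case (step i)
  have "(\<Sum>j\<in>{A<..i}. g (real j)) \<le> G (real i) - G (real A)"
    by (rule step.IH) (use step.prems in auto)
  moreover have "{A<..Suc i} = insert (Suc i) {A<..i}" using step.hyps by auto
  moreover obtain z where z: "real i < z" "z < real (Suc i)" "G (real (Suc i)) - G (real i) = (real (Suc i) - real i) * g z"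
    using MVT2[of "real i" "real (Suc i)" G g] step by auto
  moreover have "g (real (Suc i)) \<le> g z" using step.prems(2)[of z "real (Suc i)"] z step.hyps by auto
  ultimately show ?case by simp
qed

lemma sum_powr_le:
  assumes "1 \<le> A" "A \<le> n"
  shows "(\<Sum>j\<in>{A..n}. real j powr (-5/4)) \<le> 5 * real A powr (-1/4)"
proof -
  have "(\<Sum>j\<in>{A<..n}. real j powr (-5/4)) \<le> - 4 * real n powr (-1/4) - (- 4 * real A powr (-1/4))"
  proof (rule sum_le_antiderivative[where G = "\<lambda>t. - 4 * t powr (-1/4)"])
    fix t :: real assume "real A \<le> t"
    then show "((\<lambda>t. - 4 * t powr (-1/4)) has_real_derivative t powr (-5/4)) (at t)"
      using assms by (auto intro!: derivative_eq_intros)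
  next
    fix s t :: real assume "real A \<le> s" "s \<le> t"
    then show "t powr (-5/4) \<le> s powr (-5/4)" using assms by (intro powr_mono2') auto
  qed (use assms in auto)
  moreover have "(\<Sum>j\<in>{A..n}. real j powr (-5/4)) = real A powr (-5/4) + (\<Sum>j\<in>{A<..n}. real j powr (-5/4))"
    by (rule sum.head) (use assms in auto)
  moreover have "real A powr (-5/4) \<le> real A powr (-1/4)" using assms by (intro powr_mono) auto
  moreover have "0 \<le> real n powr (-1/4)" by simp
  ultimately show ?thesis by linarith
qed

section \<open>The supersolution\<close>

text \<open>
  In the logarithmic coordinate \<open>x = ln (i / A)\<close> and after division by \<open>sqrt i\<close>, the expected
  number of neighbours becomes the convolution kernel \<open>\<beta> exp (- a \<bar>x - y\<bar>)\<close> on an interval,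
  whose eigenfunctions solve \<open>u'' = - \<rho> u\<close>. The functions \<open>C\<close> and \<open>S\<close> are the
  solutions with Cauchy data \<open>(1, 0)\<close> and \<open>(0, 1)\<close>.
\<close>

locale profile =
  fixes a \<beta> \<rho> L :: real and C S :: "real \<Rightarrow> real"
  assumes a: "0 < a" "a \<le> 1 / 2"
    and rho_eq: "\<rho> = 2 * a * \<beta> - a\<^sup>2"
    and rho_le: "\<bar>\<rho>\<bar> \<le> (a / 100)\<^sup>2 / 2"
    and C_deriv: "(C has_real_derivative - \<rho> * S x) (at x)"
    and S_deriv: "(S has_real_derivative C x) (at x)"
    and C_0: "C 0 = 1" and S_0: "S 0 = 0"
    and S_nonneg: "0 \<le> x \<Longrightarrow> x \<le> L \<Longrightarrow> 0 \<le> S x"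
    and C_ge: "0 \<le> x \<Longrightarrow> x \<le> L \<Longrightarrow> 1 \<le> C x + a / 100 * S x"
    and C_le: "0 \<le> x \<Longrightarrow> x \<le> L \<Longrightarrow> C x \<le> exp (a / 100 * x)"
    and S_le: "0 \<le> x \<Longrightarrow> x \<le> L \<Longrightarrow> S x \<le> x * exp (a / 100 * x)"
    and C_le_S: "0 \<le> x \<Longrightarrow> x \<le> L \<Longrightarrow> C x \<le> 1 + a / 100 * S x"
begin

text \<open>An exact solution of the integral equation would satisfy \<open>v' 0 = a * v 0\<close>
  at the left end; the smaller slope \<open>a / 8\<close> makes the boundary term there positive.
  The factor 10 keeps \<open>h\<close> positive in spite of the subtracted exponential.\<close>

definition h :: "real \<Rightarrow> real" where
  "h x = 10 * (C x + a / 8 * S x) - exp (- (a / 100) * x)"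

definition h' :: "real \<Rightarrow> real" where
  "h' x = 10 * (- \<rho> * S x + a / 8 * C x) + a / 100 * exp (- (a / 100) * x)"

text \<open>Quotient of the eigenvalues of \<open>a^2 - d^2\<close> on solutions of
  \<open>u'' = - \<rho> u\<close> and on the exponential. It exceeds 1 because \<open>\<rho>\<close>
  is small against \<open>(a / 100)^2\<close>, and
  \<open>(\<theta> - 1) * exp (- (a / 100) * x)\<close> is the gain \<open>h - v\<close>.\<close>

definition \<theta> :: real where
  "\<theta> = (a\<^sup>2 + \<rho>) / (a\<^sup>2 - (a / 100)\<^sup>2)"

text \<open>\<open>v\<close> is chosen such that \<open>a\<^sup>2 v - v'' = 2 a \<beta> h\<close>.\<close>

definition v :: "real \<Rightarrow> real" where
  "v x = 10 * (C x + a / 8 * S x) - \<theta> * exp (- (a / 100) * x)"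

definition v' :: "real \<Rightarrow> real" where
  "v' x = 10 * (- \<rho> * S x + a / 8 * C x) + \<theta> * (a / 100) * exp (- (a / 100) * x)"

lemma h_deriv: "(h has_real_derivative h' x) (at x)"
  unfolding h_def[abs_def] h'_def
  by (rule derivative_eq_intros C_deriv S_deriv refl | simp)+

lemma v_deriv: "(v has_real_derivative v' x) (at x)"
  unfolding v_def[abs_def] v'_def
  by (rule derivative_eq_intros C_deriv S_deriv refl | simp)+

lemma two_a_beta: "2 * a * \<beta> = a\<^sup>2 + \<rho>"
  by (simp add: rho_eq)

lemma rho_bounds: "\<rho> \<le> a\<^sup>2 / 20000" "- (a\<^sup>2 / 20000) \<le> \<rho>"
  using rho_le by (auto simp: power_divide abs_le_iff)

lemma a_sq: "0 < a\<^sup>2" "a\<^sup>2 \<le> a / 2"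
  using a by (auto simp: power2_eq_square)

lemma beta_bounds: "0 < \<beta>" "\<beta> \<le> 1" "a / 4 \<le> \<beta>"
proof -
  have 1: "2 * a * \<beta> \<ge> a\<^sup>2 / 2" "2 * a * \<beta> \<le> 2 * a\<^sup>2" using two_a_beta rho_bounds a_sq by auto
  show "a / 4 \<le> \<beta>" using 1(1) a by (simp add: power2_eq_square field_simps)
  then show "0 < \<beta>" using a by linarith
  have "2 * a * \<beta> \<le> 2 * a * 1" using 1(2) a_sq by linarith
  then show "\<beta> \<le> 1" using a by simp
qed

lemma theta_bounds: "1 + 1 / 20000 \<le> \<theta>" "\<theta> \<le> 1 + 2 / 10000"
proof -
  have p: "0 < a\<^sup>2 - (a / 100)\<^sup>2" using a_sq by (simp add: power_divide)
  show "1 + 1 / 20000 \<le> \<theta>" unfolding \<theta>_def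
    using p rho_bounds a_sq by (simp add: pos_le_divide_eq power_divide)
  show "\<theta> \<le> 1 + 2 / 10000" unfolding \<theta>_def
    using p rho_bounds a_sq by (simp add: pos_divide_le_eq power_divide)
qed

lemma theta_mult: "\<theta> * (a\<^sup>2 - (a / 100)\<^sup>2) = a\<^sup>2 + \<rho>"
proof -
  have p: "0 < a\<^sup>2 - (a / 100)\<^sup>2" using a_sq by (simp add: power_divide)
  then show ?thesis by (simp add: \<theta>_def)
qed

lemma v'_deriv: "(v' has_real_derivative (a\<^sup>2 * v x - 2 * a * \<beta> * h x)) (at x)"
proof -
  have 1: "(v' has_real_derivative
      10 * (- \<rho> * C x + a / 8 * (- \<rho> * S x)) - \<theta> * (a / 100) * (a / 100) * exp (- (a / 100) * x)) (at x)"
    unfolding v'_def[abs_def]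
    by (rule derivative_eq_intros C_deriv S_deriv refl | simp)+
  have "a\<^sup>2 * v x - 2 * a * \<beta> * h x =
      - \<rho> * (10 * (C x + a / 8 * S x)) + (a\<^sup>2 + \<rho> - \<theta> * a\<^sup>2) * exp (- (a / 100) * x)"
    unfolding two_a_beta v_def h_def by (simp add: algebra_simps)
  moreover have "a\<^sup>2 + \<rho> - \<theta> * a\<^sup>2 = - (\<theta> * (a / 100) * (a / 100))"
    using theta_mult by (simp add: algebra_simps power2_eq_square)
  ultimately have "a\<^sup>2 * v x - 2 * a * \<beta> * h x =
      10 * (- \<rho> * C x + a / 8 * (- \<rho> * S x)) - \<theta> * (a / 100) * (a / 100) * exp (- (a / 100) * x)"
    by (simp only:) (simp add: algebra_simps)
  then show ?thesis using 1 by (simp only:)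
qed

context
  fixes x :: real
  assumes x: "0 \<le> x" "x \<le> L"
begin

lemma CS_ge_1: "1 \<le> C x + a / 8 * S x"
  using C_ge[OF x] mult_nonneg_nonneg[OF _ S_nonneg[OF x], of "a / 8 - a / 100"] a
  by (simp add: algebra_simps)

lemma exp_minus_le_1: "exp (- (a / 100) * x) \<le> 1"
  using x a by simp

lemma h_ge: "9 \<le> h x"
proof -
  have "9 \<le> 10 * y - e" if "1 \<le> y" "e \<le> 1" for y e :: real using that by linarith
  then show ?thesis unfolding h_def using CS_ge_1 exp_minus_le_1 by blast
qed

lemma h_le: "h x \<le> 125 * exp (a / 50 * x)"
proof -
  have 1: "1 + a / 100 * x \<le> exp (a / 100 * x)" by (rule exp_ge_add_one_self)
  have "C x + a / 8 * S x \<le> exp (a / 100 * x) + a / 8 * (x * exp (a / 100 * x))"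
    using C_le[OF x] S_le[OF x] a by (intro add_mono mult_left_mono) auto
  also have "\<dots> = exp (a / 100 * x) * (1 + 25 / 2 * (a / 100 * x))" by (simp add: algebra_simps)
  also have "\<dots> \<le> exp (a / 100 * x) * (25 / 2 * (1 + a / 100 * x))"
    by (intro mult_left_mono) (auto simp: algebra_simps)
  also have "\<dots> \<le> exp (a / 100 * x) * (25 / 2 * exp (a / 100 * x))"
    using 1 by (intro mult_left_mono) auto
  also have "\<dots> = 25 / 2 * exp (a / 50 * x)" by (simp flip: exp_add)
  finally have "10 * (C x + a / 8 * S x) \<le> 125 * exp (a / 50 * x)" by simp
  then show ?thesis unfolding h_def using exp_gt_zero[of "- (a / 100) * x"] by linarith
qed

text \<open>Says that \<open>exp (- x / 2) * h x\<close> decreases, hence that \<open>f\<close>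
  decreases in the vertex index, as the integral comparison requires.\<close>

lemma h'_le: "h' x \<le> h x / 2"
proof -
  have aS: "0 \<le> a * S x" using a S_nonneg[OF x] by simp
  have "0 \<le> (1 / 2 - a / 8) * (C x + a / 100 * S x - 1)"
    using C_ge[OF x] a by (intro mult_nonneg_nonneg) auto
  moreover have "0 \<le> S x * (a / 16 + \<rho> - (1 / 2 - a / 8) * (a / 100))"
  proof (rule mult_nonneg_nonneg[OF S_nonneg[OF x]])
    have "(1 / 2 - a / 8) * (a / 100) = a / 200 - a\<^sup>2 / 800" by (simp add: field_simps power2_eq_square)
    then show "0 \<le> a / 16 + \<rho> - (1 / 2 - a / 8) * (a / 100)"
      using rho_bounds a_sq a by linarith
  qed
  moreover have "(1 / 2 - a / 8) * C x + (a / 16 + \<rho>) * S x - (1 / 2 - a / 8)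
      = (1 / 2 - a / 8) * (C x + a / 100 * S x - 1) + S x * (a / 16 + \<rho> - (1 / 2 - a / 8) * (a / 100))"
    by (simp add: field_simps)
  ultimately have "(1 / 2 - a / 8) \<le> (1 / 2 - a / 8) * C x + (a / 16 + \<rho>) * S x"
    by linarith
  moreover have "h x / 2 - h' x = 10 * ((1 / 2 - a / 8) * C x + (a / 16 + \<rho>) * S x) - (1 / 2 + a / 100) * exp (- (a / 100) * x)"
    unfolding h_def h'_def by (simp add: field_simps)
  moreover have "(1 / 2 + a / 100) * exp (- (a / 100) * x) \<le> 1"
    using mult_mono[OF _ exp_minus_le_1, of "1 / 2 + a / 100" 1] a by simp
  moreover have "H' \<le> H / 2" if "1 / 2 - a / 8 \<le> y" "H / 2 - H' = 10 * y - e" "e \<le> 1" for H H' y e :: real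
    using that a by linarith
  ultimately show ?thesis by blast
qed

text \<open>\<open>C\<close> may be negative at the right end, so it is replaced by \<open>S\<close>
  through \<open>C_ge\<close>. The part proportional to \<open>S x\<close> survives as a gain and
  sets the scale \<open>sqrt n / S\<close> of the upper bound.\<close>

lemma boundary_right: "5 * a * (a / 8) * S x \<le> a * v x + v' x"
proof -
  have aS: "0 \<le> a * S x" "0 \<le> a * (a * S x)" using a S_nonneg[OF x] by simp_all
  have "0 \<le> (a + a / 8) * (C x + a / 100 * S x - 1)"
    using C_ge[OF x] a by (intro mult_nonneg_nonneg) auto
  moreover have "0 \<le> S x * (a * (a / 8) / 2 - \<rho> - (a + a / 8) * (a / 100))"
    using rho_bounds a_sq by (intro mult_nonneg_nonneg[OF S_nonneg[OF x]]) (simp add: algebra_simps power2_eq_square)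
  moreover have "(a + a / 8) * C x + (a * (a / 8) - \<rho>) * S x - (a + a / 8) - (a * (a / 8) * S x) / 2
      = (a + a / 8) * (C x + a / 100 * S x - 1) + S x * (a * (a / 8) / 2 - \<rho> - (a + a / 8) * (a / 100))"
    by (simp add: field_simps)
  ultimately have 1: "(a + a / 8) + (a * (a / 8) * S x) / 2 \<le> (a + a / 8) * C x + (a * (a / 8) - \<rho>) * S x"
    by linarith
  have "\<theta> * (a - a / 100) * exp (- (a / 100) * x) \<le> 2 * a * 1"
    using theta_bounds a exp_minus_le_1 by (intro mult_mono) auto
  moreover have "a * v x + v' x = 10 * ((a + a / 8) * C x + (a * (a / 8) - \<rho>) * S x) - \<theta> * (a - a / 100) * exp (- (a / 100) * x)"
    unfolding v_def v'_def by (simp add: algebra_simps)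
  moreover have "5 * z \<le> y" if "e \<le> 2 * a * 1" "y = 10 * r - e" "(a + a / 8) + z / 2 \<le> r" for y z r e
    using that a by linarith
  ultimately have "5 * (a * (a / 8) * S x) \<le> a * v x + v' x" using 1 by blast
  then show ?thesis by simp
qed

end

text \<open>For the integral equation a nonnegative right-hand side would do. The left-hand side
  pays for the summand \<open>j = A\<close>, which the integral comparison leaves out.\<close>

lemma boundary_left: "2 * a * \<beta> * h 0 \<le> a * v 0 - v' 0"
proof -
  have "a * v 0 - v' 0 = 35 / 4 * a - 101 / 100 * (\<theta> * a)"
    by (simp add: v_def v'_def C_0 S_0 field_simps)
  moreover have "\<theta> * a \<le> 2 * a" using theta_bounds a by (intro mult_right_mono) auto
  moreover have "2 * a * \<beta> * h 0 = 9 * (a\<^sup>2 + \<rho>)" by (simp add: two_a_beta h_def C_0 S_0)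
  moreover have "z \<le> y" if "y = 35 / 4 * a - 101 / 100 * r" "r \<le> 2 * a" "z = 9 * (q + \<rho>)"
    "\<rho> \<le> q / 20000" "q \<le> a / 2" for y z q r :: real
    using that a by (simp add: field_simps)
  ultimately show ?thesis using rho_bounds a_sq by blast
qed

end

section \<open>The supersolution as a function of the vertex\<close>

locale scaled_profile = profile +
  fixes A n :: nat
  assumes A: "1 \<le> A" "A \<le> n" and l_le: "ln (real n / real A) \<le> L"
begin

text \<open>For \<open>\<gamma> = 1 / 2 - a\<close> the edge probability is
  \<open>\<beta> * (old i * new j)\<close> with \<open>i\<close> the older vertex and
  \<open>j\<close> the newer one. Both factors are \<open>rsq\<close> times a power \<open>a\<close>
  or \<open>- a\<close>, which gives the convolution kernel in \<open>\<xi>\<close>.\<close>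

abbreviation old :: "nat \<Rightarrow> real" where
  "old i \<equiv> real i powr (a - 1 / 2)"

abbreviation new :: "nat \<Rightarrow> real" where
  "new i \<equiv> real i powr (- a - 1 / 2)"

abbreviation rsq :: "nat \<Rightarrow> real" where
  "rsq i \<equiv> real i powr (- 1 / 2)"

abbreviation \<xi> :: "real \<Rightarrow> real" where
  "\<xi> t \<equiv> ln (t / real A)"

abbreviation dec :: "nat \<Rightarrow> real" where
  "dec i \<equiv> exp (- (a / 100) * \<xi> i)"

lemma xi_range: "real A \<le> t \<Longrightarrow> t \<le> real n \<Longrightarrow> 0 \<le> \<xi> t \<and> \<xi> t \<le> L"
proof -
  assume t: "real A \<le> t" "t \<le> real n"
  have "\<xi> t \<le> \<xi> (real n)" using t A by (intro ln_mono) (auto simp: divide_right_mono)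
  then have "\<xi> t \<le> L" using l_le by (rule order_trans)
  moreover have "0 \<le> \<xi> t" using t A by (intro ln_ge_zero) auto
  ultimately show ?thesis by simp
qed

definition f :: "real \<Rightarrow> real" where
  "f t = t powr (- 1 / 2) * h (\<xi> t)"

lemma f_pos: "real A \<le> t \<Longrightarrow> t \<le> real n \<Longrightarrow> 0 < f t"
  unfolding f_def using h_ge[of "\<xi> t"] xi_range[of t] A by (auto intro!: mult_pos_pos)

lemma xi_deriv: "0 < t \<Longrightarrow> (\<xi> has_real_derivative 1 / t) (at t)"
  using A by (auto intro!: derivative_eq_intros)

lemma f_antimono:
  assumes "real A \<le> s" "s \<le> t" "t \<le> real n"
  shows "f t \<le> f s"
proof (rule DERIV_nonpos_imp_nonincreasing[OF assms(2)])
  fix r assume r: "s \<le> r" "r \<le> t"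
  have r': "real A \<le> r" "r \<le> real n" "0 < r" using r assms A by auto
  have dh: "((\<lambda>t. h (\<xi> t)) has_real_derivative h' (\<xi> r) * (1 / r)) (at r)"
    by (rule DERIV_chain2[OF h_deriv xi_deriv[OF r'(3)]])
  have "(f has_real_derivative (- 1 / 2) * r powr (- 1 / 2 - 1) * h (\<xi> r) + h' (\<xi> r) * (1 / r) * r powr (- 1 / 2)) (at r)"
    unfolding f_def[abs_def]
    by (rule DERIV_mult[OF has_real_derivative_powr[OF r'(3)] dh])
  moreover have "r powr (- 1 / 2 - 1) = r powr (- 1 / 2) / r" unfolding powr_diff using r' by simp
  ultimately have "(f has_real_derivative r powr (- 1 / 2) / r * (h' (\<xi> r) - h (\<xi> r) / 2)) (at r)"
    by (simp add: algebra_simps)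
  moreover have "r powr (- 1 / 2) / r * (h' (\<xi> r) - h (\<xi> r) / 2) \<le> 0"
    using h'_le[of "\<xi> r"] xi_range[OF r'(1,2)] r' by (intro mult_nonneg_nonpos) auto
  ultimately show "\<exists>y. (f has_real_derivative y) (at r) \<and> y \<le> 0" by blast
qed

lemma powr_f_antimono:
  assumes "real A \<le> s" "s \<le> t" "t \<le> real n" "e \<le> 0"
  shows "t powr e * f t \<le> s powr e * f s"
  using assms A f_antimono[OF assms(1-3)] f_pos[of t] by (intro mult_mono powr_mono2') auto

text \<open>The mixed terms cancel and \<open>t^(a - 1) * (a^2 v - v'')\<close> remains, a multiple
  of \<open>h\<close>. This is an antiderivative for the kernel towards older vertices;
  \<open>G2_deriv\<close> treats newer ones.\<close>

lemma G1_deriv: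
  assumes t: "0 < t"
  shows "((\<lambda>t. t powr a * (a * v (\<xi> t) - v' (\<xi> t))) has_real_derivative
    2 * a * \<beta> * (t powr (a - 1 / 2) * f t)) (at t)"
proof -
  have dv: "((\<lambda>t. v (\<xi> t)) has_real_derivative v' (\<xi> t) * (1 / t)) (at t)"
    by (rule DERIV_chain2[OF v_deriv xi_deriv[OF t]])
  have dv': "((\<lambda>t. v' (\<xi> t)) has_real_derivative (a\<^sup>2 * v (\<xi> t) - 2 * a * \<beta> * h (\<xi> t)) * (1 / t)) (at t)"
    by (rule DERIV_chain2[OF v'_deriv xi_deriv[OF t]])
  have "((\<lambda>t. t powr a * (a * v (\<xi> t) - v' (\<xi> t))) has_real_derivative
     a * t powr (a - 1) * (a * v (\<xi> t) - v' (\<xi> t)) +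
     (a * (v' (\<xi> t) * (1 / t)) - (a\<^sup>2 * v (\<xi> t) - 2 * a * \<beta> * h (\<xi> t)) * (1 / t)) * t powr a) (at t)"
    by (rule DERIV_mult[OF has_real_derivative_powr[OF t] DERIV_diff[OF DERIV_cmult[OF dv] dv']])
  moreover have "t powr (a - 1) = t powr a / t" using t by (simp add: powr_diff)
  moreover have "t powr (a - 1 / 2) * f t = t powr (a - 1) * h (\<xi> t)"
    unfolding f_def by (simp add: mult.assoc[symmetric] algebra_simps flip: powr_add)
  moreover have "a * (p / t) * (a * y - y') + (a * (y' * (1 / t)) - (a\<^sup>2 * y - 2 * a * \<beta> * z) * (1 / t)) * p
      = 2 * a * \<beta> * (p / t * z)" for p y y' z
    using t by (simp add: field_simps power2_eq_square)
  ultimately show ?thesis by (simp only:)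
qed

lemma G2_deriv:
  assumes t: "0 < t"
  shows "((\<lambda>t. - (t powr (- a) * (a * v (\<xi> t) + v' (\<xi> t)))) has_real_derivative
    2 * a * \<beta> * (t powr (- a - 1 / 2) * f t)) (at t)"
proof -
  have dv: "((\<lambda>t. v (\<xi> t)) has_real_derivative v' (\<xi> t) * (1 / t)) (at t)"
    by (rule DERIV_chain2[OF v_deriv xi_deriv[OF t]])
  have dv': "((\<lambda>t. v' (\<xi> t)) has_real_derivative (a\<^sup>2 * v (\<xi> t) - 2 * a * \<beta> * h (\<xi> t)) * (1 / t)) (at t)"
    by (rule DERIV_chain2[OF v'_deriv xi_deriv[OF t]])
  have "((\<lambda>t. - (t powr (- a) * (a * v (\<xi> t) + v' (\<xi> t)))) has_real_derivative
     - ((- a) * t powr (- a - 1) * (a * v (\<xi> t) + v' (\<xi> t)) +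
     (a * (v' (\<xi> t) * (1 / t)) + (a\<^sup>2 * v (\<xi> t) - 2 * a * \<beta> * h (\<xi> t)) * (1 / t)) * t powr (- a))) (at t)"
    by (rule DERIV_minus[OF DERIV_mult[OF has_real_derivative_powr[OF t] DERIV_add[OF DERIV_cmult[OF dv] dv']]])
  moreover have "t powr (- a - 1) = t powr (- a) / t" unfolding powr_diff using t by simp
  moreover have "t powr (- a - 1 / 2) * f t = t powr (- a - 1) * h (\<xi> t)"
    unfolding f_def by (simp add: mult.assoc[symmetric] algebra_simps flip: powr_add)
  moreover have "- ((- a) * (p / t) * (a * y + y') + (a * (y' * (1 / t)) + (a\<^sup>2 * y - 2 * a * \<beta> * z) * (1 / t)) * p)
      = 2 * a * \<beta> * (p / t * z)" for p y y' z
    using t by (simp add: field_simps power2_eq_square)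
  ultimately show ?thesis by (simp only:)
qed

text \<open>The left-hand side is \<open>2 a sqrt i\<close> times the operator \<open>Kop\<close> applied to \<open>f\<close>.\<close>

lemma f_super:
  assumes i: "A \<le> i" "i \<le> n"
  shows "2 * a * \<beta> * (real i powr (- a) * (\<Sum>j\<in>{A..<i}. old j * f j)
       + real i powr a * (\<Sum>j\<in>{i<..n}. new j * f j))
    + (a / 10000 * dec i + 5 * a * (a / 8) * S (\<xi> n) * (real i / real n) powr a)
    \<le> 2 * a * h (\<xi> i)"
proof -
  define G1 where "G1 = (\<lambda>t. t powr a * (a * v (\<xi> t) - v' (\<xi> t)))"
  define G2 where "G2 = (\<lambda>t. - (t powr (- a) * (a * v (\<xi> t) + v' (\<xi> t))))"
  let ?g1 = "\<lambda>t. 2 * a * \<beta> * (t powr (a - 1 / 2) * f t)"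
  let ?g2 = "\<lambda>t. 2 * a * \<beta> * (t powr (- a - 1 / 2) * f t)"
  have ab: "0 \<le> 2 * a * \<beta>" using a beta_bounds by simp
  have i0: "0 < real i" "0 < real n" "0 < real A" using i A by auto
  have s1: "(\<Sum>j\<in>{A<..i}. ?g1 (real j)) \<le> G1 (real i) - G1 (real A)"
  proof (rule sum_le_antiderivative[OF i(1)])
    fix t assume "real A \<le> t"
    then show "(G1 has_real_derivative ?g1 t) (at t)" unfolding G1_def using G1_deriv A by auto
  next
    fix s t assume "real A \<le> s" "s \<le> t" "t \<le> real i"
    then show "?g1 t \<le> ?g1 s" using powr_f_antimono[of s t] i a ab by (intro mult_left_mono) auto
  qed
  have s2: "(\<Sum>j\<in>{i<..n}. ?g2 (real j)) \<le> G2 (real n) - G2 (real i)"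
  proof (rule sum_le_antiderivative[OF i(2)])
    fix t assume "real i \<le> t"
    then show "(G2 has_real_derivative ?g2 t) (at t)" unfolding G2_def using G2_deriv i A by auto
  next
    fix s t assume "real i \<le> s" "s \<le> t" "t \<le> real n"
    then show "?g2 t \<le> ?g2 s" using powr_f_antimono[of s t] i a ab by (intro mult_left_mono) auto
  qed
  have g1nn: "0 \<le> ?g1 (real j)" if "A \<le> j" "j \<le> n" for j
    using f_pos[of "real j"] that by (intro mult_nonneg_nonneg[OF ab]) auto
  have "(\<Sum>j\<in>{A..<i}. ?g1 (real j)) \<le> (\<Sum>j\<in>{A..i}. ?g1 (real j))"
    by (rule sum_mono2) (use g1nn i in auto)
  also have "\<dots> = ?g1 (real A) + (\<Sum>j\<in>{A<..i}. ?g1 (real j))"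
    by (rule sum.head) (use i in auto)
  \<comment> \<open>Compared with the boundary value, the head term \<open>j = A\<close> has an
    additional factor \<open>1 / A \<le> 1\<close>.\<close>
  also have "?g1 (real A) \<le> real A powr a * (2 * a * \<beta> * h 0)"
  proof -
    have "old A * f (real A) = real A powr (a - 1) * h 0"
      unfolding f_def using A by (simp add: mult.assoc[symmetric] flip: powr_add)
    moreover have "real A powr (a - 1) \<le> real A powr a" using A by (intro powr_mono) auto
    ultimately have "old A * f (real A) \<le> real A powr a * h 0"
      using h_ge[of 0] xi_range[of "real A"] A by (auto intro!: mult_right_mono)
    then have "?g1 (real A) \<le> 2 * a * \<beta> * (real A powr a * h 0)"
      by (rule mult_left_mono[OF _ ab])
    then show ?thesis by (simp only: mult_ac)
  qed
  also have "real A powr a * (2 * a * \<beta> * h 0) \<le> real A powr a * (a * v 0 - v' 0)"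
    using boundary_left by (intro mult_left_mono) auto
  also have "\<dots> = G1 (real A)" using A by (simp add: G1_def)
  finally have t1: "(\<Sum>j\<in>{A..<i}. ?g1 (real j)) \<le> G1 (real i)" using s1 by simp
  have m1: "real i powr (- a) * (\<Sum>j\<in>{A..<i}. ?g1 (real j)) \<le> a * v (\<xi> i) - v' (\<xi> i)"
    using mult_left_mono[OF t1, of "real i powr (- a)"] i0 by (simp add: G1_def mult.assoc[symmetric] flip: powr_add)
  have "real i powr a * (\<Sum>j\<in>{i<..n}. ?g2 (real j)) \<le> real i powr a * (G2 (real n) - G2 (real i))"
    using s2 by (intro mult_left_mono) auto
  also have "\<dots> = (a * v (\<xi> i) + v' (\<xi> i)) - (real i / real n) powr a * (a * v (\<xi> n) + v' (\<xi> n))"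
    using i0 by (simp add: G2_def right_diff_distrib powr_divide powr_minus mult.assoc[symmetric] flip: powr_add) (simp add: field_simps)
  also have "\<dots> \<le> (a * v (\<xi> i) + v' (\<xi> i)) - (real i / real n) powr a * (5 * a * (a / 8) * S (\<xi> n))"
  proof (rule diff_left_mono)
    show "(real i / real n) powr a * (a * v (\<xi> n) + v' (\<xi> n)) \<ge> (real i / real n) powr a * (5 * a * (a / 8) * S (\<xi> n))"
      using boundary_right[of "\<xi> n"] xi_range[of n] A by (intro mult_left_mono) auto
  qed
  finally have m2: "real i powr a * (\<Sum>j\<in>{i<..n}. ?g2 (real j)) \<le> (a * v (\<xi> i) + v' (\<xi> i)) - (real i / real n) powr a * (5 * a * (a / 8) * S (\<xi> n))"
    by simp
  \<comment> \<open>Adding \<open>m1\<close> and \<open>m2\<close> cancels \<open>v'\<close>; the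
    excess of \<open>h\<close> over \<open>v\<close> is the exponential gain.\<close>
  have "2 * a * v (\<xi> i) = 2 * a * h (\<xi> i) - 2 * a * (\<theta> - 1) * dec i"
    unfolding v_def h_def by (simp add: algebra_simps)
  moreover have "a / 10000 * dec i \<le> 2 * a * (\<theta> - 1) * dec i"
    using theta_bounds a by (intro mult_right_mono) auto
  ultimately have "real i powr (- a) * (\<Sum>j\<in>{A..<i}. ?g1 (real j)) + real i powr a * (\<Sum>j\<in>{i<..n}. ?g2 (real j))
     + (a / 10000 * dec i + 5 * a * (a / 8) * S (\<xi> n) * (real i / real n) powr a) \<le> 2 * a * h (\<xi> i)"
    using m1 m2 by (simp add: mult_ac)
  then show ?thesis by (simp add: sum_distrib_left[symmetric] distrib_left mult_ac)
qed

end

section \<open>The subsolution\<close>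

text \<open>The estimate \<open>int w p \<le> w j * int p\<close> over \<open>[s, t]\<close>,
  phrased with antiderivatives. The endpoints are free because \<open>g_sub\<close> cuts a unit
  interval at a mean value point.\<close>

lemma weighted_increment_le:
  fixes F P p w :: "real \<Rightarrow> real"
  assumes st: "s \<le> t" "j \<le> s" and c: "0 \<le> c"
    and F: "\<And>x. s \<le> x \<Longrightarrow> x \<le> t \<Longrightarrow> (F has_real_derivative c * (w x * p x)) (at x)"
    and P: "\<And>x. s \<le> x \<Longrightarrow> x \<le> t \<Longrightarrow> (P has_real_derivative p x) (at x)"
    and p: "\<And>x. s \<le> x \<Longrightarrow> x \<le> t \<Longrightarrow> 0 \<le> p x"
    and w: "\<And>x. s \<le> x \<Longrightarrow> x \<le> t \<Longrightarrow> w x \<le> w j"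
  shows "F t - F s \<le> c * (w j * (P t - P s))"
proof -
  have "(\<lambda>x. c * w j * P x - F x) s \<le> (\<lambda>x. c * w j * P x - F x) t"
  proof (rule DERIV_nonneg_imp_nondecreasing[OF st(1)])
    fix x assume x: "s \<le> x" "x \<le> t"
    have "((\<lambda>x. c * w j * P x - F x) has_real_derivative c * w j * p x - c * (w x * p x)) (at x)"
      by (rule DERIV_diff[OF DERIV_cmult[OF P[OF x]] F[OF x]])
    moreover have "c * w j * p x - c * (w x * p x) = c * (w j - w x) * p x" by (simp add: algebra_simps)
    moreover have "0 \<le> c * (w j - w x) * p x" using c w[OF x] p[OF x] by simp
    ultimately show "\<exists>y. ((\<lambda>x. c * w j * P x - F x) has_real_derivative y) (at x) \<and> 0 \<le> y" by metis
  qed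
  then show ?thesis by (simp add: algebra_simps)
qed

context profile
begin

text \<open>The slope \<open>2 * a\<close> lies above the value \<open>a\<close> of an exact
  boundary condition, so \<open>a * r 0 - r' 0 = - a\<close> is negative. This reserve pays for the
  diagonal terms in \<open>g_sub\<close>.\<close>

definition r :: "real \<Rightarrow> real" where "r x = C x + 2 * a * S x"
definition r' :: "real \<Rightarrow> real" where "r' x = - \<rho> * S x + 2 * a * C x"

lemma r_deriv: "(r has_real_derivative r' x) (at x)"
  unfolding r_def[abs_def] r'_def
  by (rule derivative_eq_intros C_deriv S_deriv refl | simp)+

lemma r'_deriv: "(r' has_real_derivative - \<rho> * r x) (at x)"
proof -
  have "(r' has_real_derivative - \<rho> * C x + 2 * a * (- \<rho> * S x)) (at x)"
    unfolding r'_def[abs_def]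
    by (rule derivative_eq_intros C_deriv S_deriv refl | simp)+
  then show ?thesis by (simp add: r_def algebra_simps)
qed

lemma r_ge: assumes x: "0 \<le> x" "x \<le> L" shows "1 \<le> r x"
proof -
  have "0 \<le> (2 * a - a / 100) * S x" using a S_nonneg[OF x] by simp
  then show ?thesis using C_ge[OF x] unfolding r_def by (simp add: algebra_simps)
qed

lemma r_le: assumes x: "0 \<le> x" "x \<le> L" shows "r x \<le> 4 * exp (x / 2)"
proof -
  have "r x \<le> exp (a / 100 * x) + 2 * a * (x * exp (a / 100 * x))"
    unfolding r_def using C_le[OF x] S_le[OF x] a by (intro add_mono mult_left_mono) auto
  also have "\<dots> = (1 + 2 * a * x) * exp (a / 100 * x)" by (simp add: algebra_simps)
  also have "\<dots> \<le> (4 * (1 + x / 4)) * exp (x / 4)"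
    using a x mult_right_mono[of "2 * a" 1 x] mult_right_mono[of "a / 100" "1 / 4" x] by (intro mult_mono) auto
  also have "\<dots> \<le> (4 * exp (x / 4)) * exp (x / 4)"
    by (intro mult_right_mono mult_left_mono exp_ge_add_one_self) auto
  also have "\<dots> = 4 * exp (x / 2)" by (simp add: mult.assoc flip: exp_add)
  finally show ?thesis .
qed

text \<open>Opposite direction to \<open>boundary_right\<close>: here the deficit at the right end
  has to be at most a multiple of \<open>S x\<close>. The constant 1 of \<open>C_le_S\<close> is
  absorbed by \<open>1 \<le> S x\<close>.\<close>

lemma r_boundary:
  assumes x: "0 \<le> x" "x \<le> L" and S1: "1 \<le> S x"
  shows "a * r x + r' x \<le> 5 * a * S x"
proof -
  have "a * r x + r' x = 3 * a * C x + (2 * a\<^sup>2 - \<rho>) * S x"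
    unfolding r_def r'_def by (simp add: algebra_simps power2_eq_square)
  also have "\<dots> \<le> 3 * a * (S x + a / 100 * S x) + (3 / 2 * a) * S x"
    using C_le_S[OF x] S1 a rho_bounds a_sq by (intro add_mono mult_left_mono mult_right_mono) auto
  also have "\<dots> = a * S x * (9 / 2 + 3 * a / 100)" by (simp add: field_simps)
  also have "\<dots> \<le> a * S x * 5" using a S1 by (intro mult_left_mono) auto
  finally show ?thesis by simp
qed

end

section \<open>The subsolution as a function of the vertex\<close>

context scaled_profile
begin

definition dens :: "real \<Rightarrow> real" where
  "dens t = t powr (- 1 / 2) * r (\<xi> t)"

definition P :: "real \<Rightarrow> real" where
  "P t = t powr (1 / 2) * (1 / 2 * r (\<xi> t) - r' (\<xi> t)) / (1 / 4 + \<rho>)"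

text \<open>The integral of \<open>dens\<close> over \<open>[j, j + 1]\<close> rather than a point
  value: as the weights \<open>old\<close> and \<open>new\<close> decrease, sums against
  \<open>g\<close> dominate the integrals without error. Since \<open>g n\<close> would look beyond
  \<open>n\<close>, the lower bound works on \<open>{A..<n}\<close>.\<close>

definition g :: "nat \<Rightarrow> real" where
  "g j = P (real (Suc j)) - P (real j)"

lemma r_xi_deriv: "0 < t \<Longrightarrow> ((\<lambda>t. r (\<xi> t)) has_real_derivative r' (\<xi> t) * (1 / t)) (at t)"
  by (rule DERIV_chain2[OF r_deriv xi_deriv])

lemma r'_xi_deriv: "0 < t \<Longrightarrow> ((\<lambda>t. r' (\<xi> t)) has_real_derivative - \<rho> * r (\<xi> t) * (1 / t)) (at t)"
  by (rule DERIV_chain2[OF r'_deriv xi_deriv])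

text \<open>Product rule and \<open>r'' = - \<rho> r\<close>; the exponents \<open>1 / 2\<close>,
  \<open>a\<close> and \<open>- a\<close> give \<open>P\<close>, \<open>F\<close> and
  \<open>Q\<close>.\<close>

lemma r_scaled_deriv:
  assumes t: "0 < t"
  shows "((\<lambda>t. t powr e * (e * r (\<xi> t) - r' (\<xi> t))) has_real_derivative
    (e\<^sup>2 + \<rho>) * (t powr (e - 1) * r (\<xi> t))) (at t)"
proof -
  have "((\<lambda>t. t powr e * (e * r (\<xi> t) - r' (\<xi> t))) has_real_derivative
     e * t powr (e - 1) * (e * r (\<xi> t) - r' (\<xi> t)) +
     (e * (r' (\<xi> t) * (1 / t)) - (- \<rho> * r (\<xi> t) * (1 / t))) * t powr e) (at t)"
    by (rule DERIV_mult[OF has_real_derivative_powr[OF t] DERIV_diff[OF DERIV_cmult[OF r_xi_deriv[OF t]] r'_xi_deriv[OF t]]])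
  moreover have "t powr (e - 1) = t powr e / t" using t by (simp add: powr_diff)
  moreover have "e * (p / t) * (e * y - y') + (e * (y' * (1 / t)) - (- \<rho> * y * (1 / t))) * p
      = (e\<^sup>2 + \<rho>) * (p / t * y)" for p y y'
    using t by (simp add: field_simps power2_eq_square)
  ultimately show ?thesis by (simp only:)
qed

lemma P_deriv:
  assumes t: "0 < t"
  shows "(P has_real_derivative dens t) (at t)"
proof -
  have "0 < 1 / 4 + \<rho>" using rho_bounds a_sq a by linarith
  then show ?thesis
    using DERIV_cdivide[OF r_scaled_deriv[OF t, of "1 / 2"], of "1 / 4 + \<rho>"]
    unfolding P_def[abs_def] dens_def by (simp add: power2_eq_square)
qed

definition F :: "real \<Rightarrow> real" where
  "F t = t powr a * (a * r (\<xi> t) - r' (\<xi> t))"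

definition Q :: "real \<Rightarrow> real" where
  "Q t = - (t powr (- a) * (a * r (\<xi> t) + r' (\<xi> t)))"

lemma F_deriv:
  assumes t: "0 < t"
  shows "(F has_real_derivative 2 * a * \<beta> * (t powr (a - 1 / 2) * dens t)) (at t)"
proof -
  have "t powr (a - 1 / 2) * dens t = t powr (a - 1) * r (\<xi> t)"
    by (simp add: dens_def mult.assoc[symmetric] flip: powr_add)
  then show ?thesis using r_scaled_deriv[OF t, of a] unfolding F_def[abs_def] two_a_beta by (simp only:)
qed

lemma Q_deriv:
  assumes t: "0 < t"
  shows "(Q has_real_derivative 2 * a * \<beta> * (t powr (- a - 1 / 2) * dens t)) (at t)"
proof -
  have "t powr (- a - 1 / 2) * dens t = t powr (- a - 1) * r (\<xi> t)"
    by (simp add: dens_def mult.assoc[symmetric] algebra_simps flip: powr_add)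
  moreover have "Q = (\<lambda>t. t powr (- a) * (- a * r (\<xi> t) - r' (\<xi> t)))"
    by (auto simp: Q_def fun_eq_iff algebra_simps)
  ultimately show ?thesis using r_scaled_deriv[OF t, of "- a"] unfolding two_a_beta by (simp only: power2_minus)
qed

lemma dens_nonneg: "real A \<le> t \<Longrightarrow> t \<le> real n \<Longrightarrow> 0 \<le> dens t"
  unfolding dens_def using r_ge[of "\<xi> t"] xi_range[of t] by (auto intro!: mult_nonneg_nonneg)

lemma P_mono:
  assumes "real A \<le> s" "s \<le> t" "t \<le> real n"
  shows "P s \<le> P t"
proof (rule DERIV_nonneg_imp_nondecreasing[OF assms(2)])
  fix x assume "s \<le> x" "x \<le> t"
  then show "\<exists>y. (P has_real_derivative y) (at x) \<and> 0 \<le> y"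
    using P_deriv[of x] dens_nonneg[of x] assms A by auto
qed

lemma g_mvt:
  assumes "A \<le> i" "i < n"
  obtains t where "real i < t" "t < real (Suc i)" "g i = t powr (- 1 / 2) * r (\<xi> t)"
proof -
  have "\<exists>z>real i. z < real (Suc i) \<and> P (real (Suc i)) - P (real i) = (real (Suc i) - real i) * dens z"
    by (rule MVT2) (use assms A in \<open>auto intro!: P_deriv\<close>)
  then show ?thesis using that unfolding g_def dens_def by auto
qed

lemma g_ge:
  assumes "A \<le> i" "i < n"
  shows "real (Suc i) powr (- 1 / 2) \<le> g i"
proof -
  obtain t where t: "real i < t" "t < real (Suc i)" "g i = t powr (- 1 / 2) * r (\<xi> t)"
    using g_mvt[OF assms] .
  have t': "real A \<le> t" "t \<le> real n" "0 < t" using t assms A by auto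
  have "real (Suc i) powr (- 1 / 2) * 1 \<le> t powr (- 1 / 2) * r (\<xi> t)"
    using r_ge[of "\<xi> t"] xi_range[OF t'(1,2)] t t' by (intro mult_mono powr_mono2') auto
  then show ?thesis using t by simp
qed

lemma g_nonneg: "A \<le> i \<Longrightarrow> i < n \<Longrightarrow> 0 \<le> g i"
  using g_ge[of i] powr_ge_zero[of "real (Suc i)" "- 1 / 2"] by linarith

lemma F_increment_le:
  assumes i: "A \<le> i" "i < n" and t: "real i \<le> t" "t \<le> real (Suc i)"
  shows "F t - F (real A) \<le> 2 * a * \<beta> * (\<Sum>j\<in>{A..<Suc i}. old j * g j)"
proof -
  have ab: "0 \<le> 2 * a * \<beta>" using a beta_bounds by simp
  have step: "F s - F (real j) \<le> 2 * a * \<beta> * (old j * (P s - P (real j)))"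
    if "A \<le> j" "j < n" "real j \<le> s" "s \<le> real (Suc j)" for j s
    by (rule weighted_increment_le[where w = "\<lambda>x. x powr (a - 1 / 2)" and p = dens])
      (use that ab A a in \<open>auto intro!: F_deriv P_deriv dens_nonneg powr_mono2'\<close>)
  have "F (real i) - F (real A) = (\<Sum>j\<in>{A..<i}. F (real (Suc j)) - F (real j))"
    using i by (simp only: sum_Suc_diff'[of A i "\<lambda>j. F (real j)"])
  also have "\<dots> \<le> (\<Sum>j\<in>{A..<i}. 2 * a * \<beta> * (old j * g j))"
    unfolding g_def by (intro sum_mono step) (use i in auto)
  finally have 1: "F (real i) - F (real A) \<le> (\<Sum>j\<in>{A..<i}. 2 * a * \<beta> * (old j * g j))" .
  have "F t - F (real i) \<le> 2 * a * \<beta> * (old i * (P t - P (real i)))"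
    by (rule step) (use i t in auto)
  also have "\<dots> \<le> 2 * a * \<beta> * (old i * g i)"
    unfolding g_def using P_mono[of t "real (Suc i)"] i t ab
    by (intro mult_left_mono[OF _ ab] mult_left_mono) auto
  finally have "F t - F (real A) \<le> (\<Sum>j\<in>{A..<Suc i}. 2 * a * \<beta> * (old j * g j))"
    using 1 i by simp
  then show ?thesis by (simp only: sum_distrib_left)
qed

lemma Q_increment_le:
  assumes i: "A \<le> i" "i < n" and t: "real i \<le> t" "t \<le> real (Suc i)"
  shows "Q (real n) - Q t \<le> 2 * a * \<beta> * (\<Sum>j\<in>{i..<n}. new j * g j)"
proof -
  have ab: "0 \<le> 2 * a * \<beta>" using a beta_bounds by simp
  have step: "Q (real (Suc j)) - Q s \<le> 2 * a * \<beta> * (new j * (P (real (Suc j)) - P s))"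
    if "A \<le> j" "j < n" "real j \<le> s" "s \<le> real (Suc j)" for j s
    by (rule weighted_increment_le[where w = "\<lambda>x. x powr (- a - 1 / 2)" and p = dens])
      (use that ab A a in \<open>auto intro!: Q_deriv P_deriv dens_nonneg powr_mono2'\<close>)
  have "Q (real n) - Q (real (Suc i)) = (\<Sum>j\<in>{Suc i..<n}. Q (real (Suc j)) - Q (real j))"
    using i by (simp only: sum_Suc_diff'[of "Suc i" n "\<lambda>j. Q (real j)"] Suc_leI)
  also have "\<dots> \<le> (\<Sum>j\<in>{Suc i..<n}. 2 * a * \<beta> * (new j * g j))"
    unfolding g_def by (intro sum_mono step) (use i in auto)
  finally have 1: "Q (real n) - Q (real (Suc i)) \<le> (\<Sum>j\<in>{Suc i..<n}. 2 * a * \<beta> * (new j * g j))" .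
  have "Q (real (Suc i)) - Q t \<le> 2 * a * \<beta> * (new i * (P (real (Suc i)) - P t))"
    by (rule step) (use i t in auto)
  also have "\<dots> \<le> 2 * a * \<beta> * (new i * g i)"
    unfolding g_def using P_mono[of "real i" t] i t ab
    by (intro mult_left_mono[OF _ ab] mult_left_mono) auto
  finally have "Q (real n) - Q t \<le> (\<Sum>j\<in>{i..<n}. 2 * a * \<beta> * (new j * g j))"
    using 1 i by (simp add: sum.atLeast_Suc_lessThan)
  then show ?thesis by (simp add: sum_distrib_left)
qed

text \<open>
  The comparison with the integrals also produces the two terms \<open>j = i\<close>, which the operator lacks;
  they are absorbed by the boundary term at \<open>A\<close>.
\<close>

lemma g_sub:
  assumes i: "A \<le> i" "i < n" and A32: "32 \<le> A" and S1: "1 \<le> S (\<xi> n)"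
  shows "g i \<le> \<beta> * (new i * (\<Sum>j\<in>{A..<i}. old j * g j)
      + old i * (\<Sum>j\<in>{i<..<n}. new j * g j))
    + old i * real n powr (- a) * (5 / 2 * S (\<xi> n))"
proof -
  \<comment> \<open>\<open>g i\<close> equals \<open>dens t\<close> at some \<open>t\<close> inside
    the unit interval, so the integral equation is used at \<open>t\<close>. Both integrals split
    there, and each is charged with the full term \<open>j = i\<close>.\<close>
  obtain t where t: "real i < t" "t < real (Suc i)" and gt: "g i = t powr (- 1 / 2) * r (\<xi> t)"
    using g_mvt[OF i] .
  have t': "real A \<le> t" "t \<le> real n" "0 < t" and i0: "0 < real i" "0 < real n" "0 < real A"
    using t i A by auto
  note xt = xi_range[OF t'(1,2)]
  have ab: "0 \<le> 2 * a * \<beta>" using a beta_bounds by simp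
  let ?e1 = "- a - 1 / 2" and ?e2 = "a - 1 / 2"
  define s1 where "s1 = (\<Sum>j\<in>{A..<i}. old j * g j)"
  define s2 where "s2 = (\<Sum>j\<in>{i<..<n}. new j * g j)"
  have s: "0 \<le> s1" "0 \<le> s2" unfolding s1_def s2_def
    using g_nonneg i by (auto intro!: sum_nonneg mult_nonneg_nonneg)
  have S1': "(\<Sum>j\<in>{A..<Suc i}. old j * g j) = s1 + old i * g i"
    using i by (simp add: s1_def)
  have S2': "(\<Sum>j\<in>{i..<n}. new j * g j) = s2 + new i * g i"
  proof -
    have "{i..<n} = insert i {i<..<n}" using i by auto
    then show ?thesis by (simp add: s2_def)
  qed
  have gi: "0 \<le> g i" by (rule g_nonneg[OF i])
  \<comment> \<open>Eliminates \<open>r'\<close> from \<open>F\<close> and \<open>Q\<close>, which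
    carry \<open>a r - r'\<close> and \<open>a r + r'\<close>.\<close>
  have id: "2 * a * g i = t powr ?e1 * F t - t powr ?e2 * Q t"
  proof -
    have 1: "t powr ?e1 * t powr a = t powr (- 1 / 2)" "t powr ?e2 * t powr (- a) = t powr (- 1 / 2)"
      by (simp_all flip: powr_add)
    have "t powr ?e1 * F t - t powr ?e2 * Q t = (t powr ?e1 * t powr a) * (a * r (\<xi> t) - r' (\<xi> t)) + (t powr ?e2 * t powr (- a)) * (a * r (\<xi> t) + r' (\<xi> t))"
      unfolding F_def Q_def by simp
    also have "\<dots> = 2 * a * g i" unfolding 1 gt by (simp add: algebra_simps)
    finally show ?thesis by simp
  qed
  have "t powr ?e1 * (F t - F (real A)) \<le> t powr ?e1 * (2 * a * \<beta> * (s1 + old i * g i))"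
    using F_increment_le[OF i, of t] t S1' by (intro mult_left_mono) auto
  also have "\<dots> \<le> new i * (2 * a * \<beta> * (s1 + old i * g i))"
    using s gi i0 t a by (intro mult_right_mono powr_mono2' mult_nonneg_nonneg[OF ab] add_nonneg_nonneg mult_nonneg_nonneg[OF _ gi]) auto
  finally have b1: "t powr ?e1 * (F t - F (real A)) \<le> 2 * a * \<beta> * (new i * s1 + new i * old i * g i)"
    by (simp add: algebra_simps)
  have "t powr ?e2 * (Q (real n) - Q t) \<le> t powr ?e2 * (2 * a * \<beta> * (s2 + new i * g i))"
    using Q_increment_le[OF i, of t] t S2' by (intro mult_left_mono) auto
  also have "\<dots> \<le> old i * (2 * a * \<beta> * (s2 + new i * g i))"
    using s gi i0 t a by (intro mult_right_mono powr_mono2' mult_nonneg_nonneg[OF ab] add_nonneg_nonneg mult_nonneg_nonneg[OF _ gi]) auto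
  finally have b2: "t powr ?e2 * (Q (real n) - Q t) \<le> 2 * a * \<beta> * (old i * s2 + new i * old i * g i)"
    by (simp add: algebra_simps)
  have pp: "new i * old i = 1 / real i"
  proof -
    have "new i * old i = real i powr (- 1)" by (simp flip: powr_add)
    then show ?thesis using i0 by (simp add: powr_minus_divide)
  qed
  have b3: "t powr ?e1 * F (real A) = - (a * (t powr (- 1 / 2) * (real A / t) powr a))"
  proof -
    have "F (real A) = - (a * real A powr a)" using i0 by (simp add: F_def r_def r'_def C_0 S_0)
    moreover have "t powr ?e1 = t powr (- 1 / 2) / t powr a"
    proof -
      have "?e1 = - 1 / 2 - a" by simp
      then show ?thesis by (simp only: powr_diff)
    qed
    ultimately show ?thesis using t' i0 by (simp add: powr_divide)
  qed
  have b4: "t powr ?e2 * (- Q (real n)) \<le> old i * real n powr (- a) * (5 * a * S (\<xi> n))"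
  proof -
    have "- Q (real n) \<le> real n powr (- a) * (5 * a * S (\<xi> n))"
      unfolding Q_def using r_boundary[OF _ _ S1] xi_range[of "real n"] A by (auto intro!: mult_left_mono)
    then have "t powr ?e2 * (- Q (real n)) \<le> t powr ?e2 * (real n powr (- a) * (5 * a * S (\<xi> n)))"
      by (intro mult_left_mono) auto
    also have "\<dots> \<le> old i * (real n powr (- a) * (5 * a * S (\<xi> n)))"
      using S1 a i0 t by (intro mult_right_mono powr_mono2') auto
    finally show ?thesis by simp
  qed
  \<comment> \<open>With \<open>x = \<xi> t\<close>, the bounds
    \<open>1 / i \<le> (2 / A) exp (- x)\<close> and \<open>r \<le> 4 exp (x / 2)\<close> leave
    \<open>(32 / A) exp (- x / 2)\<close>, at most \<open>exp (- a x)\<close> as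
    \<open>a \<le> 1 / 2\<close>. This is the origin of \<open>32 \<le> A\<close>.\<close>
  have b5: "4 * a * \<beta> * (1 / real i * g i) \<le> a * (t powr (- 1 / 2) * (real A / t) powr a)"
  proof -
    have "t \<le> 2 * real i" using t i A by auto
    then have "1 / real i \<le> 2 / t" using i0 t' by (simp add: field_simps)
    moreover have "real A / t = exp (- \<xi> t)" using t' i0 by (simp add: exp_minus)
    moreover have "(real A / t) powr a = exp (- a * \<xi> t)"
      using t' i0 by (simp add: powr_def ln_div) (simp add: algebra_simps)
    moreover have "2 / t = 2 / real A * exp (- \<xi> t)" using t' i0 by (simp add: exp_minus)
    ultimately have "4 * \<beta> * (1 / real i * r (\<xi> t)) \<le> 4 * 1 * ((2 / real A * exp (- \<xi> t)) * (4 * exp (\<xi> t / 2)))"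
      using r_le[of "\<xi> t"] r_ge[of "\<xi> t"] xt beta_bounds i0 by (intro mult_mono) auto
    also have "\<dots> = 32 / real A * exp (- \<xi> t / 2)" by (simp flip: exp_add)
    also have "\<dots> \<le> 1 * exp (- a * \<xi> t)"
      using A32 xt a mult_right_mono[of a "1 / 2" "\<xi> t"] by (intro mult_mono) auto
    finally have "4 * \<beta> * (1 / real i * r (\<xi> t)) \<le> (real A / t) powr a"
      using \<open>(real A / t) powr a = exp (- a * \<xi> t)\<close> by simp
    then have "(a * t powr (- 1 / 2)) * (4 * \<beta> * (1 / real i * r (\<xi> t))) \<le> (a * t powr (- 1 / 2)) * (real A / t) powr a"
      using a by (intro mult_left_mono) auto
    then show ?thesis unfolding gt by (simp add: mult_ac)
  qed
  have "2 * a * g i = t powr ?e1 * (F t - F (real A)) + t powr ?e2 * (Q (real n) - Q t) + t powr ?e1 * F (real A) + t powr ?e2 * (- Q (real n))"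
    unfolding id by (simp add: algebra_simps)
  also have "\<dots> \<le> 2 * a * \<beta> * (new i * s1 + new i * old i * g i) + 2 * a * \<beta> * (old i * s2 + new i * old i * g i)
     - 4 * a * \<beta> * (1 / real i * g i) + old i * real n powr (- a) * (5 * a * S (\<xi> n))"
    using b1 b2 b3 b4 b5 by linarith
  also have "\<dots> = 2 * a * (\<beta> * (new i * s1 + old i * s2) + old i * real n powr (- a) * (5 / 2 * S (\<xi> n)))"
    unfolding pp by (simp add: algebra_simps)
  finally show ?thesis unfolding s1_def s2_def using a by simp
qed

text \<open>Bounds the operator on the constant 1 in the shape of the deficit of
  \<open>g_sub\<close>. For \<open>i\<close> up to about \<open>3 n / 4\<close>, the at least
  \<open>n / 4\<close> newer vertices suffice; beyond, the left-hand side is at most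
  \<open>1 / 4\<close> and the older vertices yield that much.\<close>

lemma kernel_one_ge:
  assumes i: "A \<le> i" "i < n" and n: "4 * A \<le> n" "4 \<le> n"
  shows "1 / 8 * (old i * real n powr (1 / 2 - a)) \<le>
     new i * (\<Sum>j\<in>{A..<i}. old j)
      + old i * (\<Sum>j\<in>{i<..<n}. new j)"
proof -
  have i0: "0 < real i" "0 < real n" using i A by auto
  let ?s1 = "\<Sum>j\<in>{A..<i}. old j" and ?s2 = "\<Sum>j\<in>{i<..<n}. new j"
  have s: "0 \<le> ?s1" "0 \<le> ?s2" by (auto intro!: sum_nonneg)
  show ?thesis
  proof (cases "4 * (i + 1) \<le> 3 * n")
    case True
    have "1 / 8 * (old i * real n powr (1 / 2 - a)) \<le> old i * (real n / 4 * new n)"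
    proof -
      have "real n * new n = real n powr (1 / 2 - a)"
        using i0 powr_mult_base[of "real n" "- a - 1 / 2"] by simp
      then show ?thesis by (simp add: mult_ac)
    qed
    also have "real n / 4 * new n \<le> real (card {i<..<n}) * new n"
      using True i by (intro mult_right_mono) auto
    also have "\<dots> \<le> ?s2"
      using a i A by (intro sum_bounded_below powr_mono2') auto
    finally show ?thesis using s by (simp add: mult_left_mono add_increasing)
  next
    case False
    have "1 / 8 * (old i * real n powr (1 / 2 - a)) \<le> 1 / 4"
    proof -
      have "old i = 1 / real i powr (1 / 2 - a)"
        using powr_minus_divide[of "real i" "1 / 2 - a"] by simp
      then have "old i * real n powr (1 / 2 - a) = (real n / real i) powr (1 / 2 - a)"
        using i0 by (simp add: powr_divide)
      also have "\<dots> \<le> (real n / real i) powr 1"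
        using i i0 a by (intro powr_mono) auto
      also have "\<dots> \<le> 2" using i0 False n by (simp add: field_simps)
      finally show ?thesis by simp
    qed
    also have "1 / 4 \<le> real (card {A..<i}) / real i"
      using False n i by (simp add: field_simps)
    also have "\<dots> = new i * (real (card {A..<i}) * old i)"
    proof -
      have "new i * old i = real i powr (- 1)" by (simp flip: powr_add)
      then have "new i * old i = 1 / real i"
        using i0 by (simp add: powr_minus_divide)
      then show ?thesis by (simp add: field_simps)
    qed
    also have "real (card {A..<i}) * old i \<le> ?s1"
      using a i A by (intro sum_bounded_below powr_mono2') auto
    finally show ?thesis using s by (simp add: mult_left_mono add_increasing2)
  qed
qed

text \<open>\<open>1 + lam * g\<close> is a subsolution because the operator on the constant 1 pays
  for \<open>lam\<close> times the deficit of \<open>g_sub\<close>. The factor \<open>a / 80\<close>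
  is \<open>(a / 4) * (1 / 8) / (5 / 2)\<close>, from \<open>a / 4 \<le> \<beta>\<close>,
  \<open>kernel_one_ge\<close> and \<open>g_sub\<close>.\<close>

lemma one_plus_g_sub:
  assumes i: "A \<le> i" "i < n" and A32: "32 \<le> A" "4 * A \<le> n" and S1: "1 \<le> S (\<xi> n)"
  defines "lam \<equiv> a / 80 * (sqrt (real n) / S (\<xi> n))"
  shows "lam * g i \<le> \<beta> * (new i * (\<Sum>j\<in>{A..<i}. old j * (1 + lam * g j))
      + old i * (\<Sum>j\<in>{i<..<n}. new j * (1 + lam * g j)))"
proof -
  let ?e1 = "- a - 1 / 2" and ?e2 = "a - 1 / 2"
  have i0: "0 < real i" "0 < real n" using i A by auto
  have lam: "0 \<le> lam" using a S1 by (simp add: lam_def)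
  let ?T = "\<lambda>q. new i * (\<Sum>j\<in>{A..<i}. old j * q j) + old i * (\<Sum>j\<in>{i<..<n}. new j * q j)"
  have T: "?T (\<lambda>j. 1 + lam * g j) = ?T (\<lambda>_. 1) + lam * ?T g"
  proof -
    have *: "(\<Sum>j\<in>I. w j * (1 + lam * g j)) = (\<Sum>j\<in>I. w j * 1) + lam * (\<Sum>j\<in>I. w j * g j)" for I and w :: "nat \<Rightarrow> real"
      by (simp add: distrib_left sum.distrib sum_distrib_left mult_ac)
    show ?thesis unfolding * by (simp add: algebra_simps)
  qed
  have "lam * g i \<le> lam * (\<beta> * ?T g + old i * real n powr (- a) * (5 / 2 * S (\<xi> n)))"
    by (rule mult_left_mono[OF g_sub[OF i A32(1) S1] lam])
  also have "\<dots> = \<beta> * (lam * ?T g) + (lam * (5 / 2 * S (\<xi> n))) * (old i * real n powr (- a))"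
    by (simp add: algebra_simps)
  also have "lam * (5 / 2 * S (\<xi> n)) = a / 32 * sqrt (real n)" using S1 by (simp add: lam_def)
  also have "a / 32 * sqrt (real n) * (old i * real n powr (- a)) = a / 4 * (1 / 8 * (old i * real n powr (1 / 2 - a)))"
  proof -
    have "sqrt (real n) * real n powr (- a) = real n powr (1 / 2 - a)"
      using i0 by (simp add: powr_half_sqrt[symmetric] flip: powr_add)
    then show ?thesis by (simp add: mult_ac)
  qed
  also have "\<dots> \<le> \<beta> * (new i * (\<Sum>j\<in>{A..<i}. old j) + old i * (\<Sum>j\<in>{i<..<n}. new j))"
    using beta_bounds a kernel_one_ge[OF i A32(2)] A32 by (intro mult_mono) auto
  also have "\<beta> * (lam * ?T g) + \<dots> = \<beta> * (?T (\<lambda>_. 1) + lam * ?T g)" by (simp add: algebra_simps)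
  finally show ?thesis using T by simp
qed

end

section \<open>Large clusters in the growing random graph\<close>

sublocale scaled_profile \<subseteq> edge_percolation "{1..n}" "sym_edge_prob (1 / 2 - a) \<beta>"
  by (rule edge_percolation_growing) (use beta_bounds in auto)

context scaled_profile
begin

abbreviation pr :: "nat \<Rightarrow> nat \<Rightarrow> real" where
  "pr \<equiv> sym_edge_prob (1 / 2 - a) \<beta>"

text \<open>As \<open>\<beta> \<le> 1\<close> and both powers are at most 1, the truncation in
  \<open>edge_prob\<close> never acts.\<close>

lemma pr_le:
  assumes "1 \<le> u" "u \<le> w"
  shows "pr u w = \<beta> * (old u * new w)"
    and "pr w u = \<beta> * (old u * new w)"
proof -
  have "old u \<le> 1 powr (a - 1 / 2)" "new w \<le> 1 powr (- a - 1 / 2)"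
    using assms a by (intro powr_mono2'; simp)+
  then have "\<beta> * (old u * new w) \<le> 1 * (1 * 1)"
    using beta_bounds by (intro mult_mono) auto
  moreover have "- (1 / 2 - a) = a - 1 / 2" "1 / 2 - a - 1 = - a - 1 / 2" by simp_all
  ultimately have "edge_prob (1 / 2 - a) \<beta> u w = \<beta> * (old u * new w)"
    by (simp only: edge_prob_def mult.assoc min_absorb1 mult_1)
  then show "pr u w = \<beta> * (old u * new w)"
    "pr w u = \<beta> * (old u * new w)"
    using assms by (simp_all add: sym_edge_prob_def min_absorb1 max_absorb2 min_absorb2 max_absorb1)
qed

lemma Kop_eq:
  assumes "A \<le> u" "u < m"
  shows "Kop {A..<m} q u = \<beta> * (new u * (\<Sum>w\<in>{A..<u}. old w * q w)
     + old u * (\<Sum>w\<in>{u<..<m}. new w * q w))"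
proof -
  have "{A..<m} - {u} = {A..<u} \<union> {u<..<m}" using assms by auto
  moreover have "{A..<u} \<inter> {u<..<m} = {}" by auto
  ultimately have "Kop {A..<m} q u = (\<Sum>w\<in>{A..<u}. pr u w * q w) + (\<Sum>w\<in>{u<..<m}. pr u w * q w)"
    unfolding Kop_def by (simp only: sum.union_disjoint finite_atLeastLessThan finite_greaterThanLessThan)
  also have "(\<Sum>w\<in>{A..<u}. pr u w * q w) = (\<Sum>w\<in>{A..<u}. \<beta> * (new u * (old w * q w)))"
  proof (rule sum.cong[OF refl])
    fix w assume "w \<in> {A..<u}"
    then have "1 \<le> w" "w \<le> u" using A by auto
    then show "pr u w * q w = \<beta> * (new u * (old w * q w))"
      by (simp only: pr_le(2) mult_ac)
  qed
  also have "(\<Sum>w\<in>{u<..<m}. pr u w * q w) = (\<Sum>w\<in>{u<..<m}. \<beta> * (old u * (new w * q w)))"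
  proof (rule sum.cong[OF refl])
    fix w assume "w \<in> {u<..<m}"
    then have "1 \<le> u" "u \<le> w" using A assms by auto
    then show "pr u w * q w = \<beta> * (old u * (new w * q w))"
      by (simp only: pr_le(1) mult_ac)
  qed
  finally show ?thesis by (simp only: sum_distrib_left distrib_left)
qed

text \<open>The two gains have different uses: the exponential one pays for decaying sources, hence
  for Green's function and second moments; the one from the right end pays for the constant source
  1.\<close>

lemma Kop_f_le:
  assumes V: "V \<subseteq> {A..n}" and i: "A \<le> i" "i \<le> n"
  shows "Kop V f i + rsq i * (1 / 20000 * dec i
    + 5 * a / 16 * S (\<xi> n) * (real i / real n) powr a) \<le> f i"
proof -
  have i0: "0 < real i" using i A by auto
  have "Kop V f i \<le> Kop {A..n} f i"
    by (rule Kop_mono) (use V f_pos in \<open>auto intro: less_imp_le\<close>)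
  also have "\<dots> = Kop {A..<Suc n} f i" by (simp add: atLeastLessThanSuc_atLeastAtMost)
  also have "\<dots> = \<beta> * (new i * (\<Sum>w\<in>{A..<i}. old w * f w)
     + old i * (\<Sum>w\<in>{i<..n}. new w * f w))"
    using Kop_eq[of i "Suc n" f] i by (simp add: greaterThanLessThan_def greaterThanAtMost_def lessThan_Suc_atMost)
  also have "\<dots> = rsq i / (2 * a) * (2 * a * \<beta> * (real i powr (- a) * (\<Sum>w\<in>{A..<i}. old w * f w)
     + real i powr a * (\<Sum>w\<in>{i<..n}. new w * f w)))"
  proof -
    have e: "new i = rsq i * real i powr (- a)" "old i = rsq i * real i powr a"
      by (simp_all add: algebra_simps flip: powr_add)
    have "\<beta> * (c * x * s + c * y * s') = c / (2 * a) * (2 * a * \<beta> * (x * s + y * s'))" for c x y s s'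
      using a by (simp add: field_simps)
    then show ?thesis unfolding e .
  qed
  finally have 1: "Kop V f i \<le> \<dots>" .
  have "rsq i / (2 * a) * (2 * a * \<beta> * (real i powr (- a) * (\<Sum>w\<in>{A..<i}. old w * f w)
     + real i powr a * (\<Sum>w\<in>{i<..n}. new w * f w))
     + (a / 10000 * dec i + 5 * a * (a / 8) * S (\<xi> n) * (real i / real n) powr a))
     \<le> rsq i / (2 * a) * (2 * a * h (\<xi> i))"
    by (rule mult_left_mono[OF f_super[OF i]]) (use a in auto)
  moreover have "c / (2 * a) * (y + (a / 10000 * e + 5 * a * (a / 8) * s * q)) = c / (2 * a) * y + c * (1 / 20000 * e + 5 * a / 16 * s * q)" for c y e s q
    using a by (simp add: field_simps)
  moreover have "rsq i / (2 * a) * (2 * a * h (\<xi> i)) = f i"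
    using a by (simp add: f_def)
  ultimately show ?thesis using 1 by (simp only:)
qed

lemma S_end_nonneg: "0 \<le> S (\<xi> n)"
proof -
  have "0 \<le> \<xi> n \<and> \<xi> n \<le> L" by (rule xi_range) (use A in auto)
  then show ?thesis by (intro S_nonneg) auto
qed

lemma Kop_f_le_exp:
  assumes V: "V \<subseteq> {A..n}" and i: "A \<le> i" "i \<le> n"
  shows "Kop V f i + rsq i * (1 / 20000 * dec i) \<le> f i"
proof -
  have "0 \<le> rsq i * (5 * a / 16 * S (\<xi> n) * (real i / real n) powr a)"
    using S_end_nonneg a by simp
  then show ?thesis using Kop_f_le[OF assms] by (simp only: distrib_left)
qed

text \<open>\<open>rsq i * (i / n)^a\<close> does not increase in \<open>i\<close> because
  \<open>a \<le> 1 / 2\<close>, so its value at \<open>i = n\<close> is a uniform lower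
  bound.\<close>

lemma Kop_f_le_const:
  assumes V: "V \<subseteq> {A..n}" and i: "A \<le> i" "i \<le> n"
  shows "Kop V f i + 5 * a / 16 * (S (\<xi> n) / sqrt (real n)) \<le> f i"
proof -
  have i0: "0 < real i" "0 < real n" using i A by auto
  have "rsq n \<le> rsq i * (real i / real n) powr a"
  proof -
    have "rsq n = old n * real n powr (- a)"
      unfolding powr_add[symmetric] by simp
    also have "\<dots> \<le> old i * real n powr (- a)"
      using i i0 a by (intro mult_right_mono powr_mono2') auto
    also have "old i = rsq i * real i powr a"
      by (simp add: algebra_simps flip: powr_add)
    finally have "rsq n \<le> rsq i * (real i powr a * real n powr (- a))"
      by (simp only: mult.assoc)
    moreover have "(real i / real n) powr a = real i powr a * real n powr (- a)"
      using i0 by (simp add: powr_divide powr_minus_divide)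
    ultimately show ?thesis by (simp only:)
  qed
  then have "(5 * a / 16 * S (\<xi> n)) * rsq n \<le> (5 * a / 16 * S (\<xi> n)) * (rsq i * (real i / real n) powr a)"
    using S_end_nonneg a by (intro mult_left_mono) auto
  moreover have "rsq n = 1 / sqrt (real n)"
    using i0 by (simp add: powr_minus_divide powr_half_sqrt)
  moreover have "0 \<le> rsq i * (1 / 20000 * dec i)" by simp
  moreover have "5 * a / 16 * (S (\<xi> n) / sqrt (real n)) = (5 * a / 16 * S (\<xi> n)) * (1 / sqrt (real n))"
    by simp
  ultimately have "5 * a / 16 * (S (\<xi> n) / sqrt (real n)) \<le> rsq i * (1 / 20000 * dec i)
      + (5 * a / 16 * S (\<xi> n)) * (rsq i * (real i / real n) powr a)"
    by (simp only: add_increasing)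
  also have "\<dots> = rsq i * (1 / 20000 * dec i
    + 5 * a / 16 * S (\<xi> n) * (real i / real n) powr a)"
    by (simp only: distrib_left mult_ac)
  finally show ?thesis using Kop_f_le[OF assms] by linarith
qed

lemma powr_eq_exp_xi:
  assumes "0 < t"
  shows "t powr e = real A powr e * exp (e * \<xi> t)"
  using assms A by (simp add: powr_def ln_div algebra_simps flip: exp_add)

lemma f_le:
  assumes i: "A \<le> i" "i \<le> n"
  shows "f i \<le> 125 * (rsq i * exp (a / 50 * \<xi> i))"
proof -
  have "rsq i * h (\<xi> i) \<le> rsq i * (125 * exp (a / 50 * \<xi> i))"
    using h_le[of "\<xi> i"] xi_range[of i] i by (intro mult_left_mono) auto
  then show ?thesis by (simp add: f_def)
qed

lemma f_nonneg: "A \<le> i \<Longrightarrow> i \<le> n \<Longrightarrow> 0 \<le> f (real i)"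
  using f_pos[of "real i"] by simp

text \<open>\<open>9765625 = 5 * 125^3\<close>, with 125 from \<open>f_le\<close> and 5 from
  \<open>sum_powr_le\<close>. The growth \<open>exp (3 a \<xi> / 50)\<close> is relaxed to the
  exponent \<open>1 / 4\<close>, so that \<open>i^(-3/2)\<close> still leaves the summable power
  \<open>-5/4\<close>.\<close>

lemma f_cube_sum:
  "(\<Sum>i\<in>{A..n}. f i ^ 3) \<le> 9765625 * rsq A"
proof -
  have "f i ^ 3 \<le> 1953125 * (real A powr (- 1 / 4) * real i powr (- 5 / 4))" if i: "i \<in> {A..n}" for i
  proof -
    have i0: "0 < real i" using i A by auto
    have xi: "0 \<le> \<xi> i" using xi_range[of i] i by auto
    have "f i ^ 3 \<le> (125 * (rsq i * exp (a / 50 * \<xi> i))) ^ 3"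
      using f_le[of i] f_nonneg[of i] i by (intro power_mono) auto
    also have "\<dots> = 1953125 * (real i powr (- 3 / 2) * exp (3 * (a / 50) * \<xi> i))"
      using i0 by (simp add: power_mult_distrib powr_power exp_of_nat_mult[symmetric])
    also have "\<dots> \<le> 1953125 * (real i powr (- 3 / 2) * exp (1 / 4 * \<xi> i))"
      using a xi mult_right_mono[of "3 * (a / 50)" "1 / 4" "\<xi> i"] by (intro mult_left_mono) auto
    also have "exp (1 / 4 * \<xi> i) = real A powr (- 1 / 4) * real i powr (1 / 4)"
      using powr_eq_exp_xi[OF i0, of "1 / 4"] A by (simp add: powr_minus field_simps)
    also have "real i powr (- 3 / 2) * (real A powr (- 1 / 4) * real i powr (1 / 4)) = real A powr (- 1 / 4) * real i powr (- 5 / 4)"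
      by (simp flip: powr_add)
    finally show ?thesis .
  qed
  then have "(\<Sum>i\<in>{A..n}. f i ^ 3) \<le> (\<Sum>i\<in>{A..n}. 1953125 * (real A powr (- 1 / 4) * real i powr (- 5 / 4)))"
    by (rule sum_mono)
  also have "\<dots> = 1953125 * (real A powr (- 1 / 4) * (\<Sum>i\<in>{A..n}. real i powr (- 5 / 4)))"
    by (simp only: sum_distrib_left)
  also have "\<dots> \<le> 1953125 * (real A powr (- 1 / 4) * (5 * real A powr (- 1 / 4)))"
    using sum_powr_le[OF A] by (intro mult_left_mono) auto
  also have "\<dots> = 9765625 * rsq A" by (simp flip: powr_add)
  finally show ?thesis .
qed

abbreviation W :: real where
  "W \<equiv> sqrt (real n) / S (\<xi> n)"

text \<open>Inverts the constant in \<open>Kop_f_le_const\<close>, which makes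
  \<open>lam * f\<close> a supersolution for the source 1. The local \<open>lam\<close> of
  \<open>one_plus_g_sub\<close> is a different number and belongs to the subsolution.\<close>

definition lam :: real where
  "lam = 16 / (5 * a) * W"

context
  assumes S_pos: "0 < S (\<xi> n)"
begin

lemma lam_pos: "0 < lam"
  using S_pos a A by (simp add: lam_def)

lemma lam_f_super:
  assumes V: "V \<subseteq> {A..n}" and i: "i \<in> V"
  shows "1 + Kop V (\<lambda>i. lam * f (real i)) i \<le> lam * f (real i)"
proof -
  have "lam * (Kop V f i + 5 * a / 16 * (S (\<xi> n) / sqrt (real n))) \<le> lam * f i"
    using Kop_f_le_const[OF V, of i] V i lam_pos by (intro mult_left_mono) auto
  moreover have "lam * (5 * a / 16 * (S (\<xi> n) / sqrt (real n))) = 1"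
    using a S_pos A by (simp add: lam_def)
  ultimately show ?thesis by (simp only: Kop_cmult distrib_left add.commute)
qed

lemma prob_exists_large_cluster_le:
  assumes t: "0 < t"
  shows "prob {G. \<exists>u\<in>{A..n}. t \<le> csize G {A..n} u} \<le> 9765625 * lam ^ 3 / t ^ 3"
proof -
  have "prob {G. \<exists>u\<in>{A..n}. t \<le> csize G {A..n} u} \<le> (\<Sum>u\<in>{A..n}. (lam * f (real u)) ^ 3) / t ^ 3"
    by (rule prob_large_cluster_le) (use A t lam_pos lam_f_super f_nonneg in auto)
  also have "(\<Sum>u\<in>{A..n}. (lam * f (real u)) ^ 3) = lam ^ 3 * (\<Sum>u\<in>{A..n}. f (real u) ^ 3)"
    by (simp add: power_mult_distrib sum_distrib_left)
  also have "\<dots> / t ^ 3 \<le> lam ^ 3 * (9765625 * 1) / t ^ 3"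
  proof (intro divide_right_mono mult_left_mono)
    have "rsq A \<le> real A powr 0" using A by (intro powr_mono) auto
    then show "(\<Sum>u\<in>{A..n}. f (real u) ^ 3) \<le> 9765625 * 1" using f_cube_sum A by simp
  qed (use lam_pos t in auto)
  finally show ?thesis by (simp add: mult_ac)
qed

end

end

section \<open>Green's function and the lower bound near the cutoff\<close>

context scaled_profile
begin

text \<open>As a function of \<open>w\<close> the kernel must be below a multiple of
  \<open>rsq w * dec w\<close>, the source that \<open>Kop_f_le_exp\<close> can pay for. The true
  decay at rate \<open>a\<close> in the distance of \<open>\<xi> u\<close> and
  \<open>\<xi> w\<close> is therefore weakened to a pure exponential in
  \<open>\<xi> w\<close>.\<close>

lemma pr_le_exp:
  assumes "A \<le> u" "A \<le> w"
  shows "pr u w \<le> rsq u * rsq w * exp (a / 100 * (\<xi> u - \<xi> w))"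
proof -
  have main: "\<beta> * (old i * new j)
      \<le> rsq i * rsq j * exp e"
    if ij: "A \<le> i" "i \<le> j" and e: "a * (\<xi> i - \<xi> j) \<le> e" for i j and e :: real
  proof -
    have 0: "0 < real i" "0 < real j" using ij A by auto
    have s: "old i = rsq i * real i powr a"
      "new j = rsq j * real j powr (- a)"
      by (simp_all add: algebra_simps flip: powr_add)
    have "real i powr a * real j powr (- a) = exp (a * (\<xi> i - \<xi> j))"
      unfolding powr_eq_exp_xi[OF 0(1)] powr_eq_exp_xi[OF 0(2)]
      using A by (simp add: powr_minus_divide right_diff_distrib exp_diff exp_minus field_simps)
    also have "\<dots> \<le> exp e" using e by simp
    finally have "\<beta> * ((rsq i * rsq j) * (real i powr a * real j powr (- a)))
        \<le> 1 * ((rsq i * rsq j) * exp e)"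
      using beta_bounds by (intro mult_mono) auto
    then show ?thesis unfolding s by (simp only: mult_ac mult_1)
  qed
  have mono: "\<xi> i \<le> \<xi> j" if "A \<le> i" "i \<le> j" for i j :: nat
    using that A by (intro ln_mono) (auto simp: divide_right_mono)
  show ?thesis
  proof (cases "u \<le> w")
    case True
    have "a * (\<xi> u - \<xi> w) \<le> a / 100 * (\<xi> u - \<xi> w)"
      using mono[OF assms(1) True] a by (intro mult_right_mono_neg) auto
    moreover have "1 \<le> u" using assms A by simp
    ultimately show ?thesis using main[OF assms(1) True] pr_le(1)[OF _ True] by (simp only:)
  next
    case False
    then have wu: "w \<le> u" by simp
    have "a * (\<xi> w - \<xi> u) \<le> 0 * (\<xi> w - \<xi> u)"
      using mono[OF assms(2) wu] a by (intro mult_right_mono_neg) auto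
    moreover have "0 \<le> a / 100 * (\<xi> u - \<xi> w)" using mono[OF assms(2) wu] a by simp
    ultimately have "a * (\<xi> w - \<xi> u) \<le> a / 100 * (\<xi> u - \<xi> w)" by simp
    note main[OF assms(2) wu this]
    moreover have "1 \<le> w" using assms A by simp
    ultimately show ?thesis using pr_le(2)[OF _ wu] by (simp only: mult_ac)
  qed
qed

text \<open>A supersolution for the source \<open>pr u\<close>, in effect a bound for Green's
  function. The factor 20000 inverts the exponential gain in \<open>Kop_f_le_exp\<close>.\<close>

definition green :: "nat \<Rightarrow> nat \<Rightarrow> real" where
  "green u w = 20000 * (rsq u * exp (a / 100 * \<xi> u)) * f w"

text \<open>One comparison for all decaying sources: the kernel, the errors of the mean recursion,
  the squares of \<open>lam * f\<close>, and the indicator of the block near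
  \<open>A\<close>.\<close>

lemma Kop_const_f_le:
  assumes V: "V \<subseteq> {A..n}" and i: "i \<in> V" and c: "0 \<le> c"
    and s: "s \<le> c * (rsq i * dec i)"
  shows "s + Kop V (\<lambda>i. 20000 * c * f (real i)) i \<le> 20000 * c * f (real i)"
proof -
  have "20000 * c * (Kop V f i + rsq i * (1 / 20000 * dec i)) \<le> 20000 * c * f i"
    using Kop_f_le_exp[OF V, of i] V i c by (intro mult_left_mono) auto
  moreover have "20000 * c * (Kop V f i + rsq i * (1 / 20000 * dec i))
     = Kop V (\<lambda>i. 20000 * c * f (real i)) i + c * (rsq i * dec i)"
    by (simp add: Kop_cmult distrib_left)
  ultimately show ?thesis using s by linarith
qed

lemma green_super:
  assumes V: "V \<subseteq> {A..n}" and u: "u \<in> V" and w: "w \<in> V"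
  shows "pr u w + Kop V (green u) w \<le> green u w"
  unfolding green_def[abs_def]
proof (rule Kop_const_f_le[OF V w])
  have uw: "A \<le> u" "A \<le> w" using V u w by auto
  have "exp (a / 100 * (\<xi> u - \<xi> w)) = exp (a / 100 * \<xi> u) * dec w"
    by (simp add: algebra_simps flip: exp_add)
  then show "pr u w \<le> rsq u * exp (a / 100 * \<xi> u) * (rsq w * dec w)"
    using pr_le_exp[OF uw] by (simp only: mult_ac)
qed simp

lemma green_nonneg: "A \<le> w \<Longrightarrow> w \<le> n \<Longrightarrow> 0 \<le> green u w"
  using f_nonneg by (simp add: green_def)

context
  assumes S_pos: "0 < S (\<xi> n)"
begin

text \<open>The first term contains \<open>1 / u = exp (- \<xi> u) / A\<close>, the second one
  \<open>rsq A * rsq u = exp (- \<xi> u / 2) / A\<close>; both decays outweigh the small exponential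
  factors. The constants \<open>20000 * 125^2\<close> and \<open>20000^2 * 9765625\<close> add up to
  less than \<open>4 * 10^15\<close>.\<close>

lemma error_le:
  assumes V: "V \<subseteq> {A..n}" and u: "u \<in> V"
  shows "lam * f u * Kop V (green u) u + (\<Sum>w\<in>V. lam * f w * (green u w)\<^sup>2)
     \<le> (4 * 10 ^ 15 * lam / real A) * (rsq u * dec u)"
proof -
  have An: "A \<le> u" "u \<le> n" using V u by auto
  have u0: "0 < real u" "0 < real A" using An A by auto
  have fV: "finite V" using V finite_subset by blast
  have xu: "0 \<le> \<xi> u" using xi_range[of u] An by auto
  note lam = lam_pos[OF S_pos]
  let ?k = "a / 100" and ?x = "\<xi> u"
  let ?R = "rsq u * exp (- ?k * ?x)"
  have inv: "real u powr (- 1) = 1 / real A * exp (- ?x)"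
    using powr_eq_exp_xi[OF u0(1), of "- 1"] u0 by (simp add: powr_minus_divide)
  have "Kop V (green u) u \<le> green u u"
    using green_super[OF V u u] p_nonneg[of u u] by linarith
  then have "lam * f u * Kop V (green u) u \<le> lam * f u * green u u"
    using lam f_nonneg[OF An] by (intro mult_left_mono) auto
  also have "\<dots> = (20000 * lam) * (rsq u * exp (?k * ?x)) * (f u * f u)"
    by (simp add: green_def)
  also have "\<dots> \<le> (20000 * lam) * (rsq u * exp (?k * ?x)) * ((125 * (rsq u * exp (a / 50 * ?x))) * (125 * (rsq u * exp (a / 50 * ?x))))"
    using lam f_nonneg[OF An] f_le[OF An] by (intro mult_left_mono mult_mono) auto
  also have "\<dots> = (312500000 * lam) * (rsq u * ((rsq u * rsq u) * (exp (?k * ?x) * (exp (a / 50 * ?x) * exp (a / 50 * ?x)))))"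
    by (simp only: mult_ac, simp?)
  also have "rsq u * rsq u = real u powr (- 1)" by (simp flip: powr_add)
  also have "\<dots> = 1 / real A * exp (- ?x)" by (rule inv)
  also have "(312500000 * lam) * (rsq u * (1 / real A * exp (- ?x) * (exp (?k * ?x) * (exp (a / 50 * ?x) * exp (a / 50 * ?x)))))
     = (312500000 * lam / real A) * (rsq u * exp ((5 * ?k - 1) * ?x))"
    by (simp add: algebra_simps flip: exp_add)
  also have "\<dots> \<le> (312500000 * lam / real A) * ?R"
  proof (intro mult_left_mono)
    have "(5 * ?k - 1) * ?x \<le> (- ?k) * ?x" using a xu by (intro mult_right_mono) auto
    then show "exp ((5 * ?k - 1) * ?x) \<le> exp (- ?k * ?x)" by simp
  qed (use lam in auto)
  finally have 1: "lam * f u * Kop V (green u) u \<le> (312500000 * lam / real A) * ?R" .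
  have "(\<Sum>w\<in>V. lam * f w * (green u w)\<^sup>2)
     = (400000000 * lam * ((rsq u * exp (?k * ?x)) * (rsq u * exp (?k * ?x)))) * (\<Sum>w\<in>V. f w ^ 3)"
    unfolding sum_distrib_left by (intro sum.cong refl) (simp add: green_def power2_eq_square power3_eq_cube)
  also have "\<dots> \<le> (400000000 * lam * ((rsq u * exp (?k * ?x)) * (rsq u * exp (?k * ?x)))) * (9765625 * rsq A)"
  proof (rule mult_left_mono)
    have "(\<Sum>w\<in>V. f w ^ 3) \<le> (\<Sum>w\<in>{A..n}. f w ^ 3)"
      by (rule sum_mono2) (use V f_nonneg in auto)
    then show "(\<Sum>w\<in>V. f w ^ 3) \<le> 9765625 * rsq A" using f_cube_sum by linarith
  qed (use lam in auto)
  also have "\<dots> = (3906250000000000 * lam * rsq A) * (rsq u * (rsq u * (exp (?k * ?x) * exp (?k * ?x))))"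
    by (simp only: mult_ac, simp?)
  also have "(rsq A) = real A powr (- 1) * real A powr (1 / 2)"
    unfolding powr_add[symmetric] by simp
  also have "(3906250000000000 * lam * (real A powr (- 1) * real A powr (1 / 2))) * (rsq u * (rsq u * (exp (?k * ?x) * exp (?k * ?x))))
      = (3906250000000000 * lam / real A) * (rsq u * ((real A powr (1 / 2) * rsq u) * (exp (?k * ?x) * exp (?k * ?x))))"
  proof -
    have "real A powr (- 1) = 1 / real A" using u0 by (simp add: powr_minus_divide)
    moreover have "k * l * (1 / x * y) * (b * (c * d)) = k * l / x * (b * ((y * c) * d))" for k l x y b c d :: real by simp
    ultimately show ?thesis by (simp only:)
  qed
  also have "real A powr (1 / 2) * rsq u = exp (- 1 / 2 * ?x)"
    using powr_eq_exp_xi[OF u0(1), of "- 1 / 2"] u0 by (simp add: powr_minus_divide)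
  also have "(3906250000000000 * lam / real A) * (rsq u * (exp (- 1 / 2 * ?x) * (exp (?k * ?x) * exp (?k * ?x))))
      = (3906250000000000 * lam / real A) * (rsq u * exp ((2 * ?k - 1 / 2) * ?x))"
    by (simp add: algebra_simps flip: exp_add)
  also have "\<dots> \<le> (3906250000000000 * lam / real A) * ?R"
  proof (intro mult_left_mono)
    have "(2 * ?k - 1 / 2) * ?x \<le> (- ?k) * ?x" using a xu by (intro mult_right_mono) auto
    then show "exp ((2 * ?k - 1 / 2) * ?x) \<le> exp (- ?k * ?x)" by simp
  qed (use lam in auto)
  finally have 2: "(\<Sum>w\<in>V. lam * f w * (green u w)\<^sup>2) \<le> (3906250000000000 * lam / real A) * ?R" .
  have "lam * f u * Kop V (green u) u + (\<Sum>w\<in>V. lam * f w * (green u w)\<^sup>2)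
     \<le> (312500000 * lam / real A + 3906250000000000 * lam / real A) * ?R"
    using 1 2 by (simp only: distrib_right add_mono)
  also have "\<dots> \<le> (4 * 10 ^ 15 * lam / real A) * ?R"
    using lam u0 by (intro mult_right_mono) (auto simp: field_simps)
  finally show ?thesis .
qed

lemma f_near_A_le:
  assumes m: "A \<le> m" "m < 2 * A" "m \<le> n"
  shows "f m \<le> 250 * rsq A"
proof -
  have "\<xi> m \<le> ln 2" using m A by (intro ln_mono) (auto simp: field_simps)
  moreover have "0 \<le> \<xi> m" using xi_range[of m] m by auto
  ultimately have "a / 50 * \<xi> m \<le> 1 * ln 2" using a by (intro mult_mono) auto
  then have "exp (a / 50 * \<xi> m) \<le> exp (ln 2)" by (simp only: exp_le_cancel_iff mult_1)
  then have e: "exp (a / 50 * \<xi> m) \<le> 2" by (simp only: exp_ln zero_less_numeral)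
  have "f m \<le> 125 * (rsq m * exp (a / 50 * \<xi> m))" using f_le m by simp
  also have "\<dots> \<le> 125 * (rsq A * 2)"
    using m A e by (intro mult_left_mono mult_mono powr_mono2') auto
  finally show ?thesis by simp
qed

context
  assumes A32: "32 \<le> A" and A4: "4 * A \<le> n" and S1: "1 \<le> S (\<xi> n)"
begin

text \<open>Maximum principle for the mean plus a correction minus the subsolution
  \<open>1 + l * g\<close>. The correction is a multiple of \<open>f\<close> that serves as a
  supersolution for the error in \<open>error_le\<close>;
  \<open>8 * 10^19 = 20000 * 4 * 10^15\<close>.\<close>

lemma E_csize_ge:
  assumes m: "m \<in> {A..<n}"
  shows "1 + a / 80 * W * g m - 8 * 10 ^ 19 * lam / real A * f m \<le> meanC {A..<n} m"
proof -
  let ?V = "{A..<n}"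
  have VU: "?V \<subseteq> {1..n}" and VA: "?V \<subseteq> {A..n}" and fV: "finite ?V" using A by auto
  define T where "T = (\<lambda>m. meanC ?V m)"
  define c where "c = 4 * 10 ^ 15 * lam / real A"
  define \<psi> where "\<psi> = (\<lambda>i::nat. 20000 * c * f (real i))"
  define l where "l = a / 80 * W"
  note lam = lam_pos[OF S_pos]
  have c0: "0 \<le> c" using lam by (simp add: c_def)
  define z where "z = (\<lambda>i. T i + \<psi> i + (-1) * (1 + l * g i))"
  have "0 \<le> z m"
  proof (rule Kop_max_principle[of ?V "\<lambda>i. f (real i)", OF fV])
    fix v assume v: "v \<in> ?V"
    show "0 < f (real v)" using f_pos v by auto
    have "0 < rsq v * (1 / 20000 * dec v)" using v A by simp
    then show "Kop ?V (\<lambda>i. f (real i)) v < f (real v)" using Kop_f_le_exp[OF VA, of v] v by auto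
    have 1: "1 + Kop ?V T v \<le> T v + (lam * f (real v) * Kop ?V (green v) v + (\<Sum>w\<in>?V. lam * f w * (green v w)\<^sup>2))"
      unfolding T_def
      by (rule E_csize_almost_super[OF VU v])
        (use lam lam_f_super[OF S_pos VA] green_super[OF VA v] green_nonneg f_nonneg v in auto)
    have 2: "c * (rsq v * dec v) + Kop ?V \<psi> v \<le> \<psi> v"
      unfolding \<psi>_def by (rule Kop_const_f_le[OF VA v c0]) simp
    have 3: "l * g v \<le> Kop ?V (\<lambda>i. 1 + l * g i) v"
      using one_plus_g_sub[of v, OF _ _ A32 A4 S1] v Kop_eq[of v n "\<lambda>i. 1 + l * g i"] by (simp add: l_def)
    have "Kop ?V z v = Kop ?V T v + Kop ?V \<psi> v + (-1) * Kop ?V (\<lambda>i. 1 + l * g i) v"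
      unfolding z_def Kop_add Kop_cmult ..
    have 4: "lam * f (real v) * Kop ?V (green v) v + (\<Sum>w\<in>?V. lam * f w * (green v w)\<^sup>2)
        \<le> c * (rsq v * dec v)"
      using error_le[OF VA v] unfolding c_def .
    have lin: "k1 + k2 + (-1) * k3 \<le> t1 + t2 + (-1) * (1 + t3)"
      if "1 + k1 \<le> t1 + d" "e + k2 \<le> t2" "t3 \<le> k3" "d \<le> e" for k1 k2 k3 t1 t2 t3 d e :: real
      using that by simp
    show "Kop ?V z v \<le> z v"
      unfolding \<open>Kop ?V z v = _\<close> unfolding z_def by (rule lin[OF 1 2 3 4])
  qed (rule m)
  moreover have "20000 * c = 8 * 10 ^ 19 * lam / real A" by (simp add: c_def)
  ultimately show ?thesis unfolding z_def \<psi>_def l_def T_def by (simp only:) simp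
qed

lemma g_near_A_ge:
  assumes m: "A \<le> m" "m < 2 * A"
  shows "1 / 2 * rsq A \<le> g m"
proof -
  have "1 / 2 * rsq A = 4 powr (- 1 / 2) * rsq A"
    using powr_powr[of "2::real" 2 "- 1 / 2"] by (simp add: powr_minus_divide)
  also have "\<dots> = (4 * real A) powr (- 1 / 2)" by (simp add: powr_mult)
  also have "\<dots> \<le> real (Suc m) powr (- 1 / 2)"
    using m A by (intro powr_mono2') auto
  also have "\<dots> \<le> g m" by (rule g_ge) (use m A4 A in auto)
  finally show ?thesis .
qed

text \<open>In Paley-Zygmund both \<open>s^2\<close> and \<open>Qb\<close> are proportional to
  \<open>W^2 / A\<close>, so \<open>p0\<close> depends on \<open>a\<close> alone. The assumed size
  of \<open>A\<close> makes the error in \<open>E_csize_ge\<close> at most half of the main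
  term.\<close>

lemma prob_no_large_cluster_near_A_le:
  assumes A0: "320 * 64 * 10 ^ 21 / a\<^sup>2 \<le> real A"
  defines "p0 \<equiv> (a / 640)\<^sup>2 / (78125000000 * (16 / (5 * a))\<^sup>2)"
  shows "prob {G. \<forall>m\<in>{A..<2 * A}. csize G {A..<n} m < a / 640 * W * rsq A}
     \<le> 2 * 10 ^ 7 / p0\<^sup>2 / real A"
proof -
  let ?V = "{A..<n}" and ?B = "{A..<2 * A}"
  have VU: "?V \<subseteq> {1..n}" and VA: "?V \<subseteq> {A..n}" and fV: "finite ?V" using A by auto
  have BV: "?B \<subseteq> ?V" using A4 A by auto
  note lam = lam_pos[OF S_pos]
  have u0: "0 < real A" "0 < real n" using A by auto
  have W: "0 < W" using S_pos u0 by simp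
  have p0: "0 < p0" using a by (simp add: p0_def)
  let ?q = "rsq A"
  define s where "s = a / 640 * W * ?q"
  have q0: "0 < ?q" using u0 by simp
  have s0: "0 < s" unfolding s_def using a by (intro mult_pos_pos W q0) auto
  have qq: "?q * ?q = 1 / real A"
  proof -
    have "?q * ?q = real A powr (- 1)" by (simp flip: powr_add)
    then show ?thesis using u0 by (simp add: powr_minus_divide)
  qed
  define Qb where "Qb = 78125000000 * lam\<^sup>2 / real A"
  have Q0: "0 < Qb" using lam u0 by (simp add: Qb_def)
  have pm: "p0 \<le> prob {G. s \<le> csize G ?V m}" if m: "m \<in> ?B" for m
  proof -
    have mV: "m \<in> ?V" using m BV by auto
    have fm: "f m \<le> 250 * ?q" using f_near_A_le[of m] m mV by auto
    have "8 * 10 ^ 19 * lam / real A * f m \<le> 8 * 10 ^ 19 * lam / real A * (250 * ?q)"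
      using lam by (intro mult_left_mono[OF fm]) auto
    also have "\<dots> = (64 * 10 ^ 21 / a / real A) * (W * ?q)" by (simp add: lam_def)
    also have "\<dots> \<le> (a / 320) * (W * ?q)"
    proof (rule mult_right_mono)
      show "64 * 10 ^ 21 / a / real A \<le> a / 320"
        using A0 a u0 by (simp add: field_simps power2_eq_square)
    qed (intro mult_nonneg_nonneg less_imp_le W q0)
    finally have 1: "8 * 10 ^ 19 * lam / real A * f m \<le> (a / 320) * (W * ?q)" .
    have k1: "a / 80 * W * (1 / 2 * ?q) \<le> a / 80 * W * g m"
      using g_near_A_ge[of m] m a by (intro mult_left_mono mult_nonneg_nonneg less_imp_le[OF W]) auto
    have k2: "a / 80 * W * (1 / 2 * ?q) = (a / 160) * (W * ?q)" by simp
    have k3: "2 * s = (a / 320) * (W * ?q)" by (simp add: s_def)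
    have k4: "(a / 160) * (W * ?q) = 2 * ((a / 320) * (W * ?q))" by simp
    have lin: "s' \<le> t" if "x \<le> y" "x = p" "s' = r" "p = 2 * r" "1 + y - z \<le> t" "z \<le> r" for s' t x y z p r :: real
      using that by linarith
    have E2: "2 * s \<le> meanC ?V m"
      by (rule lin[OF k1 k2 k3 k4 E_csize_ge[OF mV] 1])
    \<comment> \<open>\<open>(lam * f)^2\<close> decays like \<open>1 / v\<close> up to a small
      exponential, and \<open>rsq v = ?q * exp (- \<xi> v / 2)\<close> supplies both the factor
      \<open>?q\<close> and the decay \<open>dec v\<close>. The 15625 is
      \<open>125^2\<close>.\<close>
    define c where "c = 15625 * lam\<^sup>2 * ?q"
    have c0: "0 \<le> c" by (simp add: c_def)
    have "E (\<lambda>G. csize G ?V m * csize G ?V m) \<le> Gop ?V (card ?V) (\<lambda>v. lam * f (real v) * (lam * f (real v))) m"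
      by (rule E_XX_le[OF VU _ _ lam_f_super[OF S_pos VA] _ _ lam_f_super[OF S_pos VA]])
        (use mV lam f_nonneg in auto)
    also have "\<dots> \<le> 20000 * c * f m"
    proof (rule Gop_le[OF fV, where \<psi> = "\<lambda>v. 20000 * c * f (real v)"])
      fix v assume v: "v \<in> ?V"
      show "0 \<le> 20000 * c * f (real v)" using c0 f_nonneg v by auto
      show "lam * f (real v) * (lam * f (real v)) + Kop ?V (\<lambda>v. 20000 * c * f (real v)) v \<le> 20000 * c * f (real v)"
      proof (rule Kop_const_f_le[OF VA v c0])
        have An: "A \<le> v" "v \<le> n" and v0: "0 < real v" using v A by auto
        have xv: "0 \<le> \<xi> v" using xi_range[of v] An by auto
        have "lam * f (real v) * (lam * f (real v)) = lam\<^sup>2 * (f (real v) * f (real v))" by (simp add: power2_eq_square)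
        also have "\<dots> \<le> lam\<^sup>2 * ((125 * (rsq v * exp (a / 50 * \<xi> v))) * (125 * (rsq v * exp (a / 50 * \<xi> v))))"
          using f_nonneg[OF An] f_le[OF An] by (intro mult_left_mono mult_mono) auto
        also have "\<dots> = 15625 * lam\<^sup>2 * (rsq v * (rsq v * (exp (a / 50 * \<xi> v) * exp (a / 50 * \<xi> v))))"
          by (simp only: mult_ac, simp?)
        also have "rsq v * (exp (a / 50 * \<xi> v) * exp (a / 50 * \<xi> v)) = ?q * exp ((a / 25 - 1 / 2) * \<xi> v)"
          unfolding powr_eq_exp_xi[OF v0] by (simp add: algebra_simps flip: exp_add)
        also have "15625 * lam\<^sup>2 * (rsq v * (?q * exp ((a / 25 - 1 / 2) * \<xi> v)))
           \<le> 15625 * lam\<^sup>2 * (rsq v * (?q * dec v))"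
        proof (intro mult_left_mono)
          have "(a / 25 - 1 / 2) * \<xi> v \<le> (- (a / 100)) * \<xi> v" using a xv by (intro mult_right_mono) auto
          then show "exp ((a / 25 - 1 / 2) * \<xi> v) \<le> dec v" by simp
        qed auto
        finally show "lam * f (real v) * (lam * f (real v)) \<le> c * (rsq v * dec v)"
          by (simp add: c_def mult_ac)
      qed
    qed (rule mV)
    also have "\<dots> \<le> 20000 * c * (250 * ?q)" using c0 by (intro mult_left_mono[OF fm]) auto
    also have "\<dots> = 78125000000 * lam\<^sup>2 * (?q * ?q)" by (simp add: c_def)
    also have "\<dots> = Qb" unfolding qq by (simp add: Qb_def)
    finally have Q2: "E (\<lambda>G. csize G ?V m * csize G ?V m) \<le> Qb" .
    have "p0 = s\<^sup>2 / Qb"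
    proof -
      have "s\<^sup>2 = (a / 640)\<^sup>2 * W\<^sup>2 * (?q * ?q)" unfolding s_def by (simp only: power_mult_distrib power2_eq_square mult_ac)
      then have s2: "s\<^sup>2 = (a / 640)\<^sup>2 * W\<^sup>2 / real A" unfolding qq by simp
      have l2: "lam\<^sup>2 = (16 / (5 * a))\<^sup>2 * W\<^sup>2" unfolding lam_def by (rule power_mult_distrib)
      have gen: "x / (k * z) = x * w / y / (k * (z * w) / y)" if "w \<noteq> 0" "y \<noteq> 0" for x w y k z :: real
        using that by (simp add: field_simps)
      have "0 < W\<^sup>2" by (rule zero_less_power[OF W])
      then have "W\<^sup>2 \<noteq> 0" by (rule less_imp_neq[THEN not_sym])
      then show ?thesis unfolding Qb_def p0_def s2 l2 using u0 by (intro gen) auto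
    qed
    then show ?thesis using paley_zygmund[OF s0 E2 Q0 Q2] by simp
  qed
  have vm: "meanX (indicator ?B) ?V m \<le> 2 * 10 ^ 7" if m: "m \<in> ?B" for m
  proof -
    have mV: "m \<in> ?V" using m BV by auto
    have fm: "f m \<le> 250 * ?q" using f_near_A_le[of m] m mV by auto
    \<comment> \<open>On the block, \<open>v < 2 * A\<close> gives
      \<open>sqrt A * rsq v * dec v \<ge> 1 / 2\<close>, so \<open>c\<close> covers the indicator;
      then \<open>20000 * 4 * 250 = 2 * 10^7\<close>.\<close>
    define c where "c = 4 * real A powr (1 / 2)"
    have c0: "0 \<le> c" by (simp add: c_def)
    have "meanX (indicator ?B) ?V m \<le> 20000 * c * f m"
    proof (rule E_X_le[OF VU, where \<phi> = "\<lambda>v. 20000 * c * f (real v)"])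
      fix v assume v: "v \<in> ?V"
      show "0 \<le> 20000 * c * f (real v)" using c0 f_nonneg v by auto
      show "indicator ?B v + Kop ?V (\<lambda>v. 20000 * c * f (real v)) v \<le> 20000 * c * f (real v)"
      proof (rule Kop_const_f_le[OF VA v c0])
        show "indicator ?B v \<le> c * (rsq v * dec v)"
        proof (cases "v \<in> ?B")
          case True
          have v0: "0 < real v" using True A by auto
          have xv: "0 \<le> \<xi> v" using xi_range[of v] v by auto
          have "\<xi> v \<le> ln 2" using True A by (intro ln_mono) (auto simp: field_simps)
          have "(1 / 2 + a / 100) * \<xi> v \<le> 1 * ln 2"
            using a xv \<open>\<xi> v \<le> ln 2\<close> by (intro mult_mono) auto
          then have "exp (- ln 2) \<le> exp (- 1 / 2 * \<xi> v + - (a / 100) * \<xi> v)" by (simp add: algebra_simps)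
          moreover have "exp (- ln 2) = (1 / 2 :: real)" by (simp add: exp_minus)
          ultimately have "1 / 2 \<le> exp (- 1 / 2 * \<xi> v) * dec v" by (simp only: exp_add)
          then have "4 * (1 / 2) \<le> 4 * (exp (- 1 / 2 * \<xi> v) * dec v)" by (rule mult_left_mono) simp
          also have "\<dots> = 4 * (real A powr (1 / 2) * ?q) * (exp (- 1 / 2 * \<xi> v) * dec v)"
            using u0 by (simp flip: powr_add)
          also have "\<dots> = c * (rsq v * dec v)"
            unfolding powr_eq_exp_xi[OF v0] c_def by (simp only: mult_ac)
          finally show ?thesis using True by simp
        qed (simp add: c_def)
      qed
    qed (use mV in auto)
    also have "\<dots> \<le> 20000 * c * (250 * ?q)" using c0 by (intro mult_left_mono[OF fm]) auto
    also have "\<dots> = 2 * 10 ^ 7 * (real A powr (1 / 2) * ?q)" by (simp add: c_def)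
    also have "real A powr (1 / 2) * ?q = 1" using u0 by (simp flip: powr_add)
    finally show ?thesis by simp
  qed
  have "prob {G. \<forall>m\<in>?B. csize G ?V m < s} \<le> (2 * 10 ^ 7 * real A) / (real A * p0)\<^sup>2"
  proof (rule prob_no_large_cluster_le[OF VU BV])
    show "0 < real A * p0" using u0 p0 by simp
    show "real A * p0 \<le> (\<Sum>m\<in>?B. prob {G. s \<le> csize G ?V m})"
      using sum_bounded_below[of ?B p0 "\<lambda>m. prob {G. s \<le> csize G ?V m}", OF pm] by simp
    show "(\<Sum>m\<in>?B. meanX (indicator ?B) ?V m) \<le> 2 * 10 ^ 7 * real A"
      using sum_bounded_above[of ?B "\<lambda>m. meanX (indicator ?B) ?V m" "2 * 10 ^ 7", OF vm] by (simp add: mult.commute)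
  qed
  also have "\<dots> = 2 * 10 ^ 7 / p0\<^sup>2 / real A" using u0 p0 by (simp add: power2_eq_square)
  finally show ?thesis unfolding s_def .
qed

end

end

end

section \<open>Growth of \<open>S\<close>, choice of the constants, and the bounds for a single
  \<open>n\<close>\<close>

context profile
begin

lemma exp_S_deriv:
  "((\<lambda>x. exp (a / 100 * x) * S x) has_real_derivative exp (a / 100 * x) * (C x + a / 100 * S x)) (at x)"
proof -
  have "((\<lambda>x. exp (a / 100 * x) * S x) has_real_derivative
      (exp (a / 100 * x) * (a / 100)) * S x + C x * exp (a / 100 * x)) (at x)"
    by (rule DERIV_mult[OF _ S_deriv]) (auto intro!: derivative_eq_intros)
  then show ?thesis by (simp add: algebra_simps)
qed

text \<open>\<open>S\<close> alone may be a sine beyond its maximum, but \<open>C_ge\<close> makes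
  the product increase. Replacing \<open>ln n\<close> by \<open>ln (n / A)\<close> thus costs only a
  power of \<open>A\<close>.\<close>

lemma exp_S_mono:
  assumes "0 \<le> x" "x \<le> y" "y \<le> L"
  shows "exp (a / 100 * x) * S x \<le> exp (a / 100 * y) * S y"
proof (rule DERIV_nonneg_imp_nondecreasing[OF assms(2)])
  fix z assume "x \<le> z" "z \<le> y"
  then have "0 \<le> C z + a / 100 * S z" using C_ge[of z] assms by linarith
  then show "\<exists>d. ((\<lambda>x. exp (a / 100 * x) * S x) has_real_derivative d) (at z) \<and> 0 \<le> d"
    using exp_S_deriv by (metis exp_ge_zero mult_nonneg_nonneg)
qed

text \<open>With \<open>k = a / 100\<close>, \<open>C_ge\<close> bounds the derivative of
  \<open>exp (k x) * S x\<close> below by \<open>exp (k x)\<close>. Integration gives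
  \<open>S x \<ge> (1 - exp (- k x)) / k\<close>, and here \<open>exp (k x) \<ge> 2\<close>.\<close>

lemma S_ge:
  assumes x: "100 * ln 2 / a \<le> x" "x \<le> L"
  shows "1 \<le> S x"
proof -
  have x0: "0 \<le> x" using x(1) a by (smt (verit) divide_nonneg_pos ln_ge_zero mult_nonneg_nonneg)
  define F where "F = (\<lambda>x. exp (a / 100 * x) * S x - 100 / a * exp (a / 100 * x))"
  have "F 0 \<le> F x"
  proof (rule DERIV_nonneg_imp_nondecreasing[OF x0])
    fix z assume z: "0 \<le> z" "z \<le> x"
    have "(F has_real_derivative exp (a / 100 * z) * (C z + a / 100 * S z) - 100 / a * (exp (a / 100 * z) * (a / 100))) (at z)"
      unfolding F_def
      by (rule DERIV_diff[OF exp_S_deriv DERIV_cmult]) (auto intro!: derivative_eq_intros)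
    then have "(F has_real_derivative exp (a / 100 * z) * (C z + a / 100 * S z - 1)) (at z)"
      using a by (simp add: algebra_simps)
    moreover have "0 \<le> exp (a / 100 * z) * (C z + a / 100 * S z - 1)"
      using C_ge[of z] z x by (intro mult_nonneg_nonneg) auto
    ultimately show "\<exists>y. (F has_real_derivative y) (at z) \<and> 0 \<le> y" by blast
  qed
  moreover have "F x = exp (a / 100 * x) * (S x - 100 / a)" by (simp add: F_def algebra_simps)
  moreover have "F 0 = - (100 / a)" by (simp add: F_def S_0)
  ultimately have 1: "- (100 / a) \<le> exp (a / 100 * x) * (S x - 100 / a)" by simp
  have "ln 2 \<le> a / 100 * x" using x(1) a by (simp add: field_simps)
  then have "exp (ln 2) \<le> exp (a / 100 * x)" by (simp only: exp_le_cancel_iff)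
  then have e: "2 \<le> exp (a / 100 * x)" by (simp only: exp_ln zero_less_numeral)
  show ?thesis
  proof (rule ccontr)
    assume "\<not> 1 \<le> S x"
    moreover have "200 \<le> 100 / a" using a by (simp add: field_simps)
    ultimately have neg: "S x - 100 / a \<le> 0" "S x < 100 / a / 2" by auto
    have "exp (a / 100 * x) * (S x - 100 / a) \<le> 2 * (S x - 100 / a)"
      using e neg(1) by (rule mult_right_mono_neg)
    then show False using 1 neg(2) by simp
  qed
qed

end

definition p_large :: "real \<Rightarrow> real" where
  "p_large a = (a / 640)\<^sup>2 / (78125000000 * (16 / (5 * a))\<^sup>2)"

text \<open>The three summands serve \<open>g_sub\<close>, the size condition of
  \<open>prob_no_large_cluster_near_A_le\<close>, and a failure probability of at most
  \<open>\<epsilon> / 2\<close> there.\<close>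

definition cutoff :: "real \<Rightarrow> real \<Rightarrow> nat" where
  "cutoff a \<epsilon> = 32 + nat \<lceil>320 * 64 * 10 ^ 21 / a\<^sup>2 + 2 * (2 * 10 ^ 7 / (p_large a)\<^sup>2) / \<epsilon>\<rceil>"

text \<open>The last summand makes the claim trivial unless \<open>cutoff a \<epsilon> \<le> ln n\<close>.\<close>

definition M_const :: "real \<Rightarrow> real \<Rightarrow> real" where
  "M_const a \<epsilon> = 1 + 2 * (9765625 * (16 / (5 * a)) ^ 3) / \<epsilon> + 640 * real (cutoff a \<epsilon>) / a + exp (real (cutoff a \<epsilon>))"

lemma cutoff_ge:
  assumes "0 < a" "0 < \<epsilon>"
  shows "32 \<le> cutoff a \<epsilon>" "320 * 64 * 10 ^ 21 / a\<^sup>2 \<le> real (cutoff a \<epsilon>)"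
    "2 * 10 ^ 7 / (p_large a)\<^sup>2 / real (cutoff a \<epsilon>) \<le> \<epsilon> / 2"
proof -
  define x where "x = 320 * 64 * 10 ^ 21 / a\<^sup>2"
  define y where "y = 2 * 10 ^ 7 / (p_large a)\<^sup>2"
  have xy: "0 \<le> x" "0 \<le> y" by (simp_all add: x_def y_def)
  have c: "cutoff a \<epsilon> = 32 + nat \<lceil>x + 2 * y / \<epsilon>\<rceil>"
    by (simp only: cutoff_def x_def y_def)
  then show "32 \<le> cutoff a \<epsilon>" by simp
  have ye: "0 \<le> 2 * y / \<epsilon>" using xy assms by simp
  have ge: "x + 2 * y / \<epsilon> \<le> real (cutoff a \<epsilon>)" unfolding c using real_nat_ceiling_ge[of "x + 2 * y / \<epsilon>"] by simp
  then show "320 * 64 * 10 ^ 21 / a\<^sup>2 \<le> real (cutoff a \<epsilon>)" using ye unfolding x_def by linarith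
  have "2 * y / \<epsilon> \<le> real (cutoff a \<epsilon>)" using ge xy by linarith
  moreover have "0 < real (cutoff a \<epsilon>)" unfolding c by simp
  ultimately have "y / real (cutoff a \<epsilon>) \<le> \<epsilon> / 2" using assms by (simp add: field_simps)
  then show "2 * 10 ^ 7 / (p_large a)\<^sup>2 / real (cutoff a \<epsilon>) \<le> \<epsilon> / 2" by (simp only: y_def)
qed

lemma M_const_ge:
  assumes "0 < a" "0 < \<epsilon>"
  shows "1 \<le> M_const a \<epsilon>" "2 * (9765625 * (16 / (5 * a)) ^ 3) / \<epsilon> \<le> M_const a \<epsilon>"
    "640 * real (cutoff a \<epsilon>) / a \<le> M_const a \<epsilon>" "1 + exp (real (cutoff a \<epsilon>)) \<le> M_const a \<epsilon>"
proof -
  have "0 \<le> 2 * (9765625 * (16 / (5 * a)) ^ 3) / \<epsilon>" "0 \<le> 640 * real (cutoff a \<epsilon>) / a" "0 \<le> exp (real (cutoff a \<epsilon>))"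
    using assms by simp_all
  then show "1 \<le> M_const a \<epsilon>" "2 * (9765625 * (16 / (5 * a)) ^ 3) / \<epsilon> \<le> M_const a \<epsilon>"
    "640 * real (cutoff a \<epsilon>) / a \<le> M_const a \<epsilon>" "1 + exp (real (cutoff a \<epsilon>)) \<le> M_const a \<epsilon>"
    unfolding M_const_def by linarith+
qed

text \<open>The conditions on \<open>n\<close> do not mention \<open>\<epsilon>\<close>, which makes
  the later threshold independent of it. When \<open>A \<le> ln n\<close>, \<open>Ll\<close> keeps
  \<open>ln (n / A)\<close> long enough for \<open>S_ge\<close> and \<open>L4\<close> gives
  \<open>4 * A \<le> n\<close>; \<open>L9\<close> serves \<open>S L \<le> sqrt n\<close>.\<close>

lemma (in profile) prob_largest_component_bounds:
  assumes n: "1 \<le> n" and L: "L = ln (real n)" and L9: "9 \<le> L" and L4: "4 * L \<le> real n"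
    and Ll: "100 * ln 2 / a \<le> L - ln L" and \<epsilon>: "0 < \<epsilon>"
  shows "measure_pmf.prob (growing_graph (1 / 2 - a) \<beta> n)
     {E. real (card (largest_component n E)) / (sqrt (real n) / S L) \<in> {1 / M_const a \<epsilon>..M_const a \<epsilon>}} \<ge> 1 - \<epsilon>"
proof -
  let ?P = "measure_pmf.prob (growing_graph (1 / 2 - a) \<beta> n)" and ?c = "\<lambda>E. real (card (largest_component n E))"
  define A where "A = cutoff a \<epsilon>"
  define K where "K = M_const a \<epsilon>"
  define W1 where "W1 = sqrt (real n) / S L"
  note A_ge = cutoff_ge[OF a(1) \<epsilon>, folded A_def] and K_ge = M_const_ge[OF a(1) \<epsilon>, folded A_def K_def]
  have n0: "0 < real n" using n by simp
  have L0: "0 \<le> L" and lnL: "0 \<le> ln L" using L9 by auto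
  have S1: "1 \<le> S L" by (rule S_ge) (use Ll lnL in auto)
  have eL: "exp L = real n" using n0 L by simp
  have SL: "S L \<le> sqrt (real n)"
  proof -
    have "S L \<le> L * exp (a / 100 * L)" using S_le[OF L0] by simp
    also have "\<dots> \<le> (4 * exp (L / 4)) * exp (L / 200)"
    proof (intro mult_mono)
      have "1 + L / 4 \<le> exp (L / 4)" by (rule exp_ge_add_one_self)
      then show "L \<le> 4 * exp (L / 4)" by linarith
      have "a / 100 * L \<le> 1 / 200 * L" using a L0 by (intro mult_right_mono) auto
      then show "exp (a / 100 * L) \<le> exp (L / 200)" by simp
    qed (use L0 in auto)
    also have "\<dots> \<le> (exp (49 / 200 * L) * exp (L / 4)) * exp (L / 200)"
    proof (intro mult_right_mono)
      have "1 + 49 / 400 * L \<le> exp (49 / 400 * L)" by (rule exp_ge_add_one_self)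
      then have "2 \<le> exp (49 / 400 * L)" using L9 by linarith
      then have "2 * 2 \<le> exp (49 / 400 * L) * exp (49 / 400 * L)" by (intro mult_mono) auto
      then show "4 \<le> exp (49 / 200 * L)" by (simp flip: exp_add)
    qed auto
    also have "\<dots> = exp (1 / 2 * L)" by (simp flip: exp_add)
    also have "\<dots> = sqrt (real n)" using n0 unfolding L by (simp add: powr_half_sqrt[symmetric] powr_def)
    finally show ?thesis .
  qed
  have "sqrt (real n) / S L \<le> sqrt (real n) / 1" using S1 by (intro divide_left_mono) auto
  then have W1: "1 \<le> W1" "W1 \<le> sqrt (real n)" using S1 SL by (simp_all add: W1_def)
  have key: "?P {E. ?c E \<in> {lo..hi}}
      \<le> ?P
        {E. ?c E / W1 \<in> {1 / K..K}}"
    if "W1 / K \<le> lo" "hi \<le> K * W1" for lo hi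
  proof (rule measure_pmf.finite_measure_mono)
    show "{E. ?c E \<in> {lo..hi}} \<subseteq> {E. ?c E / W1 \<in> {1 / K..K}}"
    proof
      fix E assume "E \<in> {E. ?c E \<in> {lo..hi}}"
      then have "W1 / K \<le> ?c E" "?c E \<le> K * W1"
        using that by auto
      then show "E \<in> {E. ?c E / W1 \<in> {1 / K..K}}"
        using W1 K_ge(1) by (simp add: field_simps)
    qed
  qed simp
  \<comment> \<open>The upper bound concerns the whole graph, so the supersolution is used with
    cutoff 1.\<close>
  interpret A1: scaled_profile a \<beta> \<rho> L C S 1 n
    by unfold_locales (use n L in auto)
  have x1: "A1.\<xi> (real n) = L" using L by simp
  have "1 - \<epsilon> \<le> ?P
        {E. ?c E / W1 \<in> {1 / K..K}}"
  proof (cases "real A \<le> L")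
    case False
    \<comment> \<open>All possible sizes lie in \<open>{1..n + 1}\<close>, and the last summand of
      \<open>M_const\<close> puts this interval inside the window, as
      \<open>1 \<le> W1 \<le> sqrt n\<close>. The end is \<open>n + 1\<close> because the upper
      event in \<open>prob_largest_component_ge\<close> is not strict.\<close>
    have nA: "real n \<le> exp (real A)" using False eL by (metis exp_le_cancel_iff linorder_not_le order_less_imp_le)
    have "A1.prob {G. \<exists>u\<in>{1..n}. real n + 1 \<le> csize G {1..n} u} = 0"
    proof -
      have "{G. \<exists>u\<in>{1..n}. real n + 1 \<le> csize G {1..n} u} = {}"
      proof -
        have "csize G {1..n} u < real n + 1" if "u \<in> {1..n}" for G u
          using card_mono[OF _ cl_subset[OF that, of G]] by (simp add: csize_eq_card)
        then show ?thesis by (auto simp: not_le)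
      qed
      then show ?thesis by simp
    qed
    moreover have "A1.prob {G. \<forall>m\<in>{1}. csize G {1..n} m < 1} = 0"
    proof -
      have "1 \<le> csize G {1..n} 1" for G
        using finite_cl[of "{1..n}" 1 G] n cl_refl[of 1 G "{1..n}"] by (simp add: csize_eq_card Suc_le_eq card_gt_0_iff) auto
      then have "{G. \<forall>m\<in>{1}. csize G {1..n} m < 1} = {}" by (auto simp: not_less)
      then show ?thesis by simp
    qed
    ultimately have "1 \<le> ?P {E. ?c E \<in> {1..real n + 1}}"
      using prob_largest_component_ge[of \<beta> n "{1}" "{1..n}" "1 / 2 - a" "real n + 1" 1] beta_bounds n by simp
    also have "\<dots> \<le> ?P {E. ?c E / W1 \<in> {1 / K..K}}"
    proof (rule key)
      have nK: "real n + 1 \<le> K" using nA K_ge(4) by linarith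
      have "sqrt (real n) \<le> real n" using n by (intro real_le_lsqrt) (auto simp: power2_eq_square)
      then show "W1 / K \<le> 1" using nK W1 K_ge(1) by (simp add: field_simps)
      have "K * 1 \<le> K * W1" using W1 K_ge(1) by (intro mult_left_mono) auto
      then show "real n + 1 \<le> K * W1" using nK unfolding mult_1_right by linarith
    qed
    finally show ?thesis using \<epsilon> by simp
  next
    case True
    have A0: "1 \<le> A" "32 \<le> A" "0 < real A" using A_ge(1) by auto
    have A4: "4 * A \<le> n" using True L4 by linarith
    have l_eq: "ln (real n / real A) = L - ln (real A)" using n0 A0 L by (simp add: ln_div)
    have lnA: "0 \<le> ln (real A)" "ln (real A) \<le> ln L" using True A0 by auto
    interpret SA: scaled_profile a \<beta> \<rho> L C S A n
      by unfold_locales (use A0 A4 l_eq lnA in auto)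
    let ?l = "ln (real n / real A)"
    have "0 \<le> 100 * ln 2 / a" using a by simp
    then have l: "100 * ln 2 / a \<le> ?l" "0 \<le> ?l" "?l \<le> L"
      unfolding l_eq using Ll lnA by linarith+
    have Sl: "1 \<le> S ?l" by (rule S_ge[OF l(1,3)])
    define lo where "lo = a / 640 * (sqrt (real n) / S ?l) * real A powr (- 1 / 2)"
    have up: "A1.prob {G. \<exists>u\<in>{1..n}. K * W1 \<le> csize G {1..n} u} \<le> \<epsilon> / 2"
    proof -
      have "A1.prob {G. \<exists>u\<in>{1..n}. K * W1 \<le> csize G {1..n} u} \<le> 9765625 * A1.lam ^ 3 / (K * W1) ^ 3"
        by (rule A1.prob_exists_large_cluster_le) (use x1 S1 K_ge(1) W1 in auto)
      also have "A1.lam = 16 / (5 * a) * W1" unfolding A1.lam_def x1 W1_def ..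
      also have "9765625 * (16 / (5 * a) * W1) ^ 3 / (K * W1) ^ 3 = (9765625 * (16 / (5 * a)) ^ 3) / K ^ 3"
      proof -
        have cancel: "9765625 * (x * w) ^ 3 / (k * w) ^ 3 = (9765625 * x ^ 3) / k ^ 3" if "w \<noteq> 0" for x w k :: real
          using that by (simp add: power_mult_distrib)
        show ?thesis by (rule cancel) (use W1(1) in auto)
      qed
      also have "\<dots> \<le> (9765625 * (16 / (5 * a)) ^ 3) / K"
        using K_ge(1) a self_le_power[of K 3] by (intro divide_left_mono) auto
      also have "\<dots> \<le> \<epsilon> / 2"
      proof -
        define y where "y = 9765625 * (16 / (5 * a)) ^ 3"
        have "2 * y / \<epsilon> \<le> K" using K_ge(2) unfolding y_def .
        then have "y / K \<le> \<epsilon> / 2" using K_ge(1) \<epsilon> by (simp add: field_simps)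
        then show ?thesis unfolding y_def .
      qed
      finally show ?thesis .
    qed
    have down: "A1.prob {G. \<forall>m\<in>{A..<2 * A}. csize G {A..<n} m < lo} \<le> \<epsilon> / 2"
    proof -
      have "A1.prob {G. \<forall>m\<in>{A..<2 * A}. csize G {A..<n} m < lo} \<le> 2 * 10 ^ 7 / (p_large a)\<^sup>2 / real A"
        unfolding lo_def p_large_def
        by (rule SA.prob_no_large_cluster_near_A_le) (use Sl A0 A4 A_ge(2) in auto)
      then show ?thesis using A_ge(3) by linarith
    qed
    have sub: "{A..<2 * A} \<subseteq> {A..<n}" "{A..<n} \<subseteq> {1..n}" using A0 A4 by auto
    have "1 - \<epsilon> \<le> ?P {E. ?c E \<in> {lo..K * W1}}"
      using prob_largest_component_ge[OF less_imp_le[OF beta_bounds(1)] n sub, where \<gamma> = "1 / 2 - a" and lo = lo and hi = "K * W1"] up down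
      by linarith
    also have "\<dots> \<le> ?P {E. ?c E / W1 \<in> {1 / K..K}}"
    proof (rule key)
      \<comment> \<open>The subgraph above \<open>A\<close> has the scale
        \<open>S (ln (n / A))\<close>; comparing it with \<open>S L\<close> costs at most
        \<open>A^(1/2)\<close>. Together with \<open>A^(-1/2)\<close> in \<open>lo\<close> this
        explains \<open>640 * A / a\<close> in \<open>M_const\<close>.\<close>
      have "exp (a / 100 * ?l) * S ?l \<le> exp (a / 100 * L) * S L" by (rule exp_S_mono) (use l in auto)
      then have "S ?l \<le> exp (a / 100 * L) * S L / exp (a / 100 * ?l)" by (simp add: field_simps)
      also have "\<dots> = exp (a / 100 * ln (real A)) * S L"
      proof -
        have "a / 100 * L = a / 100 * ln (real A) + a / 100 * ?l" unfolding l_eq by (simp add: field_simps)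
        then have "exp (a / 100 * L) = exp (a / 100 * ln (real A)) * exp (a / 100 * ?l)" by (simp only: exp_add)
        then show ?thesis by simp
      qed
      also have "\<dots> \<le> exp (1 / 2 * ln (real A)) * S L"
      proof (rule mult_right_mono)
        have "a / 100 * ln (real A) \<le> 1 / 2 * ln (real A)" using a lnA by (intro mult_right_mono) auto
        then show "exp (a / 100 * ln (real A)) \<le> exp (1 / 2 * ln (real A))" by (simp only: exp_le_cancel_iff)
      qed (use S1 in simp)
      also have "exp (1 / 2 * ln (real A)) = real A powr (1 / 2)" using A0 by (simp add: powr_def)
      finally have Sle: "S ?l \<le> real A powr (1 / 2) * S L" .
      have "W1 / K \<le> W1 / (640 * real A / a)"
        using K_ge(3) W1 A0 a K_ge(1) by (intro divide_left_mono) auto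
      also have "\<dots> = a / 640 * (sqrt (real n) / (real A powr (1 / 2) * S L)) * real A powr (- 1 / 2)"
      proof -
        define y where "y = real A powr (1 / 2)"
        have y: "0 < y" "y * y = real A" using A0 by (simp_all add: y_def flip: powr_add)
        have q: "real A powr (- 1 / 2) = 1 / y" by (simp add: powr_minus_divide y_def)
        have "sqrt (real n) / S L / (640 * (y * y) / a) = a / 640 * (sqrt (real n) / (y * S L)) * (1 / y)"
          using y(1) a by (simp add: field_simps)
        then show ?thesis unfolding W1_def q y(2) y_def[symmetric] .
      qed
      also have "\<dots> \<le> lo" unfolding lo_def
        using Sle Sl S1 A0 a by (intro mult_right_mono mult_left_mono divide_left_mono) auto
      finally show "W1 / K \<le> lo" .
    qed simp
    finally show ?thesis .
  qed
  then show ?thesis unfolding W1_def K_def .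
qed

section \<open>The critical window\<close>

definition C_sol :: "real \<Rightarrow> real \<Rightarrow> real" where
  "C_sol \<rho> x = (if \<rho> > 0 then cos (sqrt \<rho> * x) else cosh (sqrt (- \<rho>) * x))"

definition S_sol :: "real \<Rightarrow> real \<Rightarrow> real" where
  "S_sol \<rho> x = (if \<rho> > 0 then sin (sqrt \<rho> * x) / sqrt \<rho>
     else if \<rho> = 0 then x else sinh (sqrt (- \<rho>) * x) / sqrt (- \<rho>))"

lemma S_sol_eq_sinc_sqrt:
  assumes "0 < L"
  shows "S_sol \<rho> L = L * sinc_sqrt (\<rho> * L\<^sup>2)"
proof -
  have L2: "0 < L\<^sup>2" using assms by simp
  consider "\<rho> > 0" | "\<rho> = 0" | "\<rho> < 0" by linarith
  then show ?thesis
  proof cases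
    case 1
    then have "0 < \<rho> * L\<^sup>2" "sqrt (\<rho> * L\<^sup>2) = sqrt \<rho> * L" using L2 assms by (simp_all add: real_sqrt_mult)
    then show ?thesis using 1 assms by (simp add: S_sol_def sinc_sqrt_def)
  next
    case 2 then show ?thesis by (simp add: S_sol_def sinc_sqrt_def)
  next
    case 3
    then have neg: "\<rho> * L\<^sup>2 < 0" using L2 by (simp add: mult_neg_pos)
    then have "\<bar>\<rho> * L\<^sup>2\<bar> = (- \<rho>) * L\<^sup>2" by simp
    moreover have "sqrt ((- \<rho>) * L\<^sup>2) = sqrt (- \<rho>) * L"
      unfolding real_sqrt_mult using assms by simp
    ultimately have "sqrt \<bar>\<rho> * L\<^sup>2\<bar> = sqrt (- \<rho>) * L" by (simp only:)
    then show ?thesis using 3 neg assms by (simp add: S_sol_def sinc_sqrt_def)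
  qed
qed

text \<open>At half the angle, \<open>y = sqrt \<rho> * x / 2\<close>, the bound \<open>C_ge\<close>
  follows from \<open>sin y \<le> (a / 100) cos y / sqrt \<rho>\<close>. This holds since
  \<open>cos y \<ge> cos (r / 2)\<close>, and is where the angle must stay below \<open>pi\<close>
  and \<open>\<rho>\<close> must be small in terms of it.\<close>

lemma profile_pos:
  fixes a \<beta> \<rho> L :: real
  assumes a: "0 < a" "a \<le> 1 / 2" and rho: "\<rho> = 2 * a * \<beta> - a\<^sup>2" "\<bar>\<rho>\<bar> \<le> (a / 100)\<^sup>2 / 2" "0 < \<rho>"
    and r: "sqrt \<rho> * L \<le> r" "r < pi" "sqrt \<rho> \<le> a / 100 * cos (r / 2)"
  shows "profile a \<beta> \<rho> L (C_sol \<rho>) (S_sol \<rho>)"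
proof -
  define t where "t = sqrt \<rho>"
  have t: "0 < t" "t * t = \<rho>" using rho(3) by (simp_all add: t_def)
  have C: "C_sol \<rho> = (\<lambda>x. cos (t * x))" and S: "S_sol \<rho> = (\<lambda>x. sin (t * x) / t)"
    using rho(3) by (auto simp: fun_eq_iff C_sol_def S_sol_def t_def)
  have range: "0 \<le> t * x \<and> t * x \<le> r" if "0 \<le> x" "x \<le> L" for x
  proof -
    have "t * x \<le> t * L" using that t by (intro mult_left_mono) auto
    then have "t * x \<le> r" using r(1)[folded t_def] by (rule order_trans)
    then show ?thesis using that t by simp
  qed
  have S_nn: "0 \<le> sin (t * x) / t" if "0 \<le> x" "x \<le> L" for x
    using range[OF that] t r(2) by (intro divide_nonneg_pos sin_ge_zero) auto
  have e1: "1 \<le> exp (a / 100 * x)" if "0 \<le> x" for x using a that by simp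
  show ?thesis
  proof
    show "0 < a" "a \<le> 1 / 2" "\<rho> = 2 * a * \<beta> - a\<^sup>2" "\<bar>\<rho>\<bar> \<le> (a / 100)\<^sup>2 / 2" by fact+
    show "(C_sol \<rho> has_real_derivative - \<rho> * S_sol \<rho> x) (at x)" for x
      unfolding C S using t by (auto intro!: derivative_eq_intros simp: field_simps)
    show "(S_sol \<rho> has_real_derivative C_sol \<rho> x) (at x)" for x
      unfolding C S using t by (auto intro!: derivative_eq_intros simp: field_simps)
    show "C_sol \<rho> 0 = 1" "S_sol \<rho> 0 = 0" by (simp_all add: C S)
    fix x assume x: "0 \<le> x" "x \<le> L"
    show "0 \<le> S_sol \<rho> x" unfolding S by (rule S_nn[OF x])
    show "C_sol \<rho> x \<le> exp (a / 100 * x)" unfolding C using cos_le_one[of "t * x"] e1[OF x(1)] by linarith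
    have "sin (t * x) \<le> t * x" using range[OF x] by (intro sin_x_le_x) auto
    then have "sin (t * x) / t \<le> x" using t by (simp add: field_simps)
    also have "x \<le> x * exp (a / 100 * x)" using e1[OF x(1)] x by (simp add: mult_le_cancel_left1)
    finally show "S_sol \<rho> x \<le> x * exp (a / 100 * x)" unfolding S .
    have "0 \<le> a / 100 * (sin (t * x) / t)" using a S_nn[OF x] by (intro mult_nonneg_nonneg) auto
    then show "C_sol \<rho> x \<le> 1 + a / 100 * S_sol \<rho> x" unfolding C S using cos_le_one[of "t * x"] by linarith
    show "1 \<le> C_sol \<rho> x + a / 100 * S_sol \<rho> x"
    proof -
      define y where "y = t * x / 2"
      have y: "0 \<le> y" "y \<le> r / 2" "t * x = 2 * y" using range[OF x] by (auto simp: y_def)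
      have "cos (r / 2) \<le> cos y" using y r(2) by (intro cos_monotone_0_pi_le) auto
      then have "a / 100 * cos (r / 2) \<le> a / 100 * cos y" using a by (intro mult_left_mono) auto
      then have "t \<le> a / 100 * cos y" using r(3) unfolding t_def by linarith
      then have "1 \<le> a / 100 * cos y / t" using t by (simp add: field_simps)
      then have 1: "0 \<le> a / 100 * cos y / t - sin y" using sin_le_one[of y] by linarith
      have 2: "0 \<le> sin y" using y r(2) by (intro sin_ge_zero) auto
      have "0 \<le> 2 * sin y * (a / 100 * cos y / t - sin y)"
        using 1 2 by (intro mult_nonneg_nonneg) auto
      also have "\<dots> = a / 100 * (2 * sin y * cos y / t) - 2 * (sin y)\<^sup>2"
        by (simp add: power2_eq_square algebra_simps)
      finally show ?thesis unfolding C S y(3) sin_double cos_double_sin by simp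
    qed
  qed
qed

text \<open>With \<open>t = sqrt (- \<rho>) \<le> a / 100\<close>, \<open>C_ge\<close> comes from
  \<open>cosh \<ge> 1\<close>, and \<open>C_le_S\<close> from
  \<open>cosh = sinh + exp (- t x)\<close> and \<open>sinh = t S\<close>.\<close>

lemma profile_nonpos:
  fixes a \<beta> \<rho> L :: real
  assumes a: "0 < a" "a \<le> 1 / 2" and rho: "\<rho> = 2 * a * \<beta> - a\<^sup>2" "\<bar>\<rho>\<bar> \<le> (a / 100)\<^sup>2 / 2" "\<rho> \<le> 0"
  shows "profile a \<beta> \<rho> L (C_sol \<rho>) (S_sol \<rho>)"
proof -
  define t where "t = sqrt (- \<rho>)"
  have t: "0 \<le> t" "t * t = - \<rho>" using rho(3) by (simp_all add: t_def)
  have t0: "t = 0 \<longleftrightarrow> \<rho> = 0" by (simp add: t_def)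
  have "t\<^sup>2 \<le> (a / 100)\<^sup>2" using rho(2) t by (simp add: power2_eq_square)
  then have tk: "t \<le> a / 100" using a by (intro power2_le_imp_le[of t "a / 100"]) auto
  have C: "C_sol \<rho> = (\<lambda>x. cosh (t * x))" and S: "S_sol \<rho> = (\<lambda>x. if t = 0 then x else sinh (t * x) / t)"
    using rho(3) t0 by (auto simp: fun_eq_iff C_sol_def S_sol_def t_def)
  have le_sinh: "y \<le> sinh y" if "0 \<le> y" for y :: real
  proof -
    have "sinh 0 - 0 \<le> sinh y - y"
    proof (rule DERIV_nonneg_imp_nondecreasing[OF that, where f = "\<lambda>y. sinh y - y"])
      fix z :: real
      have "((\<lambda>y. sinh y - y) has_real_derivative cosh z - 1) (at z)"
        by (auto intro!: derivative_eq_intros)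
      then show "\<exists>d. ((\<lambda>y. sinh y - y) has_real_derivative d) (at z) \<and> 0 \<le> d"
        using cosh_real_ge_1[of z] by (intro exI[of _ "cosh z - 1"]) auto
    qed
    then show ?thesis by simp
  qed
  have S_ge: "x \<le> S_sol \<rho> x \<and> S_sol \<rho> x \<le> x * exp (t * x) \<and> t * S_sol \<rho> x = sinh (t * x)" if x: "0 \<le> x" for x
  proof (cases "t = 0")
    case False
    then have t1: "0 < t" using t by simp
    have tx: "0 \<le> t * x" using t x by simp
    have "exp (t * x) * (1 - exp (- 2 * (t * x))) \<le> exp (t * x) * (2 * (t * x))"
      using exp_ge_add_one_self[of "- 2 * (t * x)"] by (intro mult_left_mono) auto
    moreover have "exp (t * x) * (1 - exp (- 2 * (t * x))) = 2 * sinh (t * x)"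
      by (simp add: sinh_def right_diff_distrib flip: exp_add)
    ultimately have "2 * sinh (t * x) \<le> exp (t * x) * (2 * (t * x))" by (simp only:)
    then have "sinh (t * x) \<le> t * x * exp (t * x)" by (simp add: mult_ac)
    then have "sinh (t * x) / t \<le> x * exp (t * x)" using t1 by (simp add: field_simps)
    moreover have "t * x \<le> sinh (t * x)" by (rule le_sinh[OF tx])
    then have "x \<le> sinh (t * x) / t" using t1 by (simp add: field_simps)
    ultimately show ?thesis using t1 by (simp add: S)
  qed (simp add: S)
  show ?thesis
  proof
    show "0 < a" "a \<le> 1 / 2" "\<rho> = 2 * a * \<beta> - a\<^sup>2" "\<bar>\<rho>\<bar> \<le> (a / 100)\<^sup>2 / 2" by fact+
    show "(C_sol \<rho> has_real_derivative - \<rho> * S_sol \<rho> x) (at x)" for x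
    proof -
      have "(C_sol \<rho> has_real_derivative t * sinh (t * x)) (at x)"
        unfolding C by (auto intro!: derivative_eq_intros)
      moreover have "t * sinh (t * x) = - \<rho> * S_sol \<rho> x"
        unfolding S t(2)[symmetric] by simp
      ultimately show ?thesis by (simp only:)
    qed
    show "(S_sol \<rho> has_real_derivative C_sol \<rho> x) (at x)" for x
    proof (cases "t = 0")
      case False
      then have "S_sol \<rho> = (\<lambda>x. sinh (t * x) / t)" by (simp add: S)
      then show ?thesis using False unfolding C by (auto intro!: derivative_eq_intros)
    qed (simp add: C S)
    show "C_sol \<rho> 0 = 1" "S_sol \<rho> 0 = 0" by (simp_all add: C S)
    fix x assume x: "0 \<le> x" "x \<le> L"
    note Sx = S_ge[OF x(1)]
    have kx: "t * x \<le> a / 100 * x" using tk x by (intro mult_right_mono) auto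
    have S0: "0 \<le> S_sol \<rho> x" using Sx x by linarith
    then show "0 \<le> S_sol \<rho> x" .
    have ch: "cosh (t * x) \<le> exp (t * x)" using t x by (simp add: cosh_def)
    show "C_sol \<rho> x \<le> exp (a / 100 * x)" unfolding C using ch kx by (meson exp_le_cancel_iff order_trans)
    have "x * exp (t * x) \<le> x * exp (a / 100 * x)" using kx x by (intro mult_left_mono) auto
    then show "S_sol \<rho> x \<le> x * exp (a / 100 * x)" using Sx by linarith
    have "1 \<le> cosh (t * x)" by (rule cosh_real_ge_1)
    moreover have "0 \<le> a / 100 * S_sol \<rho> x" using a S0 by (intro mult_nonneg_nonneg) auto
    ultimately show "1 \<le> C_sol \<rho> x + a / 100 * S_sol \<rho> x" unfolding C by linarith
    have "cosh (t * x) = sinh (t * x) + exp (- (t * x))" by (simp add: cosh_def sinh_def field_simps)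
    moreover have "exp (- (t * x)) \<le> 1" using t x by simp
    moreover have "t * S_sol \<rho> x \<le> a / 100 * S_sol \<rho> x" using tk S0 by (intro mult_right_mono) auto
    ultimately show "C_sol \<rho> x \<le> 1 + a / 100 * S_sol \<rho> x" unfolding C using Sx by linarith
  qed
qed

theorem theorem2p2:
  fixes \<gamma> \<beta>c :: real
  assumes "0 \<le> \<gamma>" and "\<gamma> < 1 / 2"
    and "\<beta>c = 1 / 4 - \<gamma> / 2"
  shows "\<exists>M :: real \<Rightarrow> real. (\<forall>\<epsilon>>0. 0 < M \<epsilon>) \<and>
    (\<forall>\<beta> :: nat \<Rightarrow> real.
      (\<forall>n\<ge>1. 0 < \<beta> n) \<longrightarrow>
      \<beta> \<longlonglongrightarrow> \<beta>c \<longrightarrow>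
      limsup (\<lambda>n. ereal (4 * \<beta>c * (\<beta> n - \<beta>c) * (ln (real n))\<^sup>2)) < ereal (pi\<^sup>2) \<longrightarrow>
      (\<exists>n0 :: nat. \<forall>n\<ge>n0. \<forall>\<epsilon>>0.
        measure_pmf.prob (growing_graph \<gamma> (\<beta> n) n)
          {E. real (card (largest_component n E)) /
                ((sqrt (real n) / ln (real n)) /
                  sinc_sqrt (4 * \<beta>c * (\<beta> n - \<beta>c) * (ln (real n))\<^sup>2))
              \<in> {1 / M \<epsilon>..M \<epsilon>}}
          \<ge> 1 - \<epsilon>))"
proof -
  define a where "a = 1 / 2 - \<gamma>"
  have a: "0 < a" "a \<le> 1 / 2" and \<gamma>: "\<gamma> = 1 / 2 - a" and \<beta>c: "\<beta>c = a / 2"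
    using assms by (simp_all add: a_def)
  have "\<exists>n0 :: nat. \<forall>n\<ge>n0. \<forall>\<epsilon>>0.
        measure_pmf.prob (growing_graph \<gamma> (\<beta> n) n)
          {E. real (card (largest_component n E)) /
                ((sqrt (real n) / ln (real n)) /
                  sinc_sqrt (4 * \<beta>c * (\<beta> n - \<beta>c) * (ln (real n))\<^sup>2))
              \<in> {1 / M_const a \<epsilon>..M_const a \<epsilon>}}
          \<ge> 1 - \<epsilon>"
    if conv: "\<beta> \<longlonglongrightarrow> \<beta>c"
      and lim: "limsup (\<lambda>n. ereal (4 * \<beta>c * (\<beta> n - \<beta>c) * (ln (real n))\<^sup>2)) < ereal (pi\<^sup>2)"
    for \<beta> :: "nat \<Rightarrow> real"
  proof -
    define \<rho> where "\<rho> = (\<lambda>n. 2 * a * \<beta> n - a\<^sup>2)"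
    have \<rho>: "4 * \<beta>c * (\<beta> n - \<beta>c) = \<rho> n" for n
      by (simp add: \<rho>_def \<beta>c field_simps power2_eq_square)
    \<comment> \<open>The strict limsup leaves room for a real \<open>z\<close> below
      \<open>pi^2\<close>; the root \<open>r\<close> eventually bounds the angle
      \<open>sqrt \<rho> * ln n\<close>. As \<open>z\<close> may be negative, \<open>max\<close> is
      taken.\<close>
    obtain z where z: "limsup (\<lambda>n. ereal (4 * \<beta>c * (\<beta> n - \<beta>c) * (ln (real n))\<^sup>2)) < ereal z" "ereal z < ereal (pi\<^sup>2)"
      using ereal_dense2[OF lim] by blast
    define r where "r = sqrt (max z 0)"
    have r: "0 \<le> r" "r < pi"
    proof -
      have "r < sqrt (pi\<^sup>2)" unfolding r_def using z(2) by (intro real_sqrt_less_mono) auto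
      then show "r < pi" by simp
    qed (simp add: r_def)
    have cr: "0 < cos (r / 2)" using r by (intro cos_gt_zero_pi) auto
    \<comment> \<open>The smallness required of \<open>\<rho>\<close> depends on the sequence
      through \<open>r\<close>; it influences \<open>n0\<close> but not
      \<open>M_const\<close>.\<close>
    define \<delta> where "\<delta> = min ((a / 100)\<^sup>2 / 2) ((a / 100 * cos (r / 2))\<^sup>2)"
    have \<delta>: "0 < \<delta>" using a cr by (simp add: \<delta>_def)
    have "\<rho> \<longlonglongrightarrow> 2 * a * \<beta>c - a\<^sup>2" unfolding \<rho>_def by (intro tendsto_intros conv)
    then have "\<rho> \<longlonglongrightarrow> 0" by (simp add: \<beta>c power2_eq_square)
    then have ev1: "eventually (\<lambda>n. \<bar>\<rho> n\<bar> < \<delta>) sequentially"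
      using \<delta> by (auto simp: tendsto_iff dist_real_def)
    have ev2: "eventually (\<lambda>n. \<rho> n * (ln (real n))\<^sup>2 < z) sequentially"
      using Limsup_lessD[OF z(1)] unfolding \<rho> by simp
    have "filterlim (\<lambda>n::nat. ln (real n) - ln (ln (real n))) at_top at_top" by real_asymp
    then have ev3: "eventually (\<lambda>n. 100 * ln 2 / a \<le> ln (real n) - ln (ln (real n))) sequentially"
      by (simp add: filterlim_at_top)
    have ev4: "eventually (\<lambda>n::nat. 9 \<le> ln (real n)) sequentially" by real_asymp
    have ev5: "eventually (\<lambda>n::nat. 4 * ln (real n) \<le> real n) sequentially" by real_asymp
    have "eventually (\<lambda>n. \<forall>\<epsilon>>0.
        measure_pmf.prob (growing_graph \<gamma> (\<beta> n) n)
          {E. real (card (largest_component n E)) /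
                ((sqrt (real n) / ln (real n)) /
                  sinc_sqrt (4 * \<beta>c * (\<beta> n - \<beta>c) * (ln (real n))\<^sup>2))
              \<in> {1 / M_const a \<epsilon>..M_const a \<epsilon>}}
          \<ge> 1 - \<epsilon>) sequentially"
      using ev1 ev2 ev3 ev4 ev5 eventually_ge_at_top[of "1::nat"]
    proof eventually_elim
      case (elim n)
      define L where "L = ln (real n)"
      have L: "0 < L" using elim by (simp add: L_def)
      have small: "\<bar>\<rho> n\<bar> \<le> (a / 100)\<^sup>2 / 2" "\<bar>\<rho> n\<bar> \<le> (a / 100 * cos (r / 2))\<^sup>2"
        using elim(1) by (auto simp: \<delta>_def)
      have rho_n: "\<rho> n = 2 * a * \<beta> n - a\<^sup>2" by (simp add: \<rho>_def)
      have prof: "profile a (\<beta> n) (\<rho> n) L (C_sol (\<rho> n)) (S_sol (\<rho> n))"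
      proof (cases "0 < \<rho> n")
        case True
        have "sqrt (\<rho> n) * L = sqrt (\<rho> n * L\<^sup>2)" using L by (simp add: real_sqrt_mult)
        also have "\<dots> \<le> r" unfolding r_def using elim(2) by (intro real_sqrt_le_mono) (simp add: L_def)
        finally have 1: "sqrt (\<rho> n) * L \<le> r" .
        have "sqrt (\<rho> n) \<le> sqrt ((a / 100 * cos (r / 2))\<^sup>2)"
          using small(2) by (intro real_sqrt_le_mono) auto
        also have "\<dots> = a / 100 * cos (r / 2)" using a cr by simp
        finally show ?thesis using profile_pos[OF a rho_n small(1) True 1 r(2)] by simp
      next
        case False
        then show ?thesis using profile_nonpos[OF a rho_n small(1)] by simp
      qed
      have ratio: "sqrt (real n) / ln (real n) / sinc_sqrt (4 * \<beta>c * (\<beta> n - \<beta>c) * (ln (real n))\<^sup>2) = sqrt (real n) / S_sol (\<rho> n) L"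
        unfolding \<rho> S_sol_eq_sinc_sqrt[OF L] by (simp add: L_def)
      show ?case
        unfolding ratio \<gamma>
        using profile.prob_largest_component_bounds[OF prof] elim by (simp add: L_def)
    qed
    then show ?thesis by (simp add: eventually_sequentially)
  qed
  moreover have "\<forall>\<epsilon>>0. 0 < M_const a \<epsilon>"
    using M_const_ge(1)[OF a(1)] by (meson less_le_trans zero_less_one)
  ultimately show ?thesis by blast
qed

end
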